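(* For every $\phi\in\operatorname{Hom}^+(\mathcal{A}^0,\mathbb{R})$ (where $\mathcal{A}^0$ is the flag algebra of unlabelled tournaments), we have $$\boldsymbol{\phi^A}(\mathrm{Tr}_3^A)=\frac14\quad\text{almost surely}$$ if and only if $\phi$ is the quasi-random homomorphism $\phi_{\mathrm{qr}}$.
   Context: A tournament is a finite set $V(T)$ together with, for each pair of distinct vertices $u,v$, exactly one of the arcs $\langle u,v\rangle$ (''$u$ beats $v$''), $\langle v,u\rangle$. Types and flags. Let $\sigma$ be either the empty type $0$ (with $|\sigma|=0$) or the type $A$ (with $|\sigma|=2$), where $A$ is the tournament on vertices labelled $1,2$ in which $1$ beats $2$. A $\sigma$-flag is a tournament together with an embedding of $\sigma$ into it: a $0$-flag is just a tournament, and an $A$-flag is a tournament with two distinguished vertices labelled $1$ and $2$ such that $1$ beats $2$. Isomorphisms of flags must preserve labels. $\mathcal{F}^\sigma$ is the set of isomorphism classes of finite $\sigma$-flags and $\mathcal{F}^\sigma_\ell$ those with $\ell$ vertices in total. For $F\in\mathcal{F}^\sigma_\ell$ and a $\sigma$-flag $G$ with at least $\ell$ vertices, $p(F,G)$ is the probability that a uniformly random $\ell$-element set of vertices of $G$ containing all labelled vertices induces a $\sigma$-flag isomorphic to $F$. For $F_i\in\mathcal{F}^\sigma_{\ell_i}$ ($i=1,2$) and $G$ with at least $\ell_1+\ell_2-|\sigma|$ vertices, $p(F_1,F_2;G)$ is the probability that a uniformly random pair of vertex sets of sizes $\ell_1,\ell_2$ whose intersection is exactly the set of labelled vertices induces $\sigma$-flags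 isomorphic to $F_1$ and $F_2$, respectively. Flag algebras. $\mathcal{A}^\sigma$ is the quotient of the real vector space with basis $\mathcal{F}^\sigma$ by the subspace spanned by all $F-\sum_{G\in\mathcal{F}^\sigma_m}p(F,G)G$ with $F\in\mathcal{F}^\sigma_\ell$, $m\geq\ell$. It is a commutative algebra with product induced by $F_1\cdot F_2=\sum_{G\in\mathcal{F}^\sigma_m}p(F_1,F_2;G)G$ for any $m\geq \ell_1+\ell_2-|\sigma|$ (well defined in the quotient); its unit $1_\sigma$ is the flag with $|\sigma|$ vertices. $\operatorname{Hom}^+(\mathcal{A}^\sigma,\mathbb{R})$ is the set of unital real algebra homomorphisms $\psi:\mathcal{A}^\sigma\to\mathbb{R}$ with $\psi(F)\geq0$ for all $F\in\mathcal{F}^\sigma$, viewed as a compact subset of $[0,1]^{\mathcal{F}^\sigma}$ with the product topology and its Borel $\sigma$-algebra. (Elements of $\operatorname{Hom}^+(\mathcal{A}^0,\mathbb{R})$ are exactly the functionals $\phi(T)=\lim_{n\to\infty}p(T,T_n)$ for sequences $\{T_n\}$ of tournaments with $|V(T_n)|\to\infty$ for which all these limits exist.) Downward operator and extensions. For an $A$-flag $F$ with underlying unlabelled tournament $M$, let $\llbracket F\rrbracket_A = q(F)\,M\in\mathcal{A}^0$, where $q(F)$ is the probability that a uniformly random ordered pair of distinct vertices of $M$, labelled $1$ and $2$ in order, turns $M$ into an $A$-flag isomorphic to $F$; this extends to a linear map $\llbracket\cdot\rrbracket_A:\mathcal{A}^A\to\mathcal{A}^0$, and $\llbracket 1_A\rrbracket_A=\frac12\cdot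 1$, where $1$ is the unit of $\mathcal{A}^0$. For $\phi\in\operatorname{Hom}^+(\mathcal{A}^0,\mathbb{R})$, $\boldsymbol{\phi^A}$ denotes the random variable with values in $\operatorname{Hom}^+(\mathcal{A}^A,\mathbb{R})$, unique in distribution, such that $\mathbf{E}[\boldsymbol{\phi^A}(F)]=\phi(\llbracket F\rrbracket_A)/\phi(\llbracket 1_A\rrbracket_A)$ for every $F\in\mathcal{F}^A$. The flag $\mathrm{Tr}_3^A$ is the $A$-flag on three vertices in which the unlabelled vertex is beaten by vertex $1$ and beats vertex $2$ (and $1$ beats $2$). The quasi-random homomorphism $\phi_{\mathrm{qr}}\in\operatorname{Hom}^+(\mathcal{A}^0,\mathbb{R})$ is the almost sure limit of uniformly random tournaments (each arc orientation picked independently with probability $1/2$) as the number of vertices goes to infinity; explicitly, $\phi_{\mathrm{qr}}(T)=\dfrac{|V(T)|!}{|\operatorname{Aut}(T)|\cdot 2^{\binom{|V(T)|}{2}}}$ for every tournament $T$, where $\operatorname{Aut}(T)$ is the automorphism group of $T$. *)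

theory Defs
  imports
    "HOL-Probability.Probability"
    "HOL-Analysis.Finite_Function_Topology"
    "HOL-Algebra.QuotRing"
    "HOL-Algebra.Algebraic_Closure_Type"
begin

section \<open>Tournaments and flags\<close>

definition tournament :: "'a set \<Rightarrow> ('a \<times> 'a) set \<Rightarrow> bool" where
  "tournament V E \<longleftrightarrow> finite V \<and> E \<subseteq> V \<times> V \<and> (\<forall>v. (v, v) \<notin> E) \<and>
     (\<forall>u\<in>V. \<forall>v\<in>V. u \<noteq> v \<longrightarrow> ((u, v) \<in> E) \<noteq> ((v, u) \<in> E))"

text \<open>The empty type \<open>0\<close> and the type \<open>A\<close> consisting of a single arc from \<open>1\<close> to \<open>2\<close>.\<close>

datatype ftype = Type_0 | Type_A

fun type_size :: "ftype \<Rightarrow> nat" where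
  "type_size Type_0 = 0"
| "type_size Type_A = 2"

text \<open>
  A concrete flag. The list \<open>labels\<close> is the embedding of the type: its \<open>i\<close>-th entry
  (counting from 1) is the vertex labelled \<open>i\<close>. Every finite flag is isomorphic to one
  whose vertices are natural numbers.
\<close>

record preflag =
  verts :: "nat set"
  arcs :: "(nat \<times> nat) set"
  labels :: "nat list"

fun embeds_type :: "ftype \<Rightarrow> preflag \<Rightarrow> bool" where
  "embeds_type Type_0 G \<longleftrightarrow> labels G = []"
| "embeds_type Type_A G \<longleftrightarrow> (\<exists>u v. labels G = [u, v] \<and> (u, v) \<in> arcs G)"

definition is_preflag :: "ftype \<Rightarrow> preflag \<Rightarrow> bool" where
  "is_preflag \<sigma> G \<longleftrightarrow> tournament (verts G) (arcs G) \<and> embeds_type \<sigma> G"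

definition iso_map :: "(nat \<Rightarrow> nat) \<Rightarrow> preflag \<Rightarrow> preflag \<Rightarrow> bool" where
  "iso_map f G H \<longleftrightarrow> bij_betw f (verts G) (verts H) \<and>
     (\<forall>u\<in>verts G. \<forall>v\<in>verts G. (u, v) \<in> arcs G \<longleftrightarrow> (f u, f v) \<in> arcs H) \<and>
     labels H = map f (labels G)"

definition flag_iso :: "preflag \<Rightarrow> preflag \<Rightarrow> bool" (infix \<open>\<simeq>\<^sub>F\<close> 50) where
  "G \<simeq>\<^sub>F H \<longleftrightarrow> (\<exists>\<sigma>. is_preflag \<sigma> G \<and> is_preflag \<sigma> H) \<and> (\<exists>f. iso_map f G H)"

lemma labels_subset: "is_preflag \<sigma> G \<Longrightarrow> set (labels G) \<subseteq> verts G"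
  by (cases \<sigma>) (auto simp: is_preflag_def tournament_def)

lemma is_preflag_unique: "is_preflag \<sigma> G \<Longrightarrow> is_preflag \<tau> G \<Longrightarrow> \<sigma> = \<tau>"
  by (cases \<sigma>; cases \<tau>) (auto simp: is_preflag_def)

lemma flag_iso_sym:
  assumes "G \<simeq>\<^sub>F H"
  shows "H \<simeq>\<^sub>F G"
proof -
  from assms obtain \<sigma> f where \<sigma>: "is_preflag \<sigma> G" "is_preflag \<sigma> H" and f: "iso_map f G H"
    by (auto simp: flag_iso_def)
  let ?g = "inv_into (verts G) f"
  from f have b: "bij_betw f (verts G) (verts H)" by (simp add: iso_map_def)
  have "map ?g (labels H) = map ?g (map f (labels G))" using f by (simp add: iso_map_def)
  also have "\<dots> = labels G"
    using labels_subset[OF \<sigma>(1)] b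
    by (auto simp: bij_betw_def subset_iff intro!: map_idI)
  finally have l: "labels G = map ?g (labels H)" by simp
  have "(u, v) \<in> arcs H \<longleftrightarrow> (?g u, ?g v) \<in> arcs G" if "u \<in> verts H" "v \<in> verts H" for u v
  proof -
    have g: "f (?g u) = u" "f (?g v) = v" "?g u \<in> verts G" "?g v \<in> verts G"
      using that b by (auto simp: bij_betw_inv_into_right bij_betw_def inv_into_into)
    with f have "(?g u, ?g v) \<in> arcs G \<longleftrightarrow> (f (?g u), f (?g v)) \<in> arcs H"
      unfolding iso_map_def by blast
    then show ?thesis by (simp only: g)
  qed
  then have "iso_map ?g H G"
    using bij_betw_inv_into[OF b] l by (simp add: iso_map_def)
  with \<sigma> show ?thesis by (auto simp: flag_iso_def)
qed

lemma flag_iso_trans: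
  assumes "G \<simeq>\<^sub>F H" "H \<simeq>\<^sub>F K"
  shows "G \<simeq>\<^sub>F K"
proof -
  from assms(1) obtain \<sigma> f where 1: "is_preflag \<sigma> G" "is_preflag \<sigma> H" "iso_map f G H"
    by (auto simp: flag_iso_def)
  from assms(2) obtain \<tau> g where 2: "is_preflag \<tau> H" "is_preflag \<tau> K" "iso_map g H K"
    by (auto simp: flag_iso_def)
  have "\<sigma> = \<tau>" using 1 2 is_preflag_unique by blast
  moreover have "iso_map (g \<circ> f) G K"
    using 1(3) 2(3) unfolding iso_map_def by (auto intro: bij_betw_trans dest: bij_betwE)
  ultimately show ?thesis using 1 2 by (auto simp: flag_iso_def)
qed

lemma flag_iso_refl: "is_preflag \<sigma> G \<Longrightarrow> G \<simeq>\<^sub>F G"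
  unfolding flag_iso_def iso_map_def
  by (intro conjI exI[of _ \<sigma>] exI[of _ "\<lambda>x. x"]) (auto simp: bij_betw_def)

text \<open>Isomorphism classes of finite flags, of both types.\<close>

quotient_type flag = preflag / partial: flag_iso
proof (rule part_equivpI)
  show "\<exists>x. x \<simeq>\<^sub>F x"
    by (rule exI[of _ "\<lparr>verts = {}, arcs = {}, labels = []\<rparr>"], rule flag_iso_refl[of Type_0])
       (auto simp: is_preflag_def tournament_def)
  show "symp flag_iso" by (rule sympI) (rule flag_iso_sym)
  show "transp flag_iso" by (rule transpI) (rule flag_iso_trans)
qed

definition flags :: "ftype \<Rightarrow> flag set" where
  "flags \<sigma> = {F. is_preflag \<sigma> (rep_flag F)}"

definition flag_size :: "flag \<Rightarrow> nat" where
  "flag_size F = card (verts (rep_flag F))"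

definition flags_of_size :: "ftype \<Rightarrow> nat \<Rightarrow> flag set" where
  "flags_of_size \<sigma> l = {F \<in> flags \<sigma>. flag_size F = l}"

text \<open>Since the sums below range over \<^term>\<open>flags_of_size \<sigma> l\<close>, its finiteness matters.\<close>

lemma abs_rep_flag: "abs_flag (rep_flag F) = F"
  by (rule Quotient3_abs_rep[OF Quotient3_flag])

lemma flag_eq_iff: "F = H \<longleftrightarrow> rep_flag F \<simeq>\<^sub>F rep_flag H"
  by (rule Quotient3_rel_rep[OF Quotient3_flag, symmetric])

lemma finite_flags_of_size: "finite (flags_of_size \<sigma> l)"
proof -
  define S where "S = (\<lambda>(E, L). \<lparr>verts = {..<l}, arcs = E, labels = L\<rparr>) `
    (Pow ({..<l} \<times> {..<l}) \<times> {L. set L \<subseteq> {..<l} \<and> length L \<le> 2})"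
  have "finite S"
    unfolding S_def by (intro finite_imageI finite_cartesian_product finite_lists_length_le) auto
  moreover have "flags_of_size \<sigma> l \<subseteq> abs_flag ` S"
  proof
    fix F assume "F \<in> flags_of_size \<sigma> l"
    then have G: "is_preflag \<sigma> (rep_flag F)" and c: "card (verts (rep_flag F)) = l"
      by (auto simp: flags_of_size_def flags_def flag_size_def)
    define G where "G = rep_flag F"
    note G = G[folded G_def] and c = c[folded G_def]
    have t: "tournament (verts G) (arcs G)" using G by (simp add: is_preflag_def)
    then obtain f where f: "bij_betw f (verts G) {..<l}"
      using ex_bij_betw_finite_nat[of "verts G"] c
      by (auto simp: tournament_def lessThan_atLeast0)
    define H where "H = \<lparr>verts = {..<l}, arcs = map_prod f f ` arcs G, labels = map f (labels G)\<rparr>"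
    have E: "arcs G \<subseteq> verts G \<times> verts G" using t by (simp add: tournament_def)
    have inj: "inj_on f (verts G)" and im: "f ` verts G = {..<l}" using f by (auto simp: bij_betw_def)
    have arc: "(f u, f v) \<in> arcs H \<longleftrightarrow> (u, v) \<in> arcs G" if "u \<in> verts G" "v \<in> verts G" for u v
    proof
      assume "(f u, f v) \<in> arcs H"
      then obtain a b where ab: "(a, b) \<in> arcs G" "f u = f a" "f v = f b"
        by (auto simp: H_def)
      with E have "a \<in> verts G" "b \<in> verts G" by auto
      with ab that inj have "u = a" "v = b" by (auto dest: inj_onD)
      with ab show "(u, v) \<in> arcs G" by simp
    next
      assume "(u, v) \<in> arcs G"
      then show "(f u, f v) \<in> arcs H" unfolding H_def by (auto intro!: image_eqI[of _ _ "(u, v)"])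
    qed
    have iso: "iso_map f G H" using f arc by (auto simp: iso_map_def H_def)
    have "tournament {..<l} (arcs H)"
      unfolding tournament_def
    proof (intro conjI allI ballI impI)
      show "arcs H \<subseteq> {..<l} \<times> {..<l}" using E im by (auto simp: H_def)
      show "(v, v) \<notin> arcs H" for v
      proof
        assume v: "(v, v) \<in> arcs H"
        then obtain u where "u \<in> verts G" "v = f u" using E im by (auto simp: H_def)
        with v arc[of u u] t show False by (auto simp: tournament_def)
      qed
      fix u v assume "u \<in> {..<l}" "v \<in> {..<l}" "u \<noteq> v"
      then obtain a b where ab: "a \<in> verts G" "b \<in> verts G" "u = f a" "v = f b" "a \<noteq> b"
        using im by (metis (no_types, lifting) imageE)
      with t have "((a, b) \<in> arcs G) \<noteq> ((b, a) \<in> arcs G)"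
        unfolding tournament_def by blast
      with ab show "((u, v) \<in> arcs H) \<noteq> ((v, u) \<in> arcs H)"
        by (simp add: arc)
    qed auto
    moreover have "embeds_type \<sigma> H"
    proof (cases \<sigma>)
      case Type_0
      with G show ?thesis by (simp add: is_preflag_def H_def)
    next
      case Type_A
      with G obtain u v where uv: "labels G = [u, v]" "(u, v) \<in> arcs G"
        by (auto simp: is_preflag_def)
      with E arc[of u v] have "(f u, f v) \<in> arcs H" by blast
      with Type_A uv show ?thesis by (simp add: H_def)
    qed
    ultimately have H: "is_preflag \<sigma> H" by (simp add: is_preflag_def H_def)
    with G iso have "G \<simeq>\<^sub>F H" by (auto simp: flag_iso_def)
    then have "abs_flag G = abs_flag H"
      using Quotient3_rel[OF Quotient3_flag, of G H] by blast
    then have "F = abs_flag H" by (simp add: G_def abs_rep_flag)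
    moreover have "H \<in> S"
    proof -
      have "arcs H \<subseteq> {..<l} \<times> {..<l}" using E im by (auto simp: H_def)
      moreover have "set (labels H) \<subseteq> {..<l}" using labels_subset[OF H] by (simp add: H_def)
      moreover have "length (labels H) \<le> 2"
        using H by (cases \<sigma>) (auto simp: is_preflag_def)
      moreover have "H = (\<lambda>(E, L). \<lparr>verts = {..<l}, arcs = E, labels = L\<rparr>) (arcs H, labels H)"
        by (simp add: H_def)
      ultimately show ?thesis unfolding S_def by blast
    qed
    ultimately show "F \<in> abs_flag ` S" by blast
  qed
  ultimately show ?thesis by (meson finite_imageI finite_subset)
qed


section \<open>Densities\<close>

definition induced :: "preflag \<Rightarrow> nat set \<Rightarrow> preflag" where
  "induced G S = \<lparr>verts = S, arcs = arcs G \<inter> S \<times> S, labels = labels G\<rparr>"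

definition rooted_sets :: "preflag \<Rightarrow> nat \<Rightarrow> nat set set" where
  "rooted_sets G l = {S. set (labels G) \<subseteq> S \<and> S \<subseteq> verts G \<and> card S = l}"

definition density :: "flag \<Rightarrow> flag \<Rightarrow> real" where
  "density F G =
     real (card {S \<in> rooted_sets (rep_flag G) (flag_size F).
                   induced (rep_flag G) S \<simeq>\<^sub>F rep_flag F}) /
     real (card (rooted_sets (rep_flag G) (flag_size F)))"

definition rooted_pairs :: "preflag \<Rightarrow> nat \<Rightarrow> nat \<Rightarrow> (nat set \<times> nat set) set" where
  "rooted_pairs G l m =
     {(S, T). S \<in> rooted_sets G l \<and> T \<in> rooted_sets G m \<and> S \<inter> T = set (labels G)}"

definition density2 :: "flag \<Rightarrow> flag \<Rightarrow> flag \<Rightarrow> real" where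
  "density2 F\<^sub>1 F\<^sub>2 G =
     real (card {(S, T) \<in> rooted_pairs (rep_flag G) (flag_size F\<^sub>1) (flag_size F\<^sub>2).
                   induced (rep_flag G) S \<simeq>\<^sub>F rep_flag F\<^sub>1 \<and> induced (rep_flag G) T \<simeq>\<^sub>F rep_flag F\<^sub>2}) /
     real (card (rooted_pairs (rep_flag G) (flag_size F\<^sub>1) (flag_size F\<^sub>2)))"


section \<open>Flag algebras\<close>

text \<open>
  Formal linear combinations of flags are elements of \<^typ>\<open>flag \<Rightarrow>\<^sub>0 real\<close>. The product of two
  flags is expanded at the least admissible size \<open>\<ell>\<^sub>1 + \<ell>\<^sub>2 - |\<sigma>|\<close>; all other admissible sizes give
  the same element of the quotient by \<open>flag_relations\<close>.
\<close>

abbreviation vec :: "flag \<Rightarrow> flag \<Rightarrow>\<^sub>0 real" where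
  "vec F \<equiv> Poly_Mapping.single F 1"

definition flag_prod :: "ftype \<Rightarrow> flag \<Rightarrow> flag \<Rightarrow> flag \<Rightarrow>\<^sub>0 real" where
  "flag_prod \<sigma> F\<^sub>1 F\<^sub>2 =
     (\<Sum>G\<in>flags_of_size \<sigma> (flag_size F\<^sub>1 + flag_size F\<^sub>2 - type_size \<sigma>). density2 F\<^sub>1 F\<^sub>2 G *\<^sub>R vec G)"

definition unit_flag :: "ftype \<Rightarrow> flag" where
  "unit_flag \<sigma> = (case \<sigma> of
     Type_0 \<Rightarrow> abs_flag \<lparr>verts = {}, arcs = {}, labels = []\<rparr>
   | Type_A \<Rightarrow> abs_flag \<lparr>verts = {1, 2}, arcs = {(1, 2)}, labels = [1, 2]\<rparr>)"

definition free_flag_ring :: "ftype \<Rightarrow> (flag \<Rightarrow>\<^sub>0 real) ring" where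
  "free_flag_ring \<sigma> = \<lparr>
     carrier = {x. Poly_Mapping.keys x \<subseteq> flags \<sigma>},
     monoid.mult = (\<lambda>x y. \<Sum>F\<in>Poly_Mapping.keys x. \<Sum>H\<in>Poly_Mapping.keys y.
        (Poly_Mapping.lookup x F * Poly_Mapping.lookup y H) *\<^sub>R flag_prod \<sigma> F H),
     one = vec (unit_flag \<sigma>),
     ring.zero = 0,
     add = (+)\<rparr>"

definition flag_relations :: "ftype \<Rightarrow> (flag \<Rightarrow>\<^sub>0 real) set" where
  "flag_relations \<sigma> = span
     {vec F - (\<Sum>G\<in>flags_of_size \<sigma> m. density F G *\<^sub>R vec G) | F m. F \<in> flags \<sigma> \<and> flag_size F \<le> m}"

definition flag_algebra :: "ftype \<Rightarrow> (flag \<Rightarrow>\<^sub>0 real) set ring" where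
  "flag_algebra \<sigma> = free_flag_ring \<sigma> Quot flag_relations \<sigma>"

definition flag_class :: "ftype \<Rightarrow> (flag \<Rightarrow>\<^sub>0 real) \<Rightarrow> (flag \<Rightarrow>\<^sub>0 real) set" where
  "flag_class \<sigma> x = flag_relations \<sigma> +>\<^bsub>free_flag_ring \<sigma>\<^esub> x"


section \<open>Positive homomorphisms\<close>

definition algebra_homs :: "ftype \<Rightarrow> ((flag \<Rightarrow>\<^sub>0 real) set \<Rightarrow> real) set" where
  "algebra_homs \<sigma> = {\<psi> \<in> ring_hom (flag_algebra \<sigma>) (ring_of_type_algebra :: real ring).
     \<forall>c. \<forall>x\<in>carrier (free_flag_ring \<sigma>). \<psi> (flag_class \<sigma> (c *\<^sub>R x)) = c * \<psi> (flag_class \<sigma> x)}"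

text \<open>
  The positive homomorphisms, viewed as a subset of \<open>[0,1]\<close> to the power \<^term>\<open>flags \<sigma>\<close>: a
  homomorphism is identified with the family of its values on flags, which is
  \<^const>\<open>undefined\<close> outside \<^term>\<open>flags \<sigma>\<close>.
\<close>

definition Hom_plus :: "ftype \<Rightarrow> (flag \<Rightarrow> real) set" where
  "Hom_plus \<sigma> = {(\<lambda>F\<in>flags \<sigma>. \<psi> (flag_class \<sigma> (vec F))) | \<psi>.
     \<psi> \<in> algebra_homs \<sigma> \<and> (\<forall>F\<in>flags \<sigma>. 0 \<le> \<psi> (flag_class \<sigma> (vec F)))}"

definition Hom_plus_topology :: "ftype \<Rightarrow> (flag \<Rightarrow> real) topology" where
  "Hom_plus_topology \<sigma> =
     subtopology (product_topology (\<lambda>_. top_of_set {0..1}) (flags \<sigma>)) (Hom_plus \<sigma>)"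

definition Hom_plus_borel :: "ftype \<Rightarrow> (flag \<Rightarrow> real) measure" where
  "Hom_plus_borel \<sigma> = sigma (Hom_plus \<sigma>) {U. openin (Hom_plus_topology \<sigma>) U}"

text \<open>
  The value of a homomorphism on the class of a linear combination of flags, recovered from
  its values on flags.
\<close>

definition hom_eval :: "(flag \<Rightarrow> real) \<Rightarrow> (flag \<Rightarrow>\<^sub>0 real) \<Rightarrow> real" where
  "hom_eval \<phi> x = (\<Sum>F\<in>Poly_Mapping.keys x. Poly_Mapping.lookup x F * \<phi> F)"


section \<open>The downward operator and random extensions\<close>

definition unlabel :: "flag \<Rightarrow> flag" where
  "unlabel F = abs_flag ((rep_flag F)\<lparr>labels := []\<rparr>)"

definition labelling_prob :: "flag \<Rightarrow> real" where
  "labelling_prob F = (let M = rep_flag (unlabel F);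
                           P = {(u, v). u \<in> verts M \<and> v \<in> verts M \<and> u \<noteq> v}
     in real (card {(u, v) \<in> P. M\<lparr>labels := [u, v]\<rparr> \<simeq>\<^sub>F rep_flag F}) / real (card P))"

definition downward :: "flag \<Rightarrow> flag \<Rightarrow>\<^sub>0 real" where
  "downward F = labelling_prob F *\<^sub>R vec (unlabel F)"

text \<open>
  \<open>\<xi>\<close>, defined on the probability space \<open>M\<close>, is (a version of) the random extension
  \<open>\<phi>\<^sup>A\<close> of \<open>\<phi>\<close>. These conditions determine its distribution.
\<close>

definition random_extension ::
    "(flag \<Rightarrow> real) \<Rightarrow> 'w measure \<Rightarrow> ('w \<Rightarrow> flag \<Rightarrow> real) \<Rightarrow> bool" where
  "random_extension \<phi> M \<xi> \<longleftrightarrow> prob_space M \<and> \<xi> \<in> measurable M (Hom_plus_borel Type_A) \<and>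
     (\<forall>F\<in>flags Type_A. prob_space.expectation M (\<lambda>\<omega>. \<xi> \<omega> F) =
        hom_eval \<phi> (downward F) / hom_eval \<phi> (downward (unit_flag Type_A)))"

definition Tr3A :: flag where
  "Tr3A = abs_flag \<lparr>verts = {1, 2, 3}, arcs = {(1, 2), (1, 3), (3, 2)}, labels = [1, 2]\<rparr>"


section \<open>The quasi-random homomorphism\<close>

definition automorphisms :: "preflag \<Rightarrow> (nat \<Rightarrow> nat) set" where
  "automorphisms G = {f. f permutes verts G \<and> iso_map f G G}"

definition phi_qr :: "flag \<Rightarrow> real" where
  "phi_qr = (\<lambda>T\<in>flags Type_0.
     fact (flag_size T) / (real (card (automorphisms (rep_flag T))) * 2 ^ (flag_size T choose 2)))"

end

theory Submission
  imports Defs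
begin

text \<open>
  Let \<open>f(u, v)\<close> be \<open>1\<close> or \<open>-1\<close> according to whether the arc between \<open>u\<close> and \<open>v\<close> leaves or enters
  \<open>u\<close>, let \<open>d(u)\<close> be the sum of \<open>f(u, w)\<close> over all \<open>w\<close>, and let \<open>f\<^sup>2(u, v)\<close> be the sum of
  \<open>f(u, w) f(w, v)\<close>. If \<open>u\<close> beats \<open>v\<close> in a tournament on \<open>m\<close> vertices, then four times the number
  of \<open>w\<close> with \<open>u \<rightarrow> w \<rightarrow> v\<close> is \<open>m - 4 + d(u) - d(v) + f\<^sup>2(u, v)\<close>. The condition on \<open>\<phi>\<^sup>A\<close> says that
  this number is about \<open>m\<close> for almost all arcs.

  Already the mean of this identity over the arcs is useful. Since \<open>f\<close> is antisymmetric and \<open>f\<^sup>2\<close>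
  is symmetric, the differences \<open>d(u) - d(v)\<close> contribute the sum of all \<open>d(u)\<^sup>2\<close>, while \<open>f\<^sup>2\<close>
  contributes minus one half of it, up to lower order terms. Hence most \<open>d(u)\<close> are small. Then
  \<open>f\<^sup>2\<close> is small on most arcs, and by symmetry on most pairs, so that the trace of \<open>f\<^sup>4\<close>
  (the \<open>deviation\<close> below) is small (\<open>deviation_le\<close>). By the Cauchy-Schwarz inequality this bounds
  the cut norm of \<open>f\<close>, and a tournament whose sign kernel has small cut norm contains each fixed
  tournament with about the random density: requiring one arc after the other halves the number
  of embeddings each time (\<open>embeddings_telescope\<close>).

  No limit object is needed. A positive homomorphism \<open>\<phi>\<close> is, for every \<open>m\<close>, a probability
  distribution on the tournaments with \<open>m\<close> vertices, and its value on a smaller tournament is an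
  expected density (\<open>Hom_plus_chain\<close>, \<open>Hom_plus_sum\<close>). So the argument above is carried out in
  finite tournaments, with errors that are averaged against \<open>\<phi>\<close> and tend to \<open>0\<close> with \<open>m\<close>.

  Of \<open>\<phi>\<^sup>A(Tr\<^sub>3\<^sup>A)\<close> only the mean and the second moment matter, because it equals \<open>1/4\<close> almost surely
  if and only if they are \<open>1/4\<close> and \<open>1/16\<close>. Both are expectations of linear combinations of flags,
  the second one because \<open>\<phi>\<^sup>A\<close> is multiplicative, and hence are values of \<open>\<phi>\<close>
  (\<open>random_extension_AE_iff\<close>). Multiplicativity has to be read off from the quotient construction of
  the flag algebra, for which the relations must form an ideal (\<open>flag_relations_ideal\<close>).

  For the converse, \<open>\<phi>\<^sub>q\<^sub>r\<close> is the mean over all tournaments on a fixed vertex set (\<open>sum_phi_qr\<close>), and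
  on four vertices the two moments are found by counting.
\<close>

section \<open>Flags and their representatives\<close>

lemma preflag_arcsD:
  assumes "is_preflag \<sigma> G" "(u, v) \<in> arcs G"
  shows "u \<in> verts G" "v \<in> verts G" "u \<noteq> v" "(v, u) \<notin> arcs G"
proof -
  have t: "tournament (verts G) (arcs G)" using assms by (simp add: is_preflag_def)
  then show uv: "u \<in> verts G" "v \<in> verts G" "u \<noteq> v"
    using assms(2) by (auto simp: tournament_def)
  then show "(v, u) \<notin> arcs G"
    using t assms(2) unfolding tournament_def by blast
qed

lemma finite_verts: "is_preflag \<sigma> G \<Longrightarrow> finite (verts G)"
  by (auto simp: is_preflag_def tournament_def)

lemma is_preflag_iso: "G \<simeq>\<^sub>F H \<Longrightarrow> is_preflag \<sigma> G \<Longrightarrow> is_preflag \<sigma> H"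
  unfolding flag_iso_def using is_preflag_unique by blast

lemma abs_flag_eq_iff:
  assumes "is_preflag \<sigma> G" "is_preflag \<tau> H"
  shows "abs_flag G = abs_flag H \<longleftrightarrow> G \<simeq>\<^sub>F H"
  using Quotient3_rel[OF Quotient3_flag, of G H] flag_iso_refl assms by blast

lemma rep_abs_flag: "is_preflag \<sigma> G \<Longrightarrow> rep_flag (abs_flag G) \<simeq>\<^sub>F G"
  using Quotient3_rep_abs[OF Quotient3_flag] flag_iso_refl by blast

lemma iso_rep_flag_iff:
  assumes "is_preflag \<sigma> G"
  shows "G \<simeq>\<^sub>F rep_flag F \<longleftrightarrow> abs_flag G = F"
proof -
  have "rep_flag F \<simeq>\<^sub>F rep_flag F" by (simp add: flag_eq_iff[symmetric])
  then obtain \<tau> where "is_preflag \<tau> (rep_flag F)" unfolding flag_iso_def by blast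
  then show ?thesis using abs_flag_eq_iff[OF assms] by (metis abs_rep_flag)
qed

lemma abs_flag_in_flags:
  assumes "is_preflag \<sigma> G"
  shows "abs_flag G \<in> flags \<sigma>"
  using rep_abs_flag[OF assms] is_preflag_iso assms flag_iso_sym unfolding flags_def by blast

lemma flag_size_abs:
  assumes "is_preflag \<sigma> G"
  shows "flag_size (abs_flag G) = card (verts G)"
proof -
  obtain f where "iso_map f (rep_flag (abs_flag G)) G"
    using rep_abs_flag[OF assms] unfolding flag_iso_def by blast
  then show ?thesis
    unfolding flag_size_def iso_map_def using bij_betw_same_card by blast
qed

lemma preflag_rep: "F \<in> flags \<sigma> \<Longrightarrow> is_preflag \<sigma> (rep_flag F)"
  by (simp add: flags_def)

lemma card_labels:
  assumes "is_preflag \<sigma> G"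
  shows "card (set (labels G)) = type_size \<sigma>"
proof (cases \<sigma>)
  case Type_0
  then show ?thesis using assms by (simp add: is_preflag_def)
next
  case Type_A
  then obtain u v where "labels G = [u, v]" "(u, v) \<in> arcs G"
    using assms by (auto simp: is_preflag_def)
  then show ?thesis using preflag_arcsD(3)[OF assms] Type_A by auto
qed

lemma card_verts_ge: "is_preflag \<sigma> G \<Longrightarrow> type_size \<sigma> \<le> card (verts G)"
  by (metis card_labels card_mono finite_verts labels_subset)

lemma flag_size_ge: "F \<in> flags \<sigma> \<Longrightarrow> type_size \<sigma> \<le> flag_size F"
  using card_verts_ge preflag_rep by (auto simp: flag_size_def)

section \<open>Densities in concrete flags\<close>

abbreviation subflag :: "preflag \<Rightarrow> nat set \<Rightarrow> flag" where
  "subflag G S \<equiv> abs_flag (induced G S)"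

lemma rooted_setsD:
  assumes "S \<in> rooted_sets G l"
  shows "set (labels G) \<subseteq> S" "S \<subseteq> verts G" "card S = l"
  using assms by (auto simp: rooted_sets_def)

lemma verts_induced [simp]: "verts (induced G S) = S"
  and labels_induced [simp]: "labels (induced G S) = labels G"
  and arcs_induced [simp]: "arcs (induced G S) = arcs G \<inter> S \<times> S"
  by (simp_all add: induced_def)

lemma induced_induced: "S \<subseteq> U \<Longrightarrow> induced (induced G U) S = induced G S"
  by (auto simp: induced_def)

lemma is_preflag_induced:
  assumes "is_preflag \<sigma> G" "set (labels G) \<subseteq> S" "S \<subseteq> verts G"
  shows "is_preflag \<sigma> (induced G S)"
proof -
  have "finite S" using assms(3) finite_verts[OF assms(1)] by (rule finite_subset)
  moreover have "\<forall>u\<in>S. \<forall>v\<in>S. u \<noteq> v \<longrightarrow> ((u, v) \<in> arcs G) \<noteq> ((v, u) \<in> arcs G)"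
    using assms(1,3) unfolding is_preflag_def tournament_def by (meson subsetD)
  ultimately have "tournament S (arcs G \<inter> S \<times> S)"
    using preflag_arcsD(3)[OF assms(1)] unfolding tournament_def by blast
  then show ?thesis
    using assms(1,2) by (cases \<sigma>) (auto simp: is_preflag_def)
qed

lemma is_preflag_rooted: "is_preflag \<sigma> G \<Longrightarrow> S \<in> rooted_sets G l \<Longrightarrow> is_preflag \<sigma> (induced G S)"
  by (rule is_preflag_induced) (simp_all add: rooted_setsD)

lemma subflag_in_flags_of_size:
  "is_preflag \<sigma> G \<Longrightarrow> S \<in> rooted_sets G l \<Longrightarrow> subflag G S \<in> flags_of_size \<sigma> l"
  by (simp add: flags_of_size_def abs_flag_in_flags[OF is_preflag_rooted]
      flag_size_abs[OF is_preflag_rooted] rooted_setsD)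

lemma finite_rooted_sets: "is_preflag \<sigma> G \<Longrightarrow> finite (rooted_sets G l)"
  by (rule finite_subset[of _ "Pow (verts G)"]) (auto simp: finite_verts rooted_sets_def)

lemma finite_rooted_pairs: "is_preflag \<sigma> G \<Longrightarrow> finite (rooted_pairs G l m)"
  unfolding rooted_pairs_def
  by (rule finite_subset[of _ "rooted_sets G l \<times> rooted_sets G m"])
    (auto simp: finite_rooted_sets)

lemma card_rooted_sets:
  assumes G: "is_preflag \<sigma> G" and l: "type_size \<sigma> \<le> l"
  shows "card (rooted_sets G l) = (card (verts G) - type_size \<sigma>) choose (l - type_size \<sigma>)"
proof -
  let ?L = "set (labels G)"
  note fin = finite_verts[OF G] and sub = labels_subset[OF G] and cL = card_labels[OF G]
  have "bij_betw (\<lambda>S. S - ?L) (rooted_sets G l)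
          {B. B \<subseteq> verts G - ?L \<and> card B = l - type_size \<sigma>}"
  proof (rule bij_betwI[where g = "\<lambda>B. B \<union> ?L"])
    show "(\<lambda>S. S - ?L) \<in> rooted_sets G l \<rightarrow> {B. B \<subseteq> verts G - ?L \<and> card B = l - type_size \<sigma>}"
      using cL by (auto simp: rooted_sets_def card_Diff_subset)
    show "(\<lambda>B. B \<union> ?L) \<in> {B. B \<subseteq> verts G - ?L \<and> card B = l - type_size \<sigma>} \<rightarrow> rooted_sets G l"
    proof (intro Pi_I)
      fix B assume B: "B \<in> {B. B \<subseteq> verts G - ?L \<and> card B = l - type_size \<sigma>}"
      then have "finite B" using fin finite_subset by blast
      then have "card (B \<union> ?L) = card B + card ?L"
        using B by (intro card_Un_disjoint) auto
      then show "B \<union> ?L \<in> rooted_sets G l"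
        using B cL l sub by (auto simp: rooted_sets_def)
    qed
  qed (auto simp: rooted_sets_def)
  then have "card (rooted_sets G l) = card {B. B \<subseteq> verts G - ?L \<and> card B = l - type_size \<sigma>}"
    by (rule bij_betw_same_card)
  also have "\<dots> = card (verts G - ?L) choose (l - type_size \<sigma>)"
    using fin by (simp add: n_subsets)
  also have "card (verts G - ?L) = card (verts G) - type_size \<sigma>"
    using sub cL by (simp add: card_Diff_subset)
  finally show ?thesis .
qed

lemma iso_map_rooted:
  assumes f: "iso_map f G H" and G: "is_preflag \<sigma> G" and H: "is_preflag \<sigma> H"
    and S: "S \<in> rooted_sets G l"
  shows "f ` S \<in> rooted_sets H l" "subflag H (f ` S) = subflag G S"
proof -
  note SD = rooted_setsD[OF S]
  have bij: "bij_betw f (verts G) (verts H)" and lab: "labels H = map f (labels G)"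
    using f by (auto simp: iso_map_def)
  have bS: "bij_betw f S (f ` S)"
    using bij SD(2) by (meson bij_betw_subset)
  show *: "f ` S \<in> rooted_sets H l"
    using SD bij bS lab bij_betw_same_card[OF bS] unfolding rooted_sets_def
    by (auto simp: bij_betw_def)
  have "iso_map f (induced G S) (induced H (f ` S))"
    using f bS SD(2) unfolding iso_map_def by (auto simp: subset_iff)
  then have "induced G S \<simeq>\<^sub>F induced H (f ` S)"
    using is_preflag_rooted[OF G S] is_preflag_rooted[OF H *] unfolding flag_iso_def by blast
  then show "subflag H (f ` S) = subflag G S"
    using abs_flag_eq_iff[OF is_preflag_rooted[OF G S] is_preflag_rooted[OF H *]] by simp
qed

lemma iso_map_inv:
  assumes f: "iso_map f G H" and G: "is_preflag \<sigma> G"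
  shows "iso_map (inv_into (verts G) f) H G"
proof -
  let ?g = "inv_into (verts G) f"
  have b: "bij_betw f (verts G) (verts H)" using f by (simp add: iso_map_def)
  have "map ?g (labels H) = map ?g (map f (labels G))" using f by (simp add: iso_map_def)
  also have "\<dots> = labels G"
    using labels_subset[OF G] b
    by (auto simp: bij_betw_def subset_iff intro!: map_idI)
  finally have l: "labels G = map ?g (labels H)" by simp
  have "(u, v) \<in> arcs H \<longleftrightarrow> (?g u, ?g v) \<in> arcs G" if "u \<in> verts H" "v \<in> verts H" for u v
  proof -
    have g: "f (?g u) = u" "f (?g v) = v" "?g u \<in> verts G" "?g v \<in> verts G"
      using that b by (auto simp: bij_betw_inv_into_right bij_betw_def inv_into_into)
    with f have "(?g u, ?g v) \<in> arcs G \<longleftrightarrow> (f (?g u), f (?g v)) \<in> arcs H"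
      unfolding iso_map_def by blast
    then show ?thesis by (simp only: g)
  qed
  then show ?thesis
    using bij_betw_inv_into[OF b] l by (simp add: iso_map_def)
qed

lemma bij_betw_rooted_sets:
  assumes f: "iso_map f G H" and G: "is_preflag \<sigma> G" and H: "is_preflag \<sigma> H"
  shows "bij_betw ((`) f) (rooted_sets G l) (rooted_sets H l)"
proof -
  let ?g = "inv_into (verts G) f"
  have g: "iso_map ?g H G" by (rule iso_map_inv[OF f G])
  have b: "bij_betw f (verts G) (verts H)" using f by (simp add: iso_map_def)
  show ?thesis
  proof (rule bij_betwI[where g = "(`) ?g"])
    show "(`) f \<in> rooted_sets G l \<rightarrow> rooted_sets H l"
      using iso_map_rooted(1)[OF f G H] by blast
    show "(`) ?g \<in> rooted_sets H l \<rightarrow> rooted_sets G l"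
      using iso_map_rooted(1)[OF g H G] by blast
    show "?g ` f ` S = S" if "S \<in> rooted_sets G l" for S
      using that b unfolding rooted_sets_def bij_betw_def
      by (simp add: inv_into_image_cancel)
    show "f ` ?g ` S = S" if "S \<in> rooted_sets H l" for S
      using that b unfolding rooted_sets_def bij_betw_def
      by (simp add: image_inv_into_cancel)
  qed
qed

lemma card_eq_sum_of_bool: "finite A \<Longrightarrow> real (card {x \<in> A. P x}) = (\<Sum>x\<in>A. of_bool (P x))"
  by (simp add: of_bool_def sum.If_cases Int_def)

text \<open>
  Densities are defined by chosen representatives of isomorphism classes. An isomorphism to the
  representative carries rooted sets to rooted sets, so that any other member of the class will do.
\<close>

lemma density_abs:
  assumes G: "is_preflag \<sigma> G"
  shows "density F (abs_flag G) =
    (\<Sum>S\<in>rooted_sets G (flag_size F). of_bool (subflag G S = F)) /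
    real (card (rooted_sets G (flag_size F)))"
proof -
  let ?R = "rep_flag (abs_flag G)" and ?l = "flag_size F"
  have iso: "G \<simeq>\<^sub>F ?R" by (rule flag_iso_sym[OF rep_abs_flag[OF G]])
  then obtain f where f: "iso_map f G ?R" unfolding flag_iso_def by blast
  have R: "is_preflag \<sigma> ?R" using is_preflag_iso[OF iso G] .
  note bij = bij_betw_rooted_sets[OF f G R, of ?l]
  have "real (card {S \<in> rooted_sets ?R ?l. induced ?R S \<simeq>\<^sub>F rep_flag F}) =
      (\<Sum>S\<in>rooted_sets ?R ?l. of_bool (subflag ?R S = F))"
    unfolding card_eq_sum_of_bool[OF finite_rooted_sets[OF R]]
    by (intro sum.cong refl) (simp add: iso_rep_flag_iff[OF is_preflag_rooted[OF R]])
  also have "\<dots> = (\<Sum>S\<in>rooted_sets G ?l. of_bool (subflag ?R (f ` S) = F))"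
    by (rule sum.reindex_bij_betw[OF bij, symmetric])
  also have "\<dots> = (\<Sum>S\<in>rooted_sets G ?l. of_bool (subflag G S = F))"
    by (intro sum.cong refl) (simp add: iso_map_rooted(2)[OF f G R])
  finally show ?thesis
    unfolding density_def using bij_betw_same_card[OF bij] by simp
qed

lemma rooted_pairs_image:
  assumes f: "iso_map f G H" and G: "is_preflag \<sigma> G" and H: "is_preflag \<sigma> H"
    and p: "p \<in> rooted_pairs G l m"
  shows "map_prod ((`) f) ((`) f) p \<in> rooted_pairs H l m"
proof -
  obtain S T where [simp]: "p = (S, T)" by (cases p)
  have S: "S \<in> rooted_sets G l" and T: "T \<in> rooted_sets G m" and ST: "S \<inter> T = set (labels G)"
    using p by (auto simp: rooted_pairs_def)
  have "inj_on f (verts G)" and lab: "labels H = map f (labels G)"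
    using f by (auto simp: iso_map_def bij_betw_def)
  then have "f ` S \<inter> f ` T = f ` (S \<inter> T)"
    using rooted_setsD(2)[OF S] rooted_setsD(2)[OF T] by (simp add: inj_on_image_Int)
  then show ?thesis
    using iso_map_rooted(1)[OF f G H S] iso_map_rooted(1)[OF f G H T] ST lab
    by (simp add: rooted_pairs_def)
qed

lemma bij_betw_rooted_pairs:
  assumes f: "iso_map f G H" and G: "is_preflag \<sigma> G" and H: "is_preflag \<sigma> H"
  shows "bij_betw (map_prod ((`) f) ((`) f)) (rooted_pairs G l m) (rooted_pairs H l m)"
proof -
  let ?g = "inv_into (verts G) f"
  have g: "iso_map ?g H G" by (rule iso_map_inv[OF f G])
  have b: "bij_betw f (verts G) (verts H)" using f by (simp add: iso_map_def)
  have gf: "?g ` f ` S = S" if "S \<subseteq> verts G" for S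
    using that b unfolding bij_betw_def by (simp add: inv_into_image_cancel)
  have fg: "f ` ?g ` S = S" if "S \<subseteq> verts H" for S
    using that b unfolding bij_betw_def by (simp add: image_inv_into_cancel)
  show ?thesis
  proof (rule bij_betwI[where g = "map_prod ((`) ?g) ((`) ?g)"])
    show "map_prod ((`) f) ((`) f) \<in> rooted_pairs G l m \<rightarrow> rooted_pairs H l m"
      using rooted_pairs_image[OF f G H] by blast
    show "map_prod ((`) ?g) ((`) ?g) \<in> rooted_pairs H l m \<rightarrow> rooted_pairs G l m"
      using rooted_pairs_image[OF g H G] by blast
  qed (auto simp: rooted_pairs_def rooted_sets_def gf fg)
qed

lemma density2_abs:
  assumes G: "is_preflag \<sigma> G"
  shows "density2 F H (abs_flag G) =
    (\<Sum>(S, T)\<in>rooted_pairs G (flag_size F) (flag_size H).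
       of_bool (subflag G S = F) * of_bool (subflag G T = H)) /
    real (card (rooted_pairs G (flag_size F) (flag_size H)))"
proof -
  let ?R = "rep_flag (abs_flag G)"
  let ?P = "\<lambda>G. rooted_pairs G (flag_size F) (flag_size H)"
  let ?ind = "\<lambda>G (S, T). of_bool (subflag G S = F) * of_bool (subflag G T = H) :: real"
  have iso: "G \<simeq>\<^sub>F ?R" by (rule flag_iso_sym[OF rep_abs_flag[OF G]])
  then obtain f where f: "iso_map f G ?R" unfolding flag_iso_def by blast
  have R: "is_preflag \<sigma> ?R" using is_preflag_iso[OF iso G] .
  note bij = bij_betw_rooted_pairs[OF f G R, of "flag_size F" "flag_size H"]
  have "{(S, T) \<in> ?P ?R. induced ?R S \<simeq>\<^sub>F rep_flag F \<and> induced ?R T \<simeq>\<^sub>F rep_flag H} =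
      {p \<in> ?P ?R. induced ?R (fst p) \<simeq>\<^sub>F rep_flag F \<and> induced ?R (snd p) \<simeq>\<^sub>F rep_flag H}"
    by auto
  then have "real (card {(S, T) \<in> ?P ?R. induced ?R S \<simeq>\<^sub>F rep_flag F \<and> induced ?R T \<simeq>\<^sub>F rep_flag H}) =
      (\<Sum>p\<in>?P ?R. of_bool (induced ?R (fst p) \<simeq>\<^sub>F rep_flag F \<and> induced ?R (snd p) \<simeq>\<^sub>F rep_flag H))"
    by (simp only: card_eq_sum_of_bool[OF finite_rooted_pairs[OF R]])
  also have "\<dots> = (\<Sum>p\<in>?P ?R. ?ind ?R p)"
  proof (rule sum.cong[OF refl])
    fix p assume "p \<in> ?P ?R"
    then have "fst p \<in> rooted_sets ?R (flag_size F)" "snd p \<in> rooted_sets ?R (flag_size H)"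
      by (auto simp: rooted_pairs_def)
    note this[THEN is_preflag_rooted[OF R], THEN iso_rep_flag_iff]
    then show "of_bool (induced ?R (fst p) \<simeq>\<^sub>F rep_flag F \<and> induced ?R (snd p) \<simeq>\<^sub>F rep_flag H) =
        ?ind ?R p"
      by (simp add: case_prod_unfold)
  qed
  also have "\<dots> = (\<Sum>p\<in>?P G. ?ind ?R (map_prod ((`) f) ((`) f) p))"
    by (rule sum.reindex_bij_betw[OF bij, symmetric])
  also have "\<dots> = (\<Sum>p\<in>?P G. ?ind G p)"
  proof (rule sum.cong[OF refl])
    fix p assume "p \<in> ?P G"
    then have "fst p \<in> rooted_sets G (flag_size F)" "snd p \<in> rooted_sets G (flag_size H)"
      by (auto simp: rooted_pairs_def)
    note this[THEN iso_map_rooted(2)[OF f G R]]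
    then show "?ind ?R (map_prod ((`) f) ((`) f) p) = ?ind G p"
      by (simp add: case_prod_unfold)
  qed
  finally show ?thesis
    unfolding density2_def using bij_betw_same_card[OF bij] by simp
qed

lemma card_Collect_swap: "card {(x, y). Q x y} = card {(x, y). Q y x}"
  by (rule bij_betw_same_card[of prod.swap], rule bij_betwI[where g = prod.swap]) auto

lemma density2_commute: "density2 F H G = density2 H F G"
proof -
  let ?P = "\<lambda>F H S T. S \<in> rooted_sets (rep_flag G) (flag_size F) \<and>
    T \<in> rooted_sets (rep_flag G) (flag_size H) \<and> S \<inter> T = set (labels (rep_flag G))"
  let ?Q = "\<lambda>F H S T. ?P F H S T \<and>
    induced (rep_flag G) S \<simeq>\<^sub>F rep_flag F \<and> induced (rep_flag G) T \<simeq>\<^sub>F rep_flag H"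
  have eq: "density2 F H G = card {(S, T). ?Q F H S T} / card {(S, T). ?P F H S T}" for F H
    unfolding density2_def rooted_pairs_def by simp
  have "(\<lambda>S T. ?Q F H T S) = ?Q H F" "(\<lambda>S T. ?P F H T S) = ?P H F"
    by (intro ext, blast)+
  then show ?thesis
    unfolding eq card_Collect_swap[of "?Q F H"] card_Collect_swap[of "?P F H"] by simp
qed

section \<open>Chain rules\<close>

text \<open>
  The law of total probability: a random subflag of \<open>k\<close> vertices is isomorphic to exactly one
  flag of that size.
\<close>

lemma sum_flags_density:
  assumes G: "is_preflag \<sigma> G"
  shows "(\<Sum>K\<in>flags_of_size \<sigma> k. g K * density K (abs_flag G)) =
    (\<Sum>U\<in>rooted_sets G k. g (subflag G U)) / real (card (rooted_sets G k))"
proof -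
  have "(\<Sum>K\<in>flags_of_size \<sigma> k. g K * density K (abs_flag G)) =
      (\<Sum>K\<in>flags_of_size \<sigma> k. \<Sum>U\<in>rooted_sets G k. g K * of_bool (subflag G U = K)) /
      real (card (rooted_sets G k))"
    by (simp add: density_abs[OF G] flags_of_size_def sum_divide_distrib sum_distrib_left)
  also have "(\<Sum>K\<in>flags_of_size \<sigma> k. \<Sum>U\<in>rooted_sets G k. g K * of_bool (subflag G U = K)) =
      (\<Sum>U\<in>rooted_sets G k. \<Sum>K\<in>flags_of_size \<sigma> k. if subflag G U = K then g K else 0)"
    by (subst sum.swap) (intro sum.cong refl, auto)
  also have "\<dots> = (\<Sum>U\<in>rooted_sets G k. g (subflag G U))"
    by (intro sum.cong refl) (simp add: finite_flags_of_size subflag_in_flags_of_size[OF G])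
  finally show ?thesis .
qed

lemma rooted_sets_induced:
  assumes "U \<subseteq> verts G"
  shows "rooted_sets (induced G U) l = {S \<in> rooted_sets G l. S \<subseteq> U}"
  using assms by (auto simp: rooted_sets_def)

text \<open>
  A pair is picked by first picking its second set \<open>T\<close> and then the first set inside what
  is left when the unlabelled part of \<open>T\<close> is deleted.
\<close>

definition remaining :: "preflag \<Rightarrow> nat set \<Rightarrow> nat set" where
  "remaining G T = (verts G - T) \<union> set (labels G)"

lemma is_preflag_remaining:
  assumes "is_preflag \<sigma> G"
  shows "is_preflag \<sigma> (induced G (remaining G T))"
  by (rule is_preflag_induced[OF assms]) (use labels_subset[OF assms] in \<open>auto simp: remaining_def\<close>)

lemma card_remaining:
  assumes G: "is_preflag \<sigma> G" and T: "T \<in> rooted_sets G m"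
  shows "card (remaining G T) = card (verts G) - m + type_size \<sigma>"
proof -
  have "finite T" using rooted_setsD(2)[OF T] finite_verts[OF G] by (rule finite_subset)
  then have "card (remaining G T) = card (verts G - T) + card (set (labels G))"
    unfolding remaining_def using finite_verts[OF G] rooted_setsD(1)[OF T]
    by (intro card_Un_disjoint) auto
  then show ?thesis
    using \<open>finite T\<close> rooted_setsD[OF T] by (simp add: card_labels[OF G] card_Diff_subset)
qed

lemma rooted_pairs_Sigma:
  assumes G: "is_preflag \<sigma> G"
  shows "rooted_pairs G l m =
    prod.swap ` (SIGMA T:rooted_sets G m. rooted_sets (induced G (remaining G T)) l)"
proof -
  have "(S, T) \<in> rooted_pairs G l m \<longleftrightarrow>
      T \<in> rooted_sets G m \<and> S \<in> rooted_sets (induced G (remaining G T)) l" for S T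
    using labels_subset[OF G]
    by (auto simp: rooted_pairs_def remaining_def rooted_sets_def)
  then show ?thesis by (auto simp: image_iff)
qed

lemma sum_rooted_pairs:
  assumes G: "is_preflag \<sigma> G"
  shows "(\<Sum>(S, T)\<in>rooted_pairs G l m. h S T) =
    (\<Sum>T\<in>rooted_sets G m. \<Sum>S\<in>rooted_sets (induced G (remaining G T)) l. h S T)"
  unfolding rooted_pairs_Sigma[OF G]
  by (subst sum.reindex)
     (auto simp: sum.Sigma finite_rooted_sets[OF G] finite_rooted_sets[OF is_preflag_remaining[OF G]]
        case_prod_beta)

lemma card_rooted_pairs:
  assumes G: "is_preflag \<sigma> G" and l: "type_size \<sigma> \<le> l" and m: "type_size \<sigma> \<le> m"
  shows "card (rooted_pairs G l m) =
    (card (verts G) - type_size \<sigma> choose (m - type_size \<sigma>)) *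
    (card (verts G) - m choose (l - type_size \<sigma>))"
proof -
  have "card (rooted_pairs G l m) =
      (\<Sum>T\<in>rooted_sets G m. card (rooted_sets (induced G (remaining G T)) l))"
    unfolding rooted_pairs_Sigma[OF G]
    by (subst card_image)
       (auto simp: card_SigmaI finite_rooted_sets[OF G] finite_rooted_sets[OF is_preflag_remaining[OF G]])
  also have "\<dots> = (\<Sum>T\<in>rooted_sets G m. card (verts G) - m choose (l - type_size \<sigma>))"
    by (intro sum.cong refl)
       (simp add: card_rooted_sets[OF is_preflag_remaining[OF G] l] card_remaining[OF G])
  finally show ?thesis by (simp add: card_rooted_sets[OF G m])
qed

lemma sum_divide_twice:
  fixes a c :: real
  shows "sum g A / (a * c) = (\<Sum>x\<in>A. g x / c) / a"
  by (simp add: sum_divide_distrib mult.commute)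

text \<open>
  The number of choices of the first set does not depend on the second one, so that the mean over
  all pairs is an iterated mean.
\<close>

lemma density2_conditional:
  assumes G: "is_preflag \<sigma> G" and F: "F \<in> flags \<sigma>" and H: "H \<in> flags \<sigma>"
    and N: "flag_size F + flag_size H - type_size \<sigma> \<le> card (verts G)"
  shows "density2 F H (abs_flag G) =
    (\<Sum>T\<in>rooted_sets G (flag_size H). of_bool (subflag G T = H) *
       density F (subflag G (remaining G T))) / real (card (rooted_sets G (flag_size H)))"
proof -
  define c where "c = (card (verts G) - flag_size H choose (flag_size F - type_size \<sigma>))"
  note lF = flag_size_ge[OF F] and lH = flag_size_ge[OF H]
  have c: "card (rooted_sets (induced G (remaining G T)) (flag_size F)) = c"
    if "T \<in> rooted_sets G (flag_size H)" for T
    unfolding c_def card_rooted_sets[OF is_preflag_remaining[OF G] lF]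
    by (simp add: card_remaining[OF G that])
  have cc: "card (rooted_pairs G (flag_size F) (flag_size H)) = card (rooted_sets G (flag_size H)) * c"
    by (simp add: card_rooted_pairs[OF G lF lH] card_rooted_sets[OF G lH] c_def)
  have "density2 F H (abs_flag G) =
     (\<Sum>T\<in>rooted_sets G (flag_size H). \<Sum>S\<in>rooted_sets (induced G (remaining G T)) (flag_size F).
        of_bool (subflag G S = F) * of_bool (subflag G T = H)) /
     (real (card (rooted_sets G (flag_size H))) * real c)"
    by (simp add: density2_abs[OF G] sum_rooted_pairs[OF G] cc)
  also have "\<dots> = (\<Sum>T\<in>rooted_sets G (flag_size H).
      (\<Sum>S\<in>rooted_sets (induced G (remaining G T)) (flag_size F).
        of_bool (subflag G S = F) * of_bool (subflag G T = H)) / real c) /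
     real (card (rooted_sets G (flag_size H)))"
    by (rule sum_divide_twice)
  also have "\<dots> = (\<Sum>T\<in>rooted_sets G (flag_size H). of_bool (subflag G T = H) *
       density F (subflag G (remaining G T))) / real (card (rooted_sets G (flag_size H)))"
  proof (intro arg_cong2[where f = "(/)"] sum.cong refl)
    fix T assume T: "T \<in> rooted_sets G (flag_size H)"
    have "(\<Sum>S\<in>rooted_sets (induced G (remaining G T)) (flag_size F).
        of_bool (subflag (induced G (remaining G T)) S = F)) =
       (\<Sum>S\<in>rooted_sets (induced G (remaining G T)) (flag_size F). of_bool (subflag G S = F) :: real)"
      by (intro sum.cong refl) (simp add: induced_induced rooted_sets_def)
    then show "(\<Sum>S\<in>rooted_sets (induced G (remaining G T)) (flag_size F).
        of_bool (subflag G S = F) * of_bool (subflag G T = H)) / real c =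
       of_bool (subflag G T = H) * density F (subflag G (remaining G T))"
      unfolding density_abs[OF is_preflag_remaining[OF G]]
      by (simp add: c[OF T] sum_distrib_right[symmetric])
  qed
  finally show ?thesis .
qed

lemma sum_average_swap:
  fixes c :: real
  shows "(\<Sum>k\<in>A. p k * ((\<Sum>t\<in>B. b t * d k t) / c)) = (\<Sum>t\<in>B. b t * (\<Sum>k\<in>A. p k * d k t)) / c"
proof -
  have "(\<Sum>t\<in>B. b t * (\<Sum>k\<in>A. p k * d k t)) = (\<Sum>k\<in>A. \<Sum>t\<in>B. p k * (b t * d k t))"
    by (subst sum.swap) (simp add: sum_distrib_left mult.left_commute)
  also have "\<dots> = (\<Sum>k\<in>A. p k * (\<Sum>t\<in>B. b t * d k t))"
    by (simp add: sum_distrib_left)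
  finally show ?thesis by (simp only: sum_divide_distrib[of _ A] times_divide_eq_right)
qed

text \<open>
  The first factor of a product may be expanded at a larger size: in a flag of the size below, the
  second set determines the larger first set, which consists of all remaining vertices.
\<close>

lemma chain_rule_factor:
  assumes G: "is_preflag \<sigma> G" and F: "F \<in> flags \<sigma>" and H: "H \<in> flags \<sigma>"
    and m: "flag_size F \<le> m" and N: "card (verts G) = m + flag_size H - type_size \<sigma>"
  shows "(\<Sum>K\<in>flags_of_size \<sigma> m. density F K * density2 K H (abs_flag G)) =
    density2 F H (abs_flag G)"
proof -
  note lF = flag_size_ge[OF F] and lH = flag_size_ge[OF H]
  let ?R = "\<lambda>T. induced G (remaining G T)"
  have 1: "density2 K H (abs_flag G) = (\<Sum>T\<in>rooted_sets G (flag_size H).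
      of_bool (subflag G T = H) * density K (abs_flag (?R T))) / real (card (rooted_sets G (flag_size H)))"
    if "K \<in> flags_of_size \<sigma> m" for K
    using density2_conditional[OF G _ H, of K] that N by (simp add: flags_of_size_def)
  have "(\<Sum>K\<in>flags_of_size \<sigma> m. density F K * density2 K H (abs_flag G)) =
     (\<Sum>T\<in>rooted_sets G (flag_size H). of_bool (subflag G T = H) *
       (\<Sum>K\<in>flags_of_size \<sigma> m. density F K * density K (abs_flag (?R T)))) /
     real (card (rooted_sets G (flag_size H)))"
    unfolding sum_average_swap[symmetric] by (intro sum.cong refl) (simp add: 1)
  also have "\<dots> = (\<Sum>T\<in>rooted_sets G (flag_size H). of_bool (subflag G T = H) *
       density F (abs_flag (?R T))) / real (card (rooted_sets G (flag_size H)))"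
  proof (intro arg_cong2[where f = "(/)"] arg_cong2[where f = "(*)"] sum.cong refl)
    fix T assume T: "T \<in> rooted_sets G (flag_size H)"
    note R = is_preflag_remaining[OF G, of T]
    have cR: "card (remaining G T) = m"
      using card_remaining[OF G T] N lF lH m by simp
    have "rooted_sets (?R T) m = {remaining G T}"
      using labels_subset[OF R] cR finite_verts[OF R] card_subset_eq
      by (auto simp: rooted_sets_def)
    moreover have "induced (?R T) (remaining G T) = ?R T"
      by (simp only: induced_induced[OF subset_refl])
    ultimately show "(\<Sum>K\<in>flags_of_size \<sigma> m. density F K * density K (abs_flag (?R T))) =
       density F (abs_flag (?R T))"
      unfolding sum_flags_density[OF R] by (simp add: induced_induced)
  qed
  also have "\<dots> = density2 F H (abs_flag G)"
    using density2_conditional[OF G F H] N m by simp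
  finally show ?thesis .
qed

text \<open>
  A random pair may be chosen inside a random subflag of the least admissible size, because every
  pair of sets fills exactly one such subflag.
\<close>

lemma chain_rule_product:
  assumes G: "is_preflag \<sigma> G" and F: "F \<in> flags \<sigma>" and H: "H \<in> flags \<sigma>"
    and k: "k = flag_size F + flag_size H - type_size \<sigma>" and N: "k \<le> card (verts G)"
  shows "(\<Sum>K\<in>flags_of_size \<sigma> k. density2 F H K * density K (abs_flag G)) =
    density2 F H (abs_flag G)"
proof -
  note lF = flag_size_ge[OF F] and lH = flag_size_ge[OF H]
  let ?l = "flag_size F" and ?m = "flag_size H"
  let ?ind = "\<lambda>(S, T). of_bool (subflag G S = F) * of_bool (subflag G T = H) :: real"
  have pU: "is_preflag \<sigma> (induced G U)" if "U \<in> rooted_sets G k" for U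
    using is_preflag_rooted[OF G that] .
  have sk: "type_size \<sigma> \<le> k" using k lF lH by simp
  \<comment> \<open>the union of the two sets of a pair has exactly \<open>k\<close> elements, so it is the only
    rooted \<open>k\<close>-set that contains both\<close>
  have union: "S \<union> T \<in> rooted_sets G k" if "(S, T) \<in> rooted_pairs G ?l ?m" for S T
  proof -
    have S: "S \<in> rooted_sets G ?l" and T: "T \<in> rooted_sets G ?m" and ST: "S \<inter> T = set (labels G)"
      using that by (auto simp: rooted_pairs_def)
    have "finite S" "finite T"
      using finite_subset[OF rooted_setsD(2)[OF S]] finite_subset[OF rooted_setsD(2)[OF T]]
      finite_verts[OF G] by simp_all
    then have "card (S \<union> T) + type_size \<sigma> = ?l + ?m"
      using card_Un_Int[of S T] ST card_labels[OF G] rooted_setsD(3)[OF S] rooted_setsD(3)[OF T] by simp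
    then show ?thesis
      using rooted_setsD[OF S] rooted_setsD[OF T] k by (auto simp: rooted_sets_def)
  qed
  have RP: "rooted_pairs (induced G U) ?l ?m = {(S, T) \<in> rooted_pairs G ?l ?m. S \<union> T = U}"
    if U: "U \<in> rooted_sets G k" for U
  proof (rule Set.set_eqI)
    fix p :: "nat set \<times> nat set"
    obtain S T where p: "p = (S, T)" by (cases p)
    have 1: "S \<union> T = U" if "(S, T) \<in> rooted_pairs G ?l ?m" "S \<union> T \<subseteq> U"
      using card_subset_eq[OF _ that(2)] rooted_setsD(3)[OF union[OF that(1)]] rooted_setsD[OF U]
        finite_subset[OF _ finite_verts[OF G]] by metis
    have "(S, T) \<in> rooted_pairs (induced G U) ?l ?m \<longleftrightarrow>
        (S, T) \<in> rooted_pairs G ?l ?m \<and> S \<union> T \<subseteq> U"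
      by (auto simp: rooted_pairs_def rooted_sets_induced[OF rooted_setsD(2)[OF U]])
    then show "p \<in> rooted_pairs (induced G U) ?l ?m \<longleftrightarrow>
        p \<in> {(S, T) \<in> rooted_pairs G ?l ?m. S \<union> T = U}"
      unfolding p using 1 by auto
  qed
  have part: "(\<Sum>p\<in>rooted_pairs G ?l ?m. h p) =
      (\<Sum>U\<in>rooted_sets G k. \<Sum>p\<in>rooted_pairs (induced G U) ?l ?m. h p)" for h :: "_ \<Rightarrow> real"
  proof -
    have "(\<Sum>U\<in>rooted_sets G k. \<Sum>p\<in>rooted_pairs (induced G U) ?l ?m. h p) =
       (\<Sum>U\<in>rooted_sets G k. \<Sum>p\<in>{p \<in> rooted_pairs G ?l ?m. (\<lambda>(S, T). S \<union> T) p = U}. h p)"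
      by (intro sum.cong refl) (auto simp: RP)
    also have "\<dots> = (\<Sum>p\<in>rooted_pairs G ?l ?m. h p)"
      by (rule sum.group[OF finite_rooted_pairs[OF G] finite_rooted_sets[OF G]])
         (use union in auto)
    finally show ?thesis by simp
  qed
  define c where "c = (k - type_size \<sigma> choose (?m - type_size \<sigma>)) * (k - ?m choose (?l - type_size \<sigma>))"
  have c: "card (rooted_pairs (induced G U) ?l ?m) = c" if "U \<in> rooted_sets G k" for U
    unfolding card_rooted_pairs[OF pU[OF that] lF lH] c_def using rooted_setsD(3)[OF that] by simp
  have card: "real (card (rooted_pairs G ?l ?m)) = real (card (rooted_sets G k)) * real c"
    using part[of "\<lambda>_. 1"] by (simp add: c)
  have "density2 F H (abs_flag G) = (\<Sum>p\<in>rooted_pairs G ?l ?m. ?ind p) /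
      (real (card (rooted_sets G k)) * real c)"
    unfolding density2_abs[OF G] card ..
  also have "\<dots> = (\<Sum>U\<in>rooted_sets G k. (\<Sum>p\<in>rooted_pairs (induced G U) ?l ?m. ?ind p) / real c) /
      real (card (rooted_sets G k))"
    unfolding part by (rule sum_divide_twice)
  also have "(\<Sum>U\<in>rooted_sets G k. (\<Sum>p\<in>rooted_pairs (induced G U) ?l ?m. ?ind p) / real c) =
      (\<Sum>U\<in>rooted_sets G k. density2 F H (subflag G U))"
  proof (intro sum.cong refl)
    fix U assume U: "U \<in> rooted_sets G k"
    have "(\<Sum>p\<in>rooted_pairs (induced G U) ?l ?m. ?ind p) =
      (\<Sum>(S, T)\<in>rooted_pairs (induced G U) ?l ?m.
        of_bool (subflag (induced G U) S = F) * of_bool (subflag (induced G U) T = H))"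
      by (intro sum.cong refl) (auto simp: rooted_pairs_def rooted_sets_def induced_induced)
    then show "(\<Sum>p\<in>rooted_pairs (induced G U) ?l ?m. ?ind p) / real c = density2 F H (subflag G U)"
      by (simp add: density2_abs[OF pU[OF U]] c[OF U])
  qed
  finally show ?thesis
    by (simp add: sum_flags_density[OF G])
qed

section \<open>The flag algebra is well defined\<close>

lemma abs_flag_eqI:
  "is_preflag \<sigma> G \<Longrightarrow> is_preflag \<sigma> H \<Longrightarrow> iso_map f G H \<Longrightarrow> abs_flag G = abs_flag H"
  using abs_flag_eq_iff unfolding flag_iso_def by metis

lemma is_preflag_unit:
  "is_preflag Type_0 \<lparr>verts = {}, arcs = {}, labels = []\<rparr>"
  "is_preflag Type_A \<lparr>verts = {1, 2}, arcs = {(1, 2)}, labels = [1, 2]\<rparr>"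
  by (auto simp: is_preflag_def tournament_def)

lemma unit_flag_in_flags: "unit_flag \<sigma> \<in> flags \<sigma>"
  using is_preflag_unit[THEN abs_flag_in_flags] by (cases \<sigma>) (simp_all add: unit_flag_def)

lemma flag_size_unit: "flag_size (unit_flag \<sigma>) = type_size \<sigma>"
  using is_preflag_unit[THEN flag_size_abs] by (cases \<sigma>) (simp_all add: unit_flag_def)

lemma subflag_labels:
  assumes G: "is_preflag \<sigma> G"
  shows "subflag G (set (labels G)) = unit_flag \<sigma>"
proof -
  note I = is_preflag_induced[OF G subset_refl labels_subset[OF G]]
  show ?thesis
  proof (cases \<sigma>)
    case Type_0
    then have "labels G = []" using G by (simp add: is_preflag_def)
    then show ?thesis by (simp add: Type_0 unit_flag_def induced_def)
  next
    case Type_A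
    then obtain u v where L: "labels G = [u, v]" and uv: "(u, v) \<in> arcs G"
      using G by (auto simp: is_preflag_def)
    note D = preflag_arcsD[OF G uv]
    have "(u, u) \<notin> arcs G" "(v, v) \<notin> arcs G"
      using preflag_arcsD(3)[OF G] by blast+
    then have "iso_map (\<lambda>x. if x = u then 1 else 2) (induced G (set (labels G)))
        \<lparr>verts = {1, 2}, arcs = {(1, 2)}, labels = [1, 2]\<rparr>"
      using L uv D by (auto simp: iso_map_def bij_betw_def inj_on_def)
    then show ?thesis
      using abs_flag_eqI[OF I[unfolded Type_A] is_preflag_unit(2)] by (simp add: Type_A unit_flag_def)
  qed
qed

lemma density_unit_flag:
  assumes G: "G \<in> flags \<sigma>"
  shows "density (unit_flag \<sigma>) G = 1"
proof -
  note R = preflag_rep[OF G]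
  have "rooted_sets (rep_flag G) (type_size \<sigma>) = {set (labels (rep_flag G))}"
  proof (intro equalityI subsetI)
    fix S assume S: "S \<in> rooted_sets (rep_flag G) (type_size \<sigma>)"
    have "finite S" using finite_subset[OF rooted_setsD(2)[OF S] finite_verts[OF R]] .
    then show "S \<in> {set (labels (rep_flag G))}"
      using card_subset_eq[OF _ rooted_setsD(1)[OF S]] rooted_setsD(3)[OF S] card_labels[OF R] by simp
  qed (use labels_subset[OF R] card_labels[OF R] in \<open>auto simp: rooted_sets_def\<close>)
  then show ?thesis
    using density_abs[OF R, of "unit_flag \<sigma>"]
    by (simp add: flag_size_unit subflag_labels[OF R] abs_rep_flag)
qed

lemma lookup_scaleR: "Poly_Mapping.lookup (c *\<^sub>R x) F = c * Poly_Mapping.lookup x F"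
  for x :: "flag \<Rightarrow>\<^sub>0 real"
proof -
  have "finite {i. c *\<^sub>R Poly_Mapping.lookup x i \<noteq> 0}"
    by (rule finite_subset[OF _ finite_keys[of x]]) (auto simp: in_keys_iff)
  then show ?thesis by (simp add: scaleR_poly_mapping_def)
qed

lemma keys_scaleR: "Poly_Mapping.keys (c *\<^sub>R x) \<subseteq> Poly_Mapping.keys x" for x :: "flag \<Rightarrow>\<^sub>0 real"
  by (auto simp: in_keys_iff lookup_scaleR)

abbreviation flag_vectors :: "ftype \<Rightarrow> (flag \<Rightarrow>\<^sub>0 real) set" where
  "flag_vectors \<sigma> \<equiv> carrier (free_flag_ring \<sigma>)"

lemma flag_vectors_iff: "x \<in> flag_vectors \<sigma> \<longleftrightarrow> Poly_Mapping.keys x \<subseteq> flags \<sigma>"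
  by (simp add: free_flag_ring_def)

lemma subspace_flag_vectors: "subspace (flag_vectors \<sigma>)"
proof (rule subspaceI)
  fix x y and c :: real
  assume "x \<in> flag_vectors \<sigma>"
  then have x: "Poly_Mapping.keys x \<subseteq> flags \<sigma>" by (simp add: flag_vectors_iff)
  show "c *\<^sub>R x \<in> flag_vectors \<sigma>"
    using order_trans[OF keys_scaleR x] by (simp add: flag_vectors_iff)
  assume "y \<in> flag_vectors \<sigma>"
  then show "x + y \<in> flag_vectors \<sigma>"
    using order_trans[OF keys_add[of x y]] x by (simp add: flag_vectors_iff)
qed (simp add: flag_vectors_iff)

lemma vec_in_flag_vectors: "F \<in> flags \<sigma> \<Longrightarrow> vec F \<in> flag_vectors \<sigma>"
  by (simp add: flag_vectors_iff)

lemma sum_vec_in_flag_vectors: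
  "A \<subseteq> flags \<sigma> \<Longrightarrow> (\<Sum>G\<in>A. c G *\<^sub>R vec G) \<in> flag_vectors \<sigma>"
  by (intro subspace_sum[OF subspace_flag_vectors] subspace_scale[OF subspace_flag_vectors]
      vec_in_flag_vectors) auto

lemma flags_of_size_subset: "flags_of_size \<sigma> m \<subseteq> flags \<sigma>"
  by (auto simp: flags_of_size_def)

abbreviation fmult :: "ftype \<Rightarrow> (flag \<Rightarrow>\<^sub>0 real) \<Rightarrow> (flag \<Rightarrow>\<^sub>0 real) \<Rightarrow> flag \<Rightarrow>\<^sub>0 real" where
  "fmult \<sigma> x y \<equiv> x \<otimes>\<^bsub>free_flag_ring \<sigma>\<^esub> y"

lemma fmult_superset:
  assumes "finite A" "Poly_Mapping.keys x \<subseteq> A" "finite B" "Poly_Mapping.keys y \<subseteq> B"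
  shows "fmult \<sigma> x y = (\<Sum>F\<in>A. \<Sum>H\<in>B.
    (Poly_Mapping.lookup x F * Poly_Mapping.lookup y H) *\<^sub>R flag_prod \<sigma> F H)"
proof -
  have "fmult \<sigma> x y = (\<Sum>F\<in>Poly_Mapping.keys x. \<Sum>H\<in>Poly_Mapping.keys y.
    (Poly_Mapping.lookup x F * Poly_Mapping.lookup y H) *\<^sub>R flag_prod \<sigma> F H)"
    by (simp add: free_flag_ring_def)
  also have "\<dots> = (\<Sum>F\<in>Poly_Mapping.keys x. \<Sum>H\<in>B.
    (Poly_Mapping.lookup x F * Poly_Mapping.lookup y H) *\<^sub>R flag_prod \<sigma> F H)"
    using assms by (intro sum.cong refl sum.mono_neutral_left) (auto simp: in_keys_iff)
  also have "\<dots> = (\<Sum>F\<in>A. \<Sum>H\<in>B.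
    (Poly_Mapping.lookup x F * Poly_Mapping.lookup y H) *\<^sub>R flag_prod \<sigma> F H)"
    using assms by (intro sum.mono_neutral_left) (auto simp: in_keys_iff)
  finally show ?thesis .
qed

lemma linear_fmult_left: "linear (\<lambda>x. fmult \<sigma> x y)"
proof (rule linearI)
  fix x z :: "flag \<Rightarrow>\<^sub>0 real" and c :: real
  let ?A = "Poly_Mapping.keys x \<union> Poly_Mapping.keys z"
  have "fmult \<sigma> w y = (\<Sum>F\<in>?A. \<Sum>H\<in>Poly_Mapping.keys y.
    (Poly_Mapping.lookup w F * Poly_Mapping.lookup y H) *\<^sub>R flag_prod \<sigma> F H)"
    if "Poly_Mapping.keys w \<subseteq> ?A" for w
    using that by (intro fmult_superset) auto
  note * = this[of x] this[of z] this[of "x + z", OF keys_add]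
  show "fmult \<sigma> (x + z) y = fmult \<sigma> x y + fmult \<sigma> z y"
    by (simp add: * lookup_add distrib_right scaleR_add_left sum.distrib)
  show "fmult \<sigma> (c *\<^sub>R x) y = c *\<^sub>R fmult \<sigma> x y"
    by (subst (1 2) fmult_superset[where A = "Poly_Mapping.keys x" and B = "Poly_Mapping.keys y"])
       (use keys_scaleR in \<open>auto simp: lookup_scaleR scaleR_sum_right mult.assoc\<close>)
qed

lemma flag_prod_commute: "flag_prod \<sigma> F H = flag_prod \<sigma> H F"
  by (simp add: flag_prod_def density2_commute add.commute)

lemma fmult_commute: "fmult \<sigma> x y = fmult \<sigma> y x"
  unfolding free_flag_ring_def
  by (simp add: sum.swap[of _ "Poly_Mapping.keys x"] flag_prod_commute mult.commute)

lemma fmult_vec: "fmult \<sigma> (vec F) (vec H) = flag_prod \<sigma> F H"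
  by (simp add: free_flag_ring_def)

lemma fmult_expand_right:
  "fmult \<sigma> x y = (\<Sum>H\<in>Poly_Mapping.keys y. Poly_Mapping.lookup y H *\<^sub>R fmult \<sigma> x (vec H))"
proof -
  have "fmult \<sigma> x (vec H) = (\<Sum>F\<in>Poly_Mapping.keys x. Poly_Mapping.lookup x F *\<^sub>R flag_prod \<sigma> F H)" for H
    by (simp add: free_flag_ring_def)
  then show ?thesis
    by (simp add: free_flag_ring_def scaleR_sum_right mult.commute
        sum.swap[of _ "Poly_Mapping.keys x" "Poly_Mapping.keys y"])
qed

lemma flag_relation:
  assumes "F \<in> flags \<sigma>" "flag_size F \<le> m"
  shows "vec F - (\<Sum>G\<in>flags_of_size \<sigma> m. density F G *\<^sub>R vec G) \<in> flag_relations \<sigma>"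
  unfolding flag_relations_def using assms by (intro span_base) blast

lemma subspace_flag_relations: "subspace (flag_relations \<sigma>)"
  by (simp add: flag_relations_def subspace_span)

lemma flag_relations_subset: "flag_relations \<sigma> \<subseteq> flag_vectors \<sigma>"
  unfolding flag_relations_def
proof (rule span_minimal[OF _ subspace_flag_vectors], safe)
  fix F m assume "F \<in> flags \<sigma>"
  then show "vec F - (\<Sum>G\<in>flags_of_size \<sigma> m. density F G *\<^sub>R vec G) \<in> flag_vectors \<sigma>"
    by (intro subspace_diff[OF subspace_flag_vectors] vec_in_flag_vectors
        sum_vec_in_flag_vectors flags_of_size_subset)
qed

text \<open>
  The two chain rules say exactly that multiplying a relation by a flag gives a linear
  combination of relations.
\<close>

lemma relation_times_flag:
  assumes F: "F \<in> flags \<sigma>" and m: "flag_size F \<le> m" and H: "H \<in> flags \<sigma>"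
  shows "fmult \<sigma> (vec F - (\<Sum>G\<in>flags_of_size \<sigma> m. density F G *\<^sub>R vec G)) (vec H) \<in> flag_relations \<sigma>"
proof -
  note lF = flag_size_ge[OF F] and lH = flag_size_ge[OF H]
  define k where "k = flag_size F + flag_size H - type_size \<sigma>"
  define N where "N = m + flag_size H - type_size \<sigma>"
  let ?N = "flags_of_size \<sigma> N" and ?k = "flags_of_size \<sigma> k" and ?m = "flags_of_size \<sigma> m"
  have kN: "k \<le> N" using m by (simp add: k_def N_def)
  have Q: "is_preflag \<sigma> (rep_flag Q)" "card (verts (rep_flag Q)) = N" if "Q \<in> ?N" for Q
    using that by (auto simp: flags_of_size_def flags_def flag_size_def)
  have A: "(\<Sum>K\<in>?k. density2 F H K * density K Q) = density2 F H Q" if "Q \<in> ?N" for Q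
    using chain_rule_product[OF Q(1)[OF that] F H k_def] Q(2)[OF that] kN by (simp add: abs_rep_flag)
  have B: "(\<Sum>G\<in>?m. density F G * density2 G H Q) = density2 F H Q" if "Q \<in> ?N" for Q
    using chain_rule_factor[OF Q(1)[OF that] F H m] Q(2)[OF that] by (simp add: abs_rep_flag N_def)
  have "(\<Sum>K\<in>?k. density2 F H K *\<^sub>R (\<Sum>Q\<in>?N. density K Q *\<^sub>R vec Q)) =
      (\<Sum>Q\<in>?N. (\<Sum>K\<in>?k. density2 F H K * density K Q) *\<^sub>R vec Q)"
    by (simp add: scaleR_sum_right scaleR_sum_left sum.swap[of _ ?k])
  also have "\<dots> = (\<Sum>Q\<in>?N. density2 F H Q *\<^sub>R vec Q)"
    by (intro sum.cong refl) (simp add: A)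
  finally have 1: "(\<Sum>K\<in>?k. density2 F H K *\<^sub>R (\<Sum>Q\<in>?N. density K Q *\<^sub>R vec Q)) =
    (\<Sum>Q\<in>?N. density2 F H Q *\<^sub>R vec Q)" .
  have "(\<Sum>G\<in>?m. density F G *\<^sub>R flag_prod \<sigma> G H) =
      (\<Sum>G\<in>?m. density F G *\<^sub>R (\<Sum>Q\<in>?N. density2 G H Q *\<^sub>R vec Q))"
    by (intro sum.cong refl) (simp add: flag_prod_def N_def flags_of_size_def)
  also have "\<dots> = (\<Sum>Q\<in>?N. (\<Sum>G\<in>?m. density F G * density2 G H Q) *\<^sub>R vec Q)"
    by (simp add: scaleR_sum_right scaleR_sum_left sum.swap[of _ ?m])
  also have "\<dots> = (\<Sum>Q\<in>?N. density2 F H Q *\<^sub>R vec Q)"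
    by (intro sum.cong refl) (simp add: B)
  finally have 2: "(\<Sum>G\<in>?m. density F G *\<^sub>R flag_prod \<sigma> G H) =
    (\<Sum>Q\<in>?N. density2 F H Q *\<^sub>R vec Q)" .
  interpret L: linear "\<lambda>x. fmult \<sigma> x (vec H)" by (rule linear_fmult_left)
  have "fmult \<sigma> (vec F - (\<Sum>G\<in>?m. density F G *\<^sub>R vec G)) (vec H) =
      flag_prod \<sigma> F H - (\<Sum>G\<in>?m. density F G *\<^sub>R flag_prod \<sigma> G H)"
    by (simp add: L.diff L.sum L.scaleR fmult_vec)
  also have "\<dots> = (\<Sum>K\<in>?k. density2 F H K *\<^sub>R (vec K - (\<Sum>Q\<in>?N. density K Q *\<^sub>R vec Q)))"
    unfolding 2 1[symmetric]
    by (simp add: flag_prod_def k_def scaleR_diff_right sum_subtractf)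
  also have "\<dots> \<in> flag_relations \<sigma>"
    using kN by (intro subspace_sum[OF subspace_flag_relations] subspace_scale[OF subspace_flag_relations]
        flag_relation) (auto simp: flags_of_size_def)
  finally show ?thesis .
qed

lemma flag_relations_ideal:
  assumes r: "r \<in> flag_relations \<sigma>" and y: "y \<in> flag_vectors \<sigma>"
  shows "fmult \<sigma> r y \<in> flag_relations \<sigma>"
proof -
  have *: "fmult \<sigma> r (vec H) \<in> flag_relations \<sigma>" if H: "H \<in> flags \<sigma>" for H
    using r unfolding flag_relations_def
  proof (rule span_induct)
    interpret L: linear "\<lambda>x. fmult \<sigma> x (vec H)" by (rule linear_fmult_left)
    show "subspace {x. fmult \<sigma> x (vec H) \<in> span {vec F - (\<Sum>G\<in>flags_of_size \<sigma> m. density F G *\<^sub>R vec G) |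
        F m. F \<in> flags \<sigma> \<and> flag_size F \<le> m}}"
      by (rule subspaceI) (auto simp: L.add L.scaleR L.zero span_zero intro: span_add span_scale)
  next
    fix x assume "x \<in> {vec F - (\<Sum>G\<in>flags_of_size \<sigma> m. density F G *\<^sub>R vec G) |
        F m. F \<in> flags \<sigma> \<and> flag_size F \<le> m}"
    then show "fmult \<sigma> x (vec H) \<in> span {vec F - (\<Sum>G\<in>flags_of_size \<sigma> m. density F G *\<^sub>R vec G) |
        F m. F \<in> flags \<sigma> \<and> flag_size F \<le> m}"
      using relation_times_flag[OF _ _ H] unfolding flag_relations_def by blast
  qed
  show ?thesis
    unfolding fmult_expand_right[of \<sigma> r y]
    using y by (intro subspace_sum[OF subspace_flag_relations] subspace_scale[OF subspace_flag_relations] *)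
      (auto simp: flag_vectors_iff)
qed

lemma flag_class_eq: "flag_class \<sigma> x = (\<lambda>r. r + x) ` flag_relations \<sigma>"
  by (auto simp: flag_class_def a_r_coset_def' free_flag_ring_def)

lemma flag_class_eqI:
  assumes "x - y \<in> flag_relations \<sigma>"
  shows "flag_class \<sigma> x = flag_class \<sigma> y"
proof -
  have sub: "flag_class \<sigma> x \<subseteq> flag_class \<sigma> y" if "x - y \<in> flag_relations \<sigma>" for x y
  proof
    fix z assume "z \<in> flag_class \<sigma> x"
    then obtain r where r: "r \<in> flag_relations \<sigma>" "z = r + x" by (auto simp: flag_class_eq)
    then have "r + (x - y) \<in> flag_relations \<sigma>" "z = (r + (x - y)) + y"
      using that subspace_add[OF subspace_flag_relations] by auto
    then show "z \<in> flag_class \<sigma> y" unfolding flag_class_eq by blast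
  qed
  have "y - x \<in> flag_relations \<sigma>"
    using subspace_neg[OF subspace_flag_relations assms] by simp
  with sub[OF assms] sub show ?thesis by blast
qed

lemma flag_class_in_carrier: "x \<in> flag_vectors \<sigma> \<Longrightarrow> flag_class \<sigma> x \<in> carrier (flag_algebra \<sigma>)"
  by (auto simp: flag_algebra_def FactRing_def A_RCOSETS_def' flag_class_def)

lemma flag_class_add:
  "flag_class \<sigma> x \<oplus>\<^bsub>flag_algebra \<sigma>\<^esub> flag_class \<sigma> y = flag_class \<sigma> (x + y)"
proof -
  have "flag_class \<sigma> x \<oplus>\<^bsub>flag_algebra \<sigma>\<^esub> flag_class \<sigma> y =
      (\<Union>a\<in>flag_class \<sigma> x. \<Union>b\<in>flag_class \<sigma> y. {a + b})"
    by (simp add: flag_algebra_def FactRing_def set_add_def' free_flag_ring_def)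
  also have "\<dots> = flag_class \<sigma> (x + y)"
  proof (intro equalityI subsetI)
    fix z assume "z \<in> (\<Union>a\<in>flag_class \<sigma> x. \<Union>b\<in>flag_class \<sigma> y. {a + b})"
    then obtain r s where "r \<in> flag_relations \<sigma>" "s \<in> flag_relations \<sigma>" "z = (r + x) + (s + y)"
      by (auto simp: flag_class_eq)
    then have "r + s \<in> flag_relations \<sigma>" "z = (r + s) + (x + y)"
      using subspace_add[OF subspace_flag_relations] by (auto simp: algebra_simps)
    then show "z \<in> flag_class \<sigma> (x + y)" unfolding flag_class_eq by blast
  next
    fix z assume "z \<in> flag_class \<sigma> (x + y)"
    then obtain r where r: "r \<in> flag_relations \<sigma>" "z = r + (x + y)" by (auto simp: flag_class_eq)
    have "r + x \<in> flag_class \<sigma> x" "0 + y \<in> flag_class \<sigma> y" "z = (r + x) + (0 + y)"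
      using r subspace_0[OF subspace_flag_relations] unfolding flag_class_eq by (blast, blast, simp add: add.assoc)
    then show "z \<in> (\<Union>a\<in>flag_class \<sigma> x. \<Union>b\<in>flag_class \<sigma> y. {a + b})" by blast
  qed
  finally show ?thesis .
qed

text \<open>
  The product of two cosets is defined as a union of cosets; since the relations form an ideal,
  all of these coincide.
\<close>

lemma flag_class_mult:
  assumes x: "x \<in> flag_vectors \<sigma>" and y: "y \<in> flag_vectors \<sigma>"
  shows "flag_class \<sigma> x \<otimes>\<^bsub>flag_algebra \<sigma>\<^esub> flag_class \<sigma> y = flag_class \<sigma> (fmult \<sigma> x y)"
proof -
  have "flag_class \<sigma> (fmult \<sigma> a b) = flag_class \<sigma> (fmult \<sigma> x y)"
    if ab: "a \<in> flag_class \<sigma> x" "b \<in> flag_class \<sigma> y" for a b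
  proof -
    obtain r s where r: "r \<in> flag_relations \<sigma>" "a = r + x" and s: "s \<in> flag_relations \<sigma>" "b = s + y"
      using ab by (auto simp: flag_class_eq)
    have b: "b \<in> flag_vectors \<sigma>"
      using s y flag_relations_subset subspace_add[OF subspace_flag_vectors] by blast
    have "fmult \<sigma> a b - fmult \<sigma> x y = fmult \<sigma> r b + fmult \<sigma> s x"
      using linear_add[OF linear_fmult_left[of \<sigma> b], of r x]
        linear_add[OF linear_fmult_left[of \<sigma> x], of s y]
      unfolding r(2) s(2)[symmetric] fmult_commute[of \<sigma> x b] fmult_commute[of \<sigma> x y] by simp
    also have "\<dots> \<in> flag_relations \<sigma>"
      using flag_relations_ideal[OF r(1) b] flag_relations_ideal[OF s(1) x]
        subspace_add[OF subspace_flag_relations] by blast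
    finally show ?thesis by (rule flag_class_eqI)
  qed
  moreover have "flag_class \<sigma> x \<noteq> {}" "flag_class \<sigma> y \<noteq> {}"
    using subspace_0[OF subspace_flag_relations] by (auto simp: flag_class_eq)
  moreover have "flag_class \<sigma> x \<otimes>\<^bsub>flag_algebra \<sigma>\<^esub> flag_class \<sigma> y =
      (\<Union>a\<in>flag_class \<sigma> x. \<Union>b\<in>flag_class \<sigma> y. flag_class \<sigma> (fmult \<sigma> a b))"
    by (simp add: flag_algebra_def FactRing_def rcoset_mult_def flag_class_def)
  ultimately show ?thesis by auto
qed

section \<open>Positive homomorphisms as functions on flags\<close>

context
  fixes \<sigma> \<psi>
  assumes hom: "\<psi> \<in> algebra_homs \<sigma>"
begin

private abbreviation "v x \<equiv> \<psi> (flag_class \<sigma> x)"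

lemma hom_add:
  assumes "x \<in> flag_vectors \<sigma>" "y \<in> flag_vectors \<sigma>"
  shows "v (x + y) = v x + v y"
proof -
  have "\<psi> \<in> ring_hom (flag_algebra \<sigma>) (ring_of_type_algebra :: real ring)"
    using hom by (simp add: algebra_homs_def)
  from ring_hom_add[OF this assms[THEN flag_class_in_carrier]] show ?thesis
    by (simp add: flag_class_add ring_of_type_algebra_def)
qed

lemma hom_mult:
  assumes "x \<in> flag_vectors \<sigma>" "y \<in> flag_vectors \<sigma>"
  shows "v (fmult \<sigma> x y) = v x * v y"
proof -
  have "\<psi> \<in> ring_hom (flag_algebra \<sigma>) (ring_of_type_algebra :: real ring)"
    using hom by (simp add: algebra_homs_def)
  from ring_hom_mult[OF this assms[THEN flag_class_in_carrier]] show ?thesis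
    by (simp add: flag_class_mult assms ring_of_type_algebra_def)
qed

lemma hom_unit: "v (vec (unit_flag \<sigma>)) = 1"
proof -
  have "\<psi> \<in> ring_hom (flag_algebra \<sigma>) (ring_of_type_algebra :: real ring)"
    using hom by (simp add: algebra_homs_def)
  from ring_hom_one[OF this] show ?thesis
    by (simp add: flag_algebra_def FactRing_def flag_class_def ring_of_type_algebra_def free_flag_ring_def)
qed

lemma hom_scale: "x \<in> flag_vectors \<sigma> \<Longrightarrow> v (c *\<^sub>R x) = c * v x"
  using hom by (simp add: algebra_homs_def)

lemma hom_zero: "v 0 = 0"
  using hom_scale[OF subspace_0[OF subspace_flag_vectors], of 0] by simp

lemma hom_relation: "r \<in> flag_relations \<sigma> \<Longrightarrow> v r = 0"
  using flag_class_eqI[of r 0 \<sigma>] hom_zero by simp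

lemma hom_sum:
  assumes "A \<subseteq> flags \<sigma>" "finite A"
  shows "v (\<Sum>G\<in>A. c G *\<^sub>R vec G) = (\<Sum>G\<in>A. c G * v (vec G))"
  using assms(2,1)
proof (induction A rule: finite_induct)
  case (insert G A)
  then have "vec G \<in> flag_vectors \<sigma>" "c G *\<^sub>R vec G \<in> flag_vectors \<sigma>"
    using vec_in_flag_vectors subspace_scale[OF subspace_flag_vectors] by auto
  moreover have "(\<Sum>G\<in>A. c G *\<^sub>R vec G) \<in> flag_vectors \<sigma>"
    using insert.prems by (intro sum_vec_in_flag_vectors) auto
  ultimately show ?case using insert by (simp add: hom_add hom_scale)
qed (simp add: hom_zero)

lemma hom_chain:
  assumes F: "F \<in> flags \<sigma>" and m: "flag_size F \<le> m"
  shows "v (vec F) = (\<Sum>G\<in>flags_of_size \<sigma> m. density F G * v (vec G))"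
proof -
  let ?S = "\<Sum>G\<in>flags_of_size \<sigma> m. density F G *\<^sub>R vec G"
  have "?S \<in> flag_vectors \<sigma>"
    by (intro sum_vec_in_flag_vectors flags_of_size_subset)
  then have "v (vec F) = v (vec F - ?S) + v ?S"
    using hom_add[of "vec F - ?S" ?S] flag_relation[OF assms] flag_relations_subset by force
  then show ?thesis
    by (simp add: hom_relation[OF flag_relation[OF assms]]
        hom_sum[OF flags_of_size_subset finite_flags_of_size])
qed

lemma hom_flag_prod:
  assumes F: "F \<in> flags \<sigma>" and H: "H \<in> flags \<sigma>"
  shows "v (vec F) * v (vec H) =
    (\<Sum>G\<in>flags_of_size \<sigma> (flag_size F + flag_size H - type_size \<sigma>). density2 F H G * v (vec G))"
proof -
  have "v (vec F) * v (vec H) = v (flag_prod \<sigma> F H)"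
    using hom_mult[OF assms[THEN vec_in_flag_vectors]] by (simp add: fmult_vec)
  then show ?thesis
    unfolding flag_prod_def by (simp add: hom_sum[OF flags_of_size_subset finite_flags_of_size])
qed

end

lemma Hom_plusE:
  assumes "\<phi> \<in> Hom_plus \<sigma>"
  obtains \<psi> where "\<psi> \<in> algebra_homs \<sigma>" "\<And>F. F \<in> flags \<sigma> \<Longrightarrow> \<phi> F = \<psi> (flag_class \<sigma> (vec F))"
    "\<And>F. F \<in> flags \<sigma> \<Longrightarrow> 0 \<le> \<phi> F" "\<phi> \<in> extensional (flags \<sigma>)"
  using assms unfolding Hom_plus_def by auto

lemma Hom_plus_nonneg: "\<phi> \<in> Hom_plus \<sigma> \<Longrightarrow> F \<in> flags \<sigma> \<Longrightarrow> 0 \<le> \<phi> F"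
  by (erule Hom_plusE)

lemma Hom_plus_chain:
  assumes "\<phi> \<in> Hom_plus \<sigma>" "F \<in> flags \<sigma>" "flag_size F \<le> m"
  shows "\<phi> F = (\<Sum>G\<in>flags_of_size \<sigma> m. density F G * \<phi> G)"
proof -
  obtain \<psi> where \<psi>: "\<psi> \<in> algebra_homs \<sigma>" "\<And>F. F \<in> flags \<sigma> \<Longrightarrow> \<phi> F = \<psi> (flag_class \<sigma> (vec F))"
    using assms(1) by (elim Hom_plusE) blast
  show ?thesis
    using hom_chain[OF \<psi>(1) assms(2,3)] by (simp add: \<psi>(2) assms(2) flags_of_size_def)
qed

lemma Hom_plus_mult:
  assumes "\<phi> \<in> Hom_plus \<sigma>" "F \<in> flags \<sigma>" "H \<in> flags \<sigma>"
  shows "\<phi> F * \<phi> H =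
    (\<Sum>G\<in>flags_of_size \<sigma> (flag_size F + flag_size H - type_size \<sigma>). density2 F H G * \<phi> G)"
proof -
  obtain \<psi> where \<psi>: "\<psi> \<in> algebra_homs \<sigma>" "\<And>F. F \<in> flags \<sigma> \<Longrightarrow> \<phi> F = \<psi> (flag_class \<sigma> (vec F))"
    using assms(1) by (elim Hom_plusE) blast
  show ?thesis
    using hom_flag_prod[OF \<psi>(1) assms(2,3)] by (simp add: \<psi>(2) assms(2,3) flags_of_size_def)
qed

text \<open>
  Together with \<open>Hom_plus_chain\<close> this presents a positive homomorphism as a probability
  distribution on the flags with \<open>m\<close> vertices, for each \<open>m\<close>, whose expected densities are its values.
\<close>

lemma Hom_plus_sum:
  assumes "\<phi> \<in> Hom_plus \<sigma>" "type_size \<sigma> \<le> m"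
  shows "(\<Sum>G\<in>flags_of_size \<sigma> m. \<phi> G) = 1"
proof -
  obtain \<psi> where \<psi>: "\<psi> \<in> algebra_homs \<sigma>" "\<And>F. F \<in> flags \<sigma> \<Longrightarrow> \<phi> F = \<psi> (flag_class \<sigma> (vec F))"
    using assms(1) by (elim Hom_plusE) blast
  have "\<phi> (unit_flag \<sigma>) = 1"
    using hom_unit[OF \<psi>(1)] \<psi>(2)[OF unit_flag_in_flags] by simp
  then show ?thesis
    using Hom_plus_chain[OF assms(1) unit_flag_in_flags, of m] assms(2)
    by (simp add: flag_size_unit density_unit_flag flags_of_size_def)
qed

lemma Hom_plus_le_1:
  assumes "\<phi> \<in> Hom_plus \<sigma>" "F \<in> flags \<sigma>"
  shows "\<phi> F \<le> 1"
proof -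
  have "\<phi> F \<le> (\<Sum>G\<in>flags_of_size \<sigma> (flag_size F). \<phi> G)"
    using Hom_plus_nonneg[OF assms(1)] assms(2)
    by (intro member_le_sum finite_flags_of_size) (auto simp: flags_of_size_def)
  then show ?thesis using Hom_plus_sum[OF assms(1) flag_size_ge[OF assms(2)]] by simp
qed

section \<open>Unlabelling\<close>

abbreviation rooted_at :: "preflag \<Rightarrow> nat \<Rightarrow> nat \<Rightarrow> preflag" where
  "rooted_at G u v \<equiv> G\<lparr>labels := [u, v]\<rparr>"

lemma is_preflag_rooted_at:
  "is_preflag \<sigma> G \<Longrightarrow> (u, v) \<in> arcs G \<Longrightarrow> is_preflag Type_A (rooted_at G u v)"
  by (simp add: is_preflag_def)

lemma is_preflag_unlabelled: "is_preflag \<sigma> G \<Longrightarrow> is_preflag Type_0 (G\<lparr>labels := []\<rparr>)"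
  by (simp add: is_preflag_def)

lemma iso_map_relabel:
  assumes "iso_map f G H"
  shows "iso_map f (G\<lparr>labels := ls\<rparr>) (H\<lparr>labels := map f ls\<rparr>)"
  using assms by (simp add: iso_map_def)

lemma flags_Type_0_labels: "is_preflag Type_0 G \<Longrightarrow> G\<lparr>labels := []\<rparr> = G"
  by (simp add: is_preflag_def)

lemma finite_arcs: "is_preflag \<sigma> G \<Longrightarrow> finite (arcs G)"
  unfolding is_preflag_def tournament_def by (meson finite_SigmaI finite_subset)

lemma unlabel_in_flags: "F \<in> flags \<sigma> \<Longrightarrow> unlabel F \<in> flags Type_0"
  unfolding unlabel_def by (intro abs_flag_in_flags is_preflag_unlabelled preflag_rep)

lemma flag_size_unlabel:
  assumes "F \<in> flags \<sigma>"
  shows "flag_size (unlabel F) = flag_size F"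
  unfolding unlabel_def
  using flag_size_abs[OF is_preflag_unlabelled[OF preflag_rep[OF assms]]] by (simp add: flag_size_def)

lemma unlabel_abs:
  assumes "is_preflag \<sigma> G"
  shows "unlabel (abs_flag G) = abs_flag (G\<lparr>labels := []\<rparr>)"
proof -
  have R: "is_preflag \<sigma> (rep_flag (abs_flag G))"
    by (rule preflag_rep[OF abs_flag_in_flags[OF assms]])
  obtain f where "iso_map f (rep_flag (abs_flag G)) G"
    using rep_abs_flag[OF assms] unfolding flag_iso_def by blast
  from iso_map_relabel[OF this, of "[]"] show ?thesis
    unfolding unlabel_def
    using abs_flag_eqI[OF is_preflag_unlabelled[OF R] is_preflag_unlabelled[OF assms]] by simp
qed

lemma unlabel_rooted_at:
  assumes "is_preflag Type_0 G" "(u, v) \<in> arcs G"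
  shows "unlabel (abs_flag (rooted_at G u v)) = abs_flag G"
  using unlabel_abs[OF is_preflag_rooted_at[OF assms]] flags_Type_0_labels[OF assms(1)] by simp

definition rootings :: "flag \<Rightarrow> preflag \<Rightarrow> real" where
  "rootings F G = (\<Sum>(u, v)\<in>arcs G. of_bool (abs_flag (rooted_at G u v) = F))"

lemma rootings_eq_0:
  assumes "is_preflag Type_0 G" "abs_flag G \<noteq> unlabel F"
  shows "rootings F G = 0"
  unfolding rootings_def using unlabel_rooted_at[OF assms(1)] assms(2)
  by (intro sum.neutral) auto

lemma rootings_iso:
  assumes G: "is_preflag Type_0 G" and H: "is_preflag Type_0 H" and eq: "abs_flag G = abs_flag H"
  shows "rootings F G = rootings F H"
proof -
  obtain f where f: "iso_map f G H"
    using abs_flag_eq_iff[OF G H] eq unfolding flag_iso_def by blast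
  let ?g = "inv_into (verts G) f"
  have b: "bij_betw f (verts G) (verts H)" and arc: "\<And>u v. u \<in> verts G \<Longrightarrow> v \<in> verts G \<Longrightarrow>
      (u, v) \<in> arcs G \<longleftrightarrow> (f u, f v) \<in> arcs H"
    using f by (auto simp: iso_map_def)
  have inv: "?g (f x) = x" if "x \<in> verts G" for x
    using b that by (simp add: bij_betw_def)
  have inv': "f (?g y) = y" "?g y \<in> verts G" if "y \<in> verts H" for y
    using b that by (auto simp: bij_betw_def f_inv_into_f inv_into_into)
  have bij: "bij_betw (map_prod f f) (arcs G) (arcs H)"
  proof (rule bij_betwI[where g = "map_prod ?g ?g"])
    show "map_prod f f \<in> arcs G \<rightarrow> arcs H"
    proof
      fix p assume p: "p \<in> arcs G"
      then have "(fst p, snd p) \<in> arcs G" by simp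
      from arc[OF preflag_arcsD(1,2)[OF G this]] p show "map_prod f f p \<in> arcs H"
        by (simp add: map_prod_def case_prod_unfold)
    qed
    show "map_prod ?g ?g \<in> arcs H \<rightarrow> arcs G"
    proof
      fix p assume p: "p \<in> arcs H"
      then have "(fst p, snd p) \<in> arcs H" by simp
      note D = preflag_arcsD(1,2)[OF H this]
      from arc[OF inv'(2)[OF D(1)] inv'(2)[OF D(2)]] p show "map_prod ?g ?g p \<in> arcs G"
        by (simp add: map_prod_def case_prod_unfold inv'(1) D)
    qed
    show "map_prod ?g ?g (map_prod f f p) = p" if "p \<in> arcs G" for p
      using that inv preflag_arcsD(1,2)[OF G, of "fst p" "snd p"] by (cases p) auto
    show "map_prod f f (map_prod ?g ?g p) = p" if "p \<in> arcs H" for p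
      using that inv'(1) preflag_arcsD(1,2)[OF H, of "fst p" "snd p"] by (cases p) auto
  qed
  have "rootings F H = (\<Sum>p\<in>arcs H. of_bool (abs_flag (rooted_at H (fst p) (snd p)) = F))"
    unfolding rootings_def by (simp add: case_prod_unfold)
  also have "\<dots> = (\<Sum>p\<in>arcs G. of_bool (abs_flag (rooted_at H (fst (map_prod f f p)) (snd (map_prod f f p))) = F))"
    by (rule sum.reindex_bij_betw[OF bij, symmetric])
  also have "\<dots> = (\<Sum>p\<in>arcs G. of_bool (abs_flag (rooted_at G (fst p) (snd p)) = F))"
  proof (rule sum.cong[OF refl])
    fix p assume p: "p \<in> arcs G"
    then have "map_prod f f p \<in> arcs H" using bij by (auto simp: bij_betw_def)
    then have "abs_flag (rooted_at G (fst p) (snd p)) = abs_flag (rooted_at H (f (fst p)) (f (snd p)))"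
      using iso_map_relabel[OF f, of "[fst p, snd p]"] p
      by (intro abs_flag_eqI[OF is_preflag_rooted_at[OF G] is_preflag_rooted_at[OF H]])
         (simp_all add: map_prod_def case_prod_unfold)
    then show "of_bool (abs_flag (rooted_at H (fst (map_prod f f p)) (snd (map_prod f f p))) = F) =
       (of_bool (abs_flag (rooted_at G (fst p) (snd p)) = F) :: real)"
      by simp
  qed
  finally show ?thesis
    unfolding rootings_def by (simp add: case_prod_unfold)
qed

lemma labelling_prob_eq:
  assumes F: "F \<in> flags Type_A"
  shows "labelling_prob F = rootings F (rep_flag (unlabel F)) / real (flag_size F * (flag_size F - 1))"
proof -
  let ?M = "rep_flag (unlabel F)"
  let ?P = "{(u, v). u \<in> verts ?M \<and> v \<in> verts ?M \<and> u \<noteq> v}"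
  have M: "is_preflag Type_0 ?M" by (rule preflag_rep[OF unlabel_in_flags[OF F]])
  have c: "card (verts ?M) = flag_size F" using flag_size_unlabel[OF F] by (simp add: flag_size_def)
  have iff: "(u, v) \<in> ?P \<and> rooted_at ?M u v \<simeq>\<^sub>F rep_flag F \<longleftrightarrow>
      (u, v) \<in> arcs ?M \<and> abs_flag (rooted_at ?M u v) = F" for u v
  proof (cases "(u, v) \<in> arcs ?M")
    case True
    then show ?thesis
      using preflag_arcsD[OF M True] iso_rep_flag_iff[OF is_preflag_rooted_at[OF M True]] by simp
  next
    case False
    have "\<not> rooted_at ?M u v \<simeq>\<^sub>F rep_flag F"
    proof
      assume "rooted_at ?M u v \<simeq>\<^sub>F rep_flag F"
      then have "is_preflag Type_A (rooted_at ?M u v)"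
        using is_preflag_iso[OF flag_iso_sym] preflag_rep[OF F] by blast
      with False show False by (simp add: is_preflag_def)
    qed
    with False show ?thesis by blast
  qed
  have "real (card {(u, v) \<in> ?P. rooted_at ?M u v \<simeq>\<^sub>F rep_flag F}) =
      real (card {p \<in> arcs ?M. abs_flag (rooted_at ?M (fst p) (snd p)) = F})"
    by (rule arg_cong[where f = "\<lambda>A. real (card A)"]) (use iff in auto)
  also have "\<dots> = rootings F ?M"
    unfolding rootings_def card_eq_sum_of_bool[OF finite_arcs[OF M]] by (simp add: case_prod_unfold)
  finally have 1: "real (card {(u, v) \<in> ?P. rooted_at ?M u v \<simeq>\<^sub>F rep_flag F}) = rootings F ?M" .
  have "?P = (SIGMA u:verts ?M. verts ?M - {u})" by auto
  then have "card ?P = flag_size F * (flag_size F - 1)"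
    using finite_verts[OF M] c by (simp add: card_SigmaI card_Diff_singleton)
  then show ?thesis unfolding labelling_prob_def Let_def 1 by simp
qed

lemma binomial_drop_two:
  assumes "2 \<le> n" "n \<le> m"
  shows "real (m choose n) * real (n * (n - 1)) = real (m - 2 choose (n - 2)) * real (m * (m - 1))"
proof -
  define a b where "a = n - 2" and "b = m - 2"
  then have ab: "n = Suc (Suc a)" "m = Suc (Suc b)" using assms by simp_all
  have "(m choose n) * (n * (n - 1)) = (Suc (Suc b) choose Suc (Suc a)) * Suc (Suc a) * Suc a"
    unfolding ab by (simp only: mult.assoc diff_Suc_1)
  also have "\<dots> = Suc (Suc b) * ((Suc b choose Suc a) * Suc a)"
    by (simp only: Suc_times_binomial_eq[symmetric] mult.assoc)
  also have "\<dots> = Suc (Suc b) * (Suc b * (b choose a))"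
    by (simp only: Suc_times_binomial_eq)
  also have "\<dots> = (m - 2 choose (n - 2)) * (m * (m - 1))"
    unfolding ab by (simp only: mult_ac diff_Suc_1 diff_Suc_Suc numeral_2_eq_2 diff_zero)
  finally have "(m choose n) * (n * (n - 1)) = (m - 2 choose (n - 2)) * (m * (m - 1))" .
  then show ?thesis by (metis of_nat_mult)
qed

text \<open>
  To choose a set of vertices at random and then two labelled vertices in it amounts to choosing
  the labelled vertices first and then a set that contains them.
\<close>

lemma labelling_prob_density:
  assumes G: "is_preflag Type_0 G" and F: "F \<in> flags Type_A" and n: "flag_size F \<le> card (verts G)"
  shows "labelling_prob F * density (unlabel F) (abs_flag G) =
    (\<Sum>(u, v)\<in>arcs G. density F (abs_flag (rooted_at G u v))) /
    real (card (verts G) * (card (verts G) - 1))"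
proof -
  let ?n = "flag_size F" and ?m = "card (verts G)" and ?M = "rep_flag (unlabel F)"
  have n2: "2 \<le> ?n" using flag_size_ge[OF F] by simp
  have M: "is_preflag Type_0 ?M" by (rule preflag_rep[OF unlabel_in_flags[OF F]])
  have fl: "flag_size (unlabel F) = ?n" by (rule flag_size_unlabel[OF F])
  define B where "B = real (?m - 2 choose (?n - 2))"
  have B: "B > 0" using n n2 by (simp add: B_def zero_less_binomial_iff)
  have cG: "card (rooted_sets G ?n) = ?m choose ?n"
    using card_rooted_sets[OF G, of ?n] by simp
  \<comment> \<open>count the pairs of an \<open>n\<close>-set and an arc inside it that together induce \<open>F\<close>: set first\<close>
  have "rootings F ?M * (\<Sum>S\<in>rooted_sets G ?n. of_bool (subflag G S = unlabel F)) =
      (\<Sum>S\<in>rooted_sets G ?n. rootings F (induced G S))"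
    unfolding sum_distrib_left
  proof (rule sum.cong[OF refl])
    fix S assume "S \<in> rooted_sets G ?n"
    then have I: "is_preflag Type_0 (induced G S)" by (rule is_preflag_rooted[OF G])
    show "rootings F ?M * of_bool (subflag G S = unlabel F) = rootings F (induced G S)"
      using rootings_eq_0[OF I, of F] rootings_iso[OF M I, of F]
      by (cases "subflag G S = unlabel F") (simp_all add: abs_rep_flag)
  qed
  \<comment> \<open>and arc first\<close>
  also have "\<dots> = (\<Sum>S\<in>rooted_sets G ?n. \<Sum>p\<in>arcs G. of_bool (fst p \<in> S \<and> snd p \<in> S \<and>
      abs_flag (rooted_at (induced G S) (fst p) (snd p)) = F))"
  proof (rule sum.cong[OF refl])
    fix S assume "S \<in> rooted_sets G ?n"
    have "rootings F (induced G S) =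
        (\<Sum>p\<in>arcs G \<inter> S \<times> S. of_bool (abs_flag (rooted_at (induced G S) (fst p) (snd p)) = F))"
      unfolding rootings_def by (simp add: case_prod_unfold)
    also have "\<dots> = (\<Sum>p\<in>arcs G. of_bool (fst p \<in> S \<and> snd p \<in> S \<and>
      abs_flag (rooted_at (induced G S) (fst p) (snd p)) = F))"
      by (rule sum.mono_neutral_cong_left[OF finite_arcs[OF G]]) auto
    finally show "rootings F (induced G S) = (\<Sum>p\<in>arcs G. of_bool (fst p \<in> S \<and> snd p \<in> S \<and>
      abs_flag (rooted_at (induced G S) (fst p) (snd p)) = F))" .
  qed
  also have "\<dots> = (\<Sum>p\<in>arcs G. \<Sum>S\<in>rooted_sets G ?n. of_bool (fst p \<in> S \<and> snd p \<in> S \<and>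
      abs_flag (rooted_at (induced G S) (fst p) (snd p)) = F))"
    by (rule sum.swap)
  also have "\<dots> = (\<Sum>p\<in>arcs G. density F (abs_flag (rooted_at G (fst p) (snd p))) * B)"
  proof (rule sum.cong[OF refl])
    fix p assume p: "p \<in> arcs G"
    let ?Q = "rooted_at G (fst p) (snd p)"
    have Q: "is_preflag Type_A ?Q" using p by (intro is_preflag_rooted_at[OF G]) simp
    have ind: "induced ?Q S = rooted_at (induced G S) (fst p) (snd p)" for S
      by (simp add: induced_def)
    have "labels G = []" using G by (simp add: is_preflag_def)
    then have "rooted_sets ?Q ?n = {S \<in> rooted_sets G ?n. fst p \<in> S \<and> snd p \<in> S}"
      by (auto simp: rooted_sets_def)
    then have "(\<Sum>S\<in>rooted_sets G ?n. of_bool (fst p \<in> S \<and> snd p \<in> S \<and>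
        abs_flag (rooted_at (induced G S) (fst p) (snd p)) = F)) =
      (\<Sum>S\<in>rooted_sets ?Q ?n. of_bool (subflag ?Q S = F) :: real)"
      unfolding ind
      by (intro sum.mono_neutral_cong_right[OF finite_rooted_sets[OF G]]) auto
    also have "\<dots> = density F (abs_flag ?Q) * B"
      using B card_rooted_sets[OF Q, of ?n] n2 by (simp add: density_abs[OF Q] B_def)
    finally show "(\<Sum>S\<in>rooted_sets G ?n. of_bool (fst p \<in> S \<and> snd p \<in> S \<and>
        abs_flag (rooted_at (induced G S) (fst p) (snd p)) = F)) = density F (abs_flag ?Q) * B" .
  qed
  finally have main: "rootings F ?M * (\<Sum>S\<in>rooted_sets G ?n. of_bool (subflag G S = unlabel F)) =
      (\<Sum>(u, v)\<in>arcs G. density F (abs_flag (rooted_at G u v))) * B"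
    by (simp add: sum_distrib_right case_prod_unfold)
  have "labelling_prob F * density (unlabel F) (abs_flag G) =
      rootings F ?M * (\<Sum>S\<in>rooted_sets G ?n. of_bool (subflag G S = unlabel F)) /
      (real (?m choose ?n) * real (?n * (?n - 1)))"
    unfolding labelling_prob_eq[OF F] density_abs[OF G] fl cG by simp
  also have "\<dots> = (\<Sum>(u, v)\<in>arcs G. density F (abs_flag (rooted_at G u v))) * B / (B * real (?m * (?m - 1)))"
    unfolding main binomial_drop_two[OF n2 n] B_def ..
  also have "\<dots> = (\<Sum>(u, v)\<in>arcs G. density F (abs_flag (rooted_at G u v))) / real (?m * (?m - 1))"
    using B by (simp del: of_nat_mult)
  finally show ?thesis .
qed

lemma hom_eval_downward:
  assumes \<phi>: "\<phi> \<in> Hom_plus Type_0" and F: "F \<in> flags Type_A" and m: "flag_size F \<le> m"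
  shows "hom_eval \<phi> (downward F) =
    (\<Sum>G\<in>flags_of_size Type_0 m. \<phi> G * (labelling_prob F * density (unlabel F) G))"
proof -
  have "hom_eval \<phi> (downward F) = labelling_prob F * \<phi> (unlabel F)"
    by (cases "labelling_prob F = 0") (auto simp: hom_eval_def downward_def lookup_scaleR keys_def lookup_single when_def)
  also have "\<dots> = (\<Sum>G\<in>flags_of_size Type_0 m. \<phi> G * (labelling_prob F * density (unlabel F) G))"
    using Hom_plus_chain[OF \<phi> unlabel_in_flags[OF F], of m] m
    by (simp add: flag_size_unlabel[OF F] sum_distrib_left mult_ac)
  finally show ?thesis .
qed

section \<open>Transitive triangles over an arc\<close>

text \<open>
  If \<open>u\<close> beats \<open>v\<close>, these are the unlabelled vertices of the copies of \<open>Tr3A\<close> whose labelled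
  vertices are \<open>u\<close> and \<open>v\<close>, the middle vertices of the transitive triangles over the arc.
\<close>

definition midverts :: "('a \<times> 'a) set \<Rightarrow> 'a \<Rightarrow> 'a \<Rightarrow> 'a set" where
  "midverts E u v = {w. (u, w) \<in> E \<and> (w, v) \<in> E}"

abbreviation Tr3A_rep :: preflag where
  "Tr3A_rep \<equiv> \<lparr>verts = {1, 2, 3}, arcs = {(1, 2), (1, 3), (3, 2)}, labels = [1, 2]\<rparr>"

lemma is_preflag_Tr3A_rep: "is_preflag Type_A Tr3A_rep"
  by (auto simp: is_preflag_def tournament_def)

lemma Tr3A_in_flags: "Tr3A \<in> flags Type_A" and flag_size_Tr3A: "flag_size Tr3A = 3"
  using abs_flag_in_flags[OF is_preflag_Tr3A_rep] flag_size_abs[OF is_preflag_Tr3A_rep]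
  by (simp_all add: Tr3A_def)

context
  fixes G u v
  assumes G: "is_preflag Type_A G" and L: "labels G = [u, v]"
begin

lemma root_arc: "(u, v) \<in> arcs G" "u \<in> verts G" "v \<in> verts G" "u \<noteq> v"
proof -
  show uv: "(u, v) \<in> arcs G" using G L by (auto simp: is_preflag_def)
  show "u \<in> verts G" "v \<in> verts G" "u \<noteq> v" using preflag_arcsD[OF G uv] by auto
qed

lemma rooted_sets_3: "bij_betw (\<lambda>w. {u, v, w}) (verts G - {u, v}) (rooted_sets G 3)"
  unfolding bij_betw_def
proof
  show "inj_on (\<lambda>w. {u, v, w}) (verts G - {u, v})" by (auto simp: inj_on_def)
  show "(\<lambda>w. {u, v, w}) ` (verts G - {u, v}) = rooted_sets G 3"
  proof (intro equalityI subsetI)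
    fix S assume "S \<in> (\<lambda>w. {u, v, w}) ` (verts G - {u, v})"
    then show "S \<in> rooted_sets G 3" using root_arc L by (auto simp: rooted_sets_def)
  next
    fix S assume S: "S \<in> rooted_sets G 3"
    note D = rooted_setsD[OF S]
    have "card (S - {u, v}) = 1"
      using D L root_arc by (simp add: card_Diff_subset)
    then obtain w where "S - {u, v} = {w}" by (auto simp: card_1_singleton_iff)
    then have "S = {u, v, w}" "w \<in> verts G - {u, v}" using D L by auto
    then show "S \<in> (\<lambda>w. {u, v, w}) ` (verts G - {u, v})" by blast
  qed
qed

lemma subflag_Tr3A_iff:
  assumes w: "w \<in> verts G - {u, v}"
  shows "subflag G {u, v, w} = Tr3A \<longleftrightarrow> w \<in> midverts (arcs G) u v"
proof -
  have S: "{u, v, w} \<in> rooted_sets G 3"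
    using bij_betwE[OF rooted_sets_3] w by blast
  note I = is_preflag_rooted[OF G S]
  note irr = preflag_arcsD(3)[OF G] and asym = preflag_arcsD(4)[OF G]
  have "subflag G {u, v, w} = Tr3A \<longleftrightarrow> Tr3A_rep \<simeq>\<^sub>F induced G {u, v, w}"
    unfolding Tr3A_def using abs_flag_eq_iff[OF is_preflag_Tr3A_rep I] by (simp only: eq_commute)
  also have "\<dots> \<longleftrightarrow> (\<exists>f. iso_map f Tr3A_rep (induced G {u, v, w}))"
    unfolding flag_iso_def using I is_preflag_Tr3A_rep by blast
  also have "\<dots> \<longleftrightarrow> w \<in> midverts (arcs G) u v"
  proof
    assume "\<exists>f. iso_map f Tr3A_rep (induced G {u, v, w})"
    then obtain f where f: "iso_map f Tr3A_rep (induced G {u, v, w})" by blast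
    then have f12: "f 1 = u" "f 2 = v" and im: "f ` {1, 2, 3} = {u, v, w}"
      using L by (auto simp: iso_map_def bij_betw_def)
    then have f3: "f 3 = w" using w by auto
    have arc: "(f x, f y) \<in> arcs (induced G {u, v, w})"
      if "(x, y) \<in> arcs Tr3A_rep" "x \<in> verts Tr3A_rep" "y \<in> verts Tr3A_rep" for x y
      using f that unfolding iso_map_def by blast
    show "w \<in> midverts (arcs G) u v"
      using arc[of 1 3] arc[of 3 2] f12 f3 by (simp add: midverts_def)
  next
    assume "w \<in> midverts (arcs G) u v"
    then have a: "(u, w) \<in> arcs G" "(w, v) \<in> arcs G" by (auto simp: midverts_def)
    have "iso_map (\<lambda>x. if x = 1 then u else if x = 2 then v else w) Tr3A_rep (induced G {u, v, w})"
      unfolding iso_map_def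
    proof (intro conjI ballI)
      show "bij_betw (\<lambda>x. if x = 1 then u else if x = 2 then v else w)
          (verts Tr3A_rep) (verts (induced G {u, v, w}))"
        using root_arc w by (auto simp: bij_betw_def inj_on_def)
      show "labels (induced G {u, v, w}) =
          map (\<lambda>x. if x = 1 then u else if x = 2 then v else w) (labels Tr3A_rep)"
        using L by simp
      fix x y assume "x \<in> verts Tr3A_rep" "y \<in> verts Tr3A_rep"
      then show "(x, y) \<in> arcs Tr3A_rep \<longleftrightarrow> (if x = 1 then u else if x = 2 then v else w,
          if y = 1 then u else if y = 2 then v else w) \<in> arcs (induced G {u, v, w})"
        using a root_arc(1) asym[OF root_arc(1)] asym[OF a(1)] asym[OF a(2)] irr[of u u] irr[of v v] irr[of w w]
        by auto
    qed
    then show "\<exists>f. iso_map f Tr3A_rep (induced G {u, v, w})" by blast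
  qed
  finally show ?thesis .
qed

lemma midverts_subset: "midverts (arcs G) u v \<subseteq> verts G - {u, v}"
  using preflag_arcsD[OF G] unfolding midverts_def by blast

lemma finite_midverts: "finite (midverts (arcs G) u v)"
  using finite_subset[OF midverts_subset] finite_verts[OF G] by simp

lemma sum_rooted_sets_Tr3A:
  "(\<Sum>S\<in>rooted_sets G 3. of_bool (subflag G S = Tr3A) * h S) =
    (\<Sum>w\<in>midverts (arcs G) u v. h {u, v, w} :: real)"
proof -
  have "(\<Sum>S\<in>rooted_sets G 3. of_bool (subflag G S = Tr3A) * h S) =
      (\<Sum>w\<in>verts G - {u, v}. of_bool (subflag G {u, v, w} = Tr3A) * h {u, v, w})"
    by (rule sum.reindex_bij_betw[OF rooted_sets_3, symmetric])
  also have "\<dots> = (\<Sum>w\<in>verts G - {u, v}. of_bool (w \<in> midverts (arcs G) u v) * h {u, v, w})"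
    by (rule sum.cong[OF refl]) (simp only: subflag_Tr3A_iff)
  also have "\<dots> = (\<Sum>w\<in>midverts (arcs G) u v. h {u, v, w})"
    using finite_verts[OF G] midverts_subset
    by (intro sum.mono_neutral_cong_right) auto
  finally show ?thesis .
qed

lemma density_Tr3A:
  "density Tr3A (abs_flag G) = real (card (midverts (arcs G) u v)) / real (card (verts G) - 2)"
  using sum_rooted_sets_Tr3A[of "\<lambda>_. 1"] card_rooted_sets[OF G, of 3]
  by (simp add: density_abs[OF G] flag_size_Tr3A)

end

lemma density2_Tr3A:
  assumes G: "is_preflag Type_A G" and L: "labels G = [u, v]" and m: "4 \<le> card (verts G)"
  defines "a \<equiv> real (card (midverts (arcs G) u v))"
  shows "density2 Tr3A Tr3A (abs_flag G) = a * (a - 1) / real ((card (verts G) - 2) * (card (verts G) - 3))"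
proof -
  let ?B = "midverts (arcs G) u v" and ?m = "card (verts G)"
  note root = root_arc[OF G L] and sub = midverts_subset[OF G L] and fin = finite_midverts[OF G L]
  have "density Tr3A (subflag G (remaining G {u, v, w})) = (a - 1) / real (?m - 3)"
    if w: "w \<in> ?B" for w
  proof -
    have wV: "w \<in> verts G" "w \<noteq> u" "w \<noteq> v" using sub w by auto
    have R: "remaining G {u, v, w} = verts G - {w}"
      using L root wV by (auto simp: remaining_def)
    have "midverts (arcs (induced G (verts G - {w}))) u v = ?B - {w}"
      using root wV preflag_arcsD[OF G] unfolding midverts_def arcs_induced by blast
    moreover have "card (verts G - {w}) = ?m - 1" using wV by simp
    moreover have "real (card (?B - {w})) = a - 1"
    proof -
      have "card ?B > 0" using w fin by (auto simp: card_gt_0_iff)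
      then show ?thesis using w by (simp add: a_def card_Diff_singleton of_nat_diff)
    qed
    ultimately show ?thesis
      using density_Tr3A[OF is_preflag_remaining[OF G, of "{u, v, w}"], of u v] L
      by (simp add: R numeral_3_eq_3)
  qed
  then have "(\<Sum>w\<in>?B. density Tr3A (subflag G (remaining G {u, v, w}))) =
      (\<Sum>w\<in>?B. (a - 1) / real (?m - 3))"
    by (intro sum.cong refl)
  then have "density2 Tr3A Tr3A (abs_flag G) = (\<Sum>w\<in>?B. (a - 1) / real (?m - 3)) / real (?m - 2)"
    using density2_conditional[OF G Tr3A_in_flags Tr3A_in_flags] m card_rooted_sets[OF G, of 3]
    by (simp only: flag_size_Tr3A sum_rooted_sets_Tr3A[OF G L]) simp
  also have "(\<Sum>w\<in>?B. (a - 1) / real (?m - 3)) = a * (a - 1) / real (?m - 3)"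
    by (simp add: a_def)
  also have "\<dots> / real (?m - 2) = a * (a - 1) / real ((?m - 2) * (?m - 3))"
    unfolding of_nat_mult divide_divide_eq_left mult.commute[of "real (?m - 3)"] ..
  finally show ?thesis .
qed

lemma tournamentD:
  assumes "tournament V E"
  shows "finite V" "E \<subseteq> V \<times> V" "(v, v) \<notin> E"
    "u \<in> V \<Longrightarrow> v \<in> V \<Longrightarrow> u \<noteq> v \<Longrightarrow> (u, v) \<in> E \<longleftrightarrow> (v, u) \<notin> E"
  using assms unfolding tournament_def by blast+

lemma card_arcs:
  assumes "tournament V E"
  shows "2 * card E = card V * (card V - 1)"
proof -
  note fin = tournamentD(1)[OF assms] and E = tournamentD(2)[OF assms]
    and irr = tournamentD(3)[OF assms] and tot = tournamentD(4)[OF assms]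
  have finE: "finite E" using E fin by (meson finite_SigmaI finite_subset)
  have swap: "(u, v) \<in> prod.swap ` E \<longleftrightarrow> (v, u) \<in> E" for u v by force
  have "p \<in> E \<union> prod.swap ` E \<longleftrightarrow> p \<in> (SIGMA u:V. V - {u})" for p
  proof (cases p)
    case (Pair u v)
    then show ?thesis
      using subsetD[OF E, of "(u, v)"] subsetD[OF E, of "(v, u)"] irr[of u] tot[of u v]
      by (auto simp: swap)
  qed
  then have "E \<union> prod.swap ` E = (SIGMA u:V. V - {u})" by blast
  moreover have "E \<inter> prod.swap ` E = {}"
  proof -
    have "(v, u) \<notin> E" if "(u, v) \<in> E" for u v
      using tot[of u v] that subsetD[OF E that] irr[of u] by (cases "u = v") auto
    then show ?thesis by auto
  qed
  moreover have "card (SIGMA u:V. V - {u}) = card V * (card V - 1)"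
    using fin by (simp add: card_SigmaI)
  ultimately have "card E + card (prod.swap ` E) = card V * (card V - 1)"
    using card_Un_disjoint[of E "prod.swap ` E"] finE by simp
  then show ?thesis by (simp add: card_image)
qed

text \<open>
  Up to normalization, the two sums below are the values of the downward operator on \<open>Tr3A\<close> and
  on its square in the tournament \<open>E\<close>.
\<close>

definition triangles :: "('a \<times> 'a) set \<Rightarrow> real" where
  "triangles E = (\<Sum>(u, v)\<in>E. real (card (midverts E u v)))"

definition triangle_pairs :: "('a \<times> 'a) set \<Rightarrow> real" where
  "triangle_pairs E = (\<Sum>(u, v)\<in>E. real (card (midverts E u v)) * (real (card (midverts E u v)) - 1))"

lemma labelling_prob_unit:
  assumes G: "is_preflag Type_0 G" and m: "2 \<le> card (verts G)"
  shows "labelling_prob (unit_flag Type_A) * density (unlabel (unit_flag Type_A)) (abs_flag G) = 1 / 2"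
proof -
  have "tournament (verts G) (arcs G)" using G by (simp add: is_preflag_def)
  then have c: "real (2 * card (arcs G)) = real (card (verts G) * (card (verts G) - 1))"
    by (simp only: card_arcs)
  have "(\<Sum>(u, v)\<in>arcs G. density (unit_flag Type_A) (abs_flag (rooted_at G u v))) = real (card (arcs G))"
    by (simp add: case_prod_unfold density_unit_flag abs_flag_in_flags is_preflag_rooted_at[OF G] cong: sum.cong)
  then have "labelling_prob (unit_flag Type_A) * density (unlabel (unit_flag Type_A)) (abs_flag G) =
      real (card (arcs G)) / real (2 * card (arcs G))"
    using labelling_prob_density[OF G unit_flag_in_flags] m unfolding c by (simp add: flag_size_unit)
  moreover have "card (arcs G) > 0"
  proof -
    have "real (card (verts G) * (card (verts G) - 1)) > 0" using m by simp
    then show ?thesis unfolding c[symmetric] by simp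
  qed
  ultimately show ?thesis by simp
qed

lemma labelling_prob_Tr3A:
  assumes G: "is_preflag Type_0 G" and m: "3 \<le> card (verts G)"
  shows "labelling_prob Tr3A * density (unlabel Tr3A) (abs_flag G) =
    triangles (arcs G) / (real (card (verts G)) * (real (card (verts G)) - 1) * (real (card (verts G)) - 2))"
proof -
  let ?m = "card (verts G)"
  have "density Tr3A (abs_flag (rooted_at G u v)) = real (card (midverts (arcs G) u v)) / (real ?m - 2)"
    if "(u, v) \<in> arcs G" for u v
    using density_Tr3A[OF is_preflag_rooted_at[OF G that], of u v] m by (simp add: of_nat_diff)
  then have "(\<Sum>(u, v)\<in>arcs G. density Tr3A (abs_flag (rooted_at G u v))) =
      (\<Sum>(u, v)\<in>arcs G. real (card (midverts (arcs G) u v)) / (real ?m - 2))"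
    by (intro sum.cong refl) auto
  also have "\<dots> = triangles (arcs G) / (real ?m - 2)"
    by (simp add: triangles_def sum_divide_distrib case_prod_unfold)
  finally have s: "(\<Sum>(u, v)\<in>arcs G. density Tr3A (abs_flag (rooted_at G u v))) =
    triangles (arcs G) / (real ?m - 2)" .
  have "real (?m * (?m - 1)) = real ?m * (real ?m - 1)" using m by (simp add: of_nat_diff)
  then show ?thesis
    using labelling_prob_density[OF G Tr3A_in_flags] m unfolding flag_size_Tr3A s
    by (simp add: mult.commute)
qed

text \<open>
  The left-hand side is the downward operator applied to the square of \<open>Tr3A\<close>, expanded on
  four vertices. At each arc, the product chain rule turns it back into a density of pairs.
\<close>

lemma labelling_prob_Tr3A_square:
  assumes G: "is_preflag Type_0 G" and m: "4 \<le> card (verts G)"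
  shows "(\<Sum>H\<in>flags_of_size Type_A 4. density2 Tr3A Tr3A H *
      (labelling_prob H * density (unlabel H) (abs_flag G))) =
    triangle_pairs (arcs G) / (real (card (verts G)) * (real (card (verts G)) - 1) *
      (real (card (verts G)) - 2) * (real (card (verts G)) - 3))"
proof -
  let ?m = "card (verts G)"
  have c: "real (?m * (?m - 1)) = real ?m * (real ?m - 1)"
    "real ((?m - 2) * (?m - 3)) = (real ?m - 2) * (real ?m - 3)" using m by (simp_all add: of_nat_diff)
  have "(\<Sum>H\<in>flags_of_size Type_A 4. density2 Tr3A Tr3A H *
      (labelling_prob H * density (unlabel H) (abs_flag G))) =
     (\<Sum>H\<in>flags_of_size Type_A 4. density2 Tr3A Tr3A H *
       ((\<Sum>p\<in>arcs G. 1 * density H (abs_flag (rooted_at G (fst p) (snd p)))) / real (?m * (?m - 1))))"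
    by (intro sum.cong refl)
       (use labelling_prob_density[OF G] m in \<open>simp add: flags_of_size_def case_prod_unfold\<close>)
  also have "\<dots> = (\<Sum>p\<in>arcs G. 1 * (\<Sum>H\<in>flags_of_size Type_A 4. density2 Tr3A Tr3A H *
       density H (abs_flag (rooted_at G (fst p) (snd p))))) / real (?m * (?m - 1))"
    by (rule sum_average_swap)
  also have "(\<Sum>p\<in>arcs G. 1 * (\<Sum>H\<in>flags_of_size Type_A 4. density2 Tr3A Tr3A H *
       density H (abs_flag (rooted_at G (fst p) (snd p))))) =
     (\<Sum>(u, v)\<in>arcs G. real (card (midverts (arcs G) u v)) * (real (card (midverts (arcs G) u v)) - 1) /
        real ((?m - 2) * (?m - 3)))"
  proof (rule sum.cong[OF refl])
    fix p assume p: "p \<in> arcs G"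
    obtain u v where uv: "p = (u, v)" by (cases p)
    have Q: "is_preflag Type_A (rooted_at G u v)" using p uv is_preflag_rooted_at[OF G] by simp
    have "(\<Sum>H\<in>flags_of_size Type_A 4. density2 Tr3A Tr3A H * density H (abs_flag (rooted_at G u v))) =
        density2 Tr3A Tr3A (abs_flag (rooted_at G u v))"
      using chain_rule_product[OF Q Tr3A_in_flags Tr3A_in_flags, of 4] m by (simp add: flag_size_Tr3A)
    also have "\<dots> = real (card (midverts (arcs G) u v)) * (real (card (midverts (arcs G) u v)) - 1) /
        real ((?m - 2) * (?m - 3))"
      using density2_Tr3A[OF Q, of u v] m by (simp del: of_nat_mult)
    finally show "1 * (\<Sum>H\<in>flags_of_size Type_A 4. density2 Tr3A Tr3A H *
        density H (abs_flag (rooted_at G (fst p) (snd p)))) =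
      (case p of (u, v) \<Rightarrow> real (card (midverts (arcs G) u v)) * (real (card (midverts (arcs G) u v)) - 1) /
        real ((?m - 2) * (?m - 3)))"
      by (simp add: uv)
  qed
  also have "\<dots> = triangle_pairs (arcs G) / real ((?m - 2) * (?m - 3))"
    by (simp add: triangle_pairs_def sum_divide_distrib case_prod_unfold del: of_nat_mult)
  finally show ?thesis unfolding c by (simp add: mult_ac)
qed

section \<open>The random extension\<close>

lemma Hom_plus_eval_measurable:
  assumes F: "F \<in> flags \<sigma>"
  shows "(\<lambda>x. x F) \<in> borel_measurable (Hom_plus_borel \<sigma>)"
proof (rule borel_measurableI)
  fix S :: "real set" assume S: "open S"
  let ?T = "product_topology (\<lambda>_. top_of_set {0..1 :: real}) (flags \<sigma>)"
  have sp: "space (Hom_plus_borel \<sigma>) = Hom_plus \<sigma>"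
    by (simp add: Hom_plus_borel_def space_measure_of_conv)
  have sub: "{U. openin (Hom_plus_topology \<sigma>) U} \<subseteq> Pow (Hom_plus \<sigma>)"
    unfolding Hom_plus_topology_def using openin_subset by fastforce
  have Hom: "Hom_plus \<sigma> \<subseteq> topspace ?T"
  proof
    fix x assume x: "x \<in> Hom_plus \<sigma>"
    have "x \<in> extensional (flags \<sigma>)" using x by (elim Hom_plusE)
    then show "x \<in> topspace ?T"
      using Hom_plus_nonneg[OF x] Hom_plus_le_1[OF x] by (auto simp: PiE_def)
  qed
  have "openin ?T {x \<in> topspace ?T. x F \<in> {0..1} \<inter> S}"
    by (rule openin_continuous_map_preimage[OF continuous_map_product_projection[OF F]])
       (use S in \<open>auto simp: openin_open\<close>)
  then have "openin (Hom_plus_topology \<sigma>) ({x \<in> topspace ?T. x F \<in> {0..1} \<inter> S} \<inter> Hom_plus \<sigma>)"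
    unfolding Hom_plus_topology_def openin_subtopology by blast
  moreover have "{x \<in> topspace ?T. x F \<in> {0..1} \<inter> S} \<inter> Hom_plus \<sigma> = (\<lambda>x. x F) -` S \<inter> Hom_plus \<sigma>"
    using Hom Hom_plus_nonneg[OF _ F] Hom_plus_le_1[OF _ F] by fastforce
  ultimately have "(\<lambda>x. x F) -` S \<inter> Hom_plus \<sigma> \<in> {U. openin (Hom_plus_topology \<sigma>) U}" by simp
  then show "(\<lambda>x. x F) -` S \<inter> space (Hom_plus_borel \<sigma>) \<in> sets (Hom_plus_borel \<sigma>)"
    unfolding sp unfolding Hom_plus_borel_def sets_measure_of[OF sub] by (rule sigma_sets.Basic)
qed

text \<open>
  A random variable is almost surely \<open>1/4\<close> if and only if its mean is \<open>1/4\<close> and its second moment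
  is \<open>1/16\<close>, since then its variance vanishes. The square of \<open>\<xi> \<omega> Tr3A\<close> is a linear combination
  of values of \<open>\<xi> \<omega>\<close> on flags, so that \<open>\<phi>\<close> determines both moments.
\<close>

lemma random_extension_AE_iff:
  assumes \<phi>: "\<phi> \<in> Hom_plus Type_0" and ext: "random_extension \<phi> M \<xi>" and m: "4 \<le> m"
  shows "(AE \<omega> in M. \<xi> \<omega> Tr3A = 1 / 4) \<longleftrightarrow>
    (\<Sum>G\<in>flags_of_size Type_0 m. \<phi> G * triangles (arcs (rep_flag G))) =
      real m * (real m - 1) * (real m - 2) / 8 \<and>
    (\<Sum>G\<in>flags_of_size Type_0 m. \<phi> G * triangle_pairs (arcs (rep_flag G))) =
      real m * (real m - 1) * (real m - 2) * (real m - 3) / 32"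
proof -
  interpret prob_space M using ext by (simp add: random_extension_def)
  let ?m = "flags_of_size Type_0 m" and ?X = "\<lambda>\<omega>. \<xi> \<omega> Tr3A"
  let ?c3 = "real m * (real m - 1) * (real m - 2)"
  let ?c4 = "real m * (real m - 1) * (real m - 2) * (real m - 3)"
  have \<xi>: "\<xi> \<in> measurable M (Hom_plus_borel Type_A)" using ext by (simp add: random_extension_def)
  have E: "expectation (\<lambda>\<omega>. \<xi> \<omega> F) =
      hom_eval \<phi> (downward F) / hom_eval \<phi> (downward (unit_flag Type_A))" if "F \<in> flags Type_A" for F
    using ext that by (simp add: random_extension_def)
  have \<xi>H: "\<xi> \<omega> \<in> Hom_plus Type_A" if "\<omega> \<in> space M" for \<omega>
    using measurable_space[OF \<xi> that] by (simp add: Hom_plus_borel_def space_measure_of_conv)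
  have int: "integrable M (\<lambda>\<omega>. \<xi> \<omega> F)" if F: "F \<in> flags Type_A" for F
  proof (rule integrable_const_bound[where B = 1])
    show "(\<lambda>\<omega>. \<xi> \<omega> F) \<in> borel_measurable M"
      using measurable_compose[OF \<xi> Hom_plus_eval_measurable[OF F]] .
    show "AE \<omega> in M. norm (\<xi> \<omega> F) \<le> 1"
      using Hom_plus_nonneg[OF \<xi>H F] Hom_plus_le_1[OF \<xi>H F] by (intro AE_I2) simp
  qed
  have G: "is_preflag Type_0 (rep_flag G)" "card (verts (rep_flag G)) = m" "abs_flag (rep_flag G) = G"
    if "G \<in> ?m" for G
    using that by (auto simp: flags_of_size_def flags_def flag_size_def abs_rep_flag)
  have "hom_eval \<phi> (downward (unit_flag Type_A)) = (\<Sum>G\<in>?m. \<phi> G * (1 / 2))"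
    unfolding hom_eval_downward[OF \<phi> unit_flag_in_flags, of m, unfolded flag_size_unit, simplified, OF order_trans[OF _ m], simplified]
    using labelling_prob_unit[OF G(1)] G m by (intro sum.cong refl) force
  then have unit: "hom_eval \<phi> (downward (unit_flag Type_A)) = 1 / 2"
    using Hom_plus_sum[OF \<phi>, of m] by (simp add: sum_divide_distrib[symmetric])
  have EX: "expectation (\<lambda>\<omega>. \<xi> \<omega> F) = 2 * (\<Sum>G\<in>?m. \<phi> G * (labelling_prob F * density (unlabel F) G))"
    if "F \<in> flags Type_A" "flag_size F \<le> m" for F
    using E[OF that(1)] hom_eval_downward[OF \<phi> that] by (simp add: unit)
  have "(\<Sum>G\<in>?m. \<phi> G * (labelling_prob Tr3A * density (unlabel Tr3A) G)) =
      (\<Sum>G\<in>?m. \<phi> G * (triangles (arcs (rep_flag G)) / ?c3))"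
  proof (rule sum.cong[OF refl])
    fix H assume H: "H \<in> ?m"
    show "\<phi> H * (labelling_prob Tr3A * density (unlabel Tr3A) H) =
        \<phi> H * (triangles (arcs (rep_flag H)) / ?c3)"
      using labelling_prob_Tr3A[OF G(1)[OF H]] m by (simp add: G(2,3)[OF H])
  qed
  then have EX1: "expectation ?X = 2 * (\<Sum>G\<in>?m. \<phi> G * triangles (arcs (rep_flag G))) / ?c3"
    using EX[OF Tr3A_in_flags] m by (simp add: flag_size_Tr3A sum_divide_distrib[symmetric])
  have sq: "(?X \<omega>)\<^sup>2 = (\<Sum>H\<in>flags_of_size Type_A 4. density2 Tr3A Tr3A H * \<xi> \<omega> H)"
    if "\<omega> \<in> space M" for \<omega>
    using Hom_plus_mult[OF \<xi>H[OF that] Tr3A_in_flags Tr3A_in_flags]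
    by (simp add: flag_size_Tr3A power2_eq_square)
  have intS: "integrable M (\<lambda>\<omega>. \<Sum>H\<in>flags_of_size Type_A 4. density2 Tr3A Tr3A H * \<xi> \<omega> H)"
    by (intro Bochner_Integration.integrable_sum integrable_mult_right int) (simp add: flags_of_size_def)
  then have int2: "integrable M (\<lambda>\<omega>. (?X \<omega>)\<^sup>2)"
    by (subst Bochner_Integration.integrable_cong[OF refl sq]) auto
  have "expectation (\<lambda>\<omega>. (?X \<omega>)\<^sup>2) =
      expectation (\<lambda>\<omega>. \<Sum>H\<in>flags_of_size Type_A 4. density2 Tr3A Tr3A H * \<xi> \<omega> H)"
    by (rule Bochner_Integration.integral_cong[OF refl sq])
  also have "\<dots> = (\<Sum>H\<in>flags_of_size Type_A 4. density2 Tr3A Tr3A H * expectation (\<lambda>\<omega>. \<xi> \<omega> H))"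
    by (subst Bochner_Integration.integral_sum)
       (auto intro!: integrable_mult_right int simp: flags_of_size_def)
  also have "\<dots> = (\<Sum>H\<in>flags_of_size Type_A 4. density2 Tr3A Tr3A H *
      (2 * (\<Sum>G\<in>?m. \<phi> G * (labelling_prob H * density (unlabel H) G))))"
    using EX m by (intro sum.cong refl) (simp add: flags_of_size_def)
  also have "\<dots> = 2 * (\<Sum>G\<in>?m. \<phi> G * (\<Sum>H\<in>flags_of_size Type_A 4. density2 Tr3A Tr3A H *
      (labelling_prob H * density (unlabel H) G)))"
    unfolding sum_distrib_left by (subst sum.swap) (simp add: mult_ac)
  also have "(\<Sum>G\<in>?m. \<phi> G * (\<Sum>H\<in>flags_of_size Type_A 4. density2 Tr3A Tr3A H *
      (labelling_prob H * density (unlabel H) G))) =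
      (\<Sum>G\<in>?m. \<phi> G * (triangle_pairs (arcs (rep_flag G)) / ?c4))"
  proof (rule sum.cong[OF refl])
    fix H assume H: "H \<in> ?m"
    show "\<phi> H * (\<Sum>K\<in>flags_of_size Type_A 4. density2 Tr3A Tr3A K *
      (labelling_prob K * density (unlabel K) H)) =
        \<phi> H * (triangle_pairs (arcs (rep_flag H)) / ?c4)"
      using labelling_prob_Tr3A_square[OF G(1)[OF H]] m by (simp add: G(2,3)[OF H])
  qed
  finally have EX2: "expectation (\<lambda>\<omega>. (?X \<omega>)\<^sup>2) =
      2 * (\<Sum>G\<in>?m. \<phi> G * triangle_pairs (arcs (rep_flag G))) / ?c4"
    by (simp add: sum_divide_distrib[symmetric])
  have AE_iff: "(AE \<omega> in M. ?X \<omega> = 1 / 4) \<longleftrightarrow>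
      expectation ?X = 1 / 4 \<and> expectation (\<lambda>\<omega>. (?X \<omega>)\<^sup>2) = 1 / 16"
  proof
    assume ae: "AE \<omega> in M. ?X \<omega> = 1 / 4"
    have "expectation ?X = expectation (\<lambda>_. 1 / 4)"
      using ae int[OF Tr3A_in_flags] by (intro integral_cong_AE) auto
    moreover have "expectation (\<lambda>\<omega>. (?X \<omega>)\<^sup>2) = expectation (\<lambda>_. 1 / 16)"
    proof (rule integral_cong_AE)
      show "AE \<omega> in M. (?X \<omega>)\<^sup>2 = 1 / 16"
        using ae
      proof eventually_elim
        case (elim \<omega>)
        show ?case unfolding elim by (simp add: power_divide)
      qed
    qed (use int2 in auto)
    ultimately show "expectation ?X = 1 / 4 \<and> expectation (\<lambda>\<omega>. (?X \<omega>)\<^sup>2) = 1 / 16"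
      by (simp add: prob_space)
  next
    assume E12: "expectation ?X = 1 / 4 \<and> expectation (\<lambda>\<omega>. (?X \<omega>)\<^sup>2) = 1 / 16"
    have exp: "(?X \<omega> - 1 / 4)\<^sup>2 = (?X \<omega>)\<^sup>2 - 1 / 2 * ?X \<omega> + 1 / 16" for \<omega>
      by (simp add: power2_eq_square algebra_simps)
    have i: "integrable M (\<lambda>\<omega>. (?X \<omega> - 1 / 4)\<^sup>2)"
      unfolding exp using int2 int[OF Tr3A_in_flags] by simp
    have "expectation (\<lambda>\<omega>. (?X \<omega> - 1 / 4)\<^sup>2) = 0"
      unfolding exp using int2 int[OF Tr3A_in_flags] E12 by (simp add: prob_space)
    then have "AE \<omega> in M. (?X \<omega> - 1 / 4)\<^sup>2 = 0"
      using integral_nonneg_eq_0_iff_AE[OF i] by simp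
    then show "AE \<omega> in M. ?X \<omega> = 1 / 4" by simp
  qed
  have c: "?c3 > 0" "?c4 > 0" using m by simp_all
  have q: "2 * s / c = 1 / 4 \<longleftrightarrow> s = c / 8" "2 * s / c = 1 / 16 \<longleftrightarrow> s = c / 32"
    if "c > 0" for s c :: real
    using that by (auto simp: field_simps)
  show ?thesis unfolding AE_iff EX1 EX2 q(1)[OF c(1)] q(2)[OF c(2)] ..
qed

section \<open>The sign kernel of a tournament\<close>

text \<open>
  The sign kernel is an antisymmetric matrix with entries \<open>1\<close> and \<open>-1\<close> off the diagonal and \<open>0\<close> on it.
  A score is a row sum, out-degree minus in-degree. The square of the matrix is symmetric, so the
  deviation, which is the sum of the squared entries of the square, is the trace of the fourth power.
\<close>

definition arc_sign :: "('a \<times> 'a) set \<Rightarrow> 'a \<Rightarrow> 'a \<Rightarrow> real" where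
  "arc_sign E u v = of_bool ((u, v) \<in> E) - of_bool ((v, u) \<in> E)"

definition score :: "'a set \<Rightarrow> ('a \<times> 'a) set \<Rightarrow> 'a \<Rightarrow> real" where
  "score V E u = (\<Sum>w\<in>V. arc_sign E u w)"

definition sign_square :: "'a set \<Rightarrow> ('a \<times> 'a) set \<Rightarrow> 'a \<Rightarrow> 'a \<Rightarrow> real" where
  "sign_square V E u v = (\<Sum>w\<in>V. arc_sign E u w * arc_sign E w v)"

definition deviation :: "'a set \<Rightarrow> ('a \<times> 'a) set \<Rightarrow> real" where
  "deviation V E = (\<Sum>u\<in>V. \<Sum>v\<in>V. (sign_square V E u v)\<^sup>2)"

lemma arc_sign_antisym: "arc_sign E v u = - arc_sign E u v"
  by (simp add: arc_sign_def)

lemma sign_square_sym: "sign_square V E v u = sign_square V E u v"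
  unfolding sign_square_def
proof (rule sum.cong[OF refl])
  fix w
  show "arc_sign E v w * arc_sign E w u = arc_sign E u w * arc_sign E w v"
    using arc_sign_antisym[of E v w] arc_sign_antisym[of E u w] by simp
qed

lemma sum_arc_sign_in: "(\<Sum>w\<in>V. arc_sign E w v) = - score V E v"
  unfolding score_def sum_negf[symmetric] by (intro sum.cong refl arc_sign_antisym)

lemma deviation_nonneg: "0 \<le> deviation V E"
  by (simp add: deviation_def sum_nonneg)

context
  fixes V :: "'a set" and E
  assumes T: "tournament V E"
begin

lemma finite_tournament: "finite V" "finite E"
  using tournamentD(1,2)[OF T] finite_subset[of E "V \<times> V"] by auto

lemma arc_sign_arc:
  assumes "(u, v) \<in> E"
  shows "arc_sign E u v = 1"
proof -
  have "u \<in> V" "v \<in> V" using assms tournamentD(2)[OF T] by auto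
  moreover have "u \<noteq> v" using assms tournamentD(3)[OF T] by auto
  ultimately show ?thesis using assms tournamentD(4)[OF T, of u v] by (simp add: arc_sign_def)
qed

lemma arc_sign_eq:
  assumes "u \<in> V" "v \<in> V" "u \<noteq> v"
  shows "arc_sign E u v = 2 * of_bool ((u, v) \<in> E) - 1"
  using tournamentD(4)[OF T assms] by (simp add: arc_sign_def)

lemma arc_sign_square:
  assumes "u \<in> V" "v \<in> V"
  shows "arc_sign E u v * arc_sign E u v = of_bool (u \<noteq> v)"
  using arc_sign_eq[OF assms] by (cases "u = v") (auto simp: arc_sign_def)

text \<open>Every ordered pair of vertices is an arc, a reversed arc, or on the diagonal.\<close>

lemma sum_pairs_arcs:
  fixes g :: "'a \<Rightarrow> 'a \<Rightarrow> real"
  shows "(\<Sum>u\<in>V. \<Sum>v\<in>V. g u v) = (\<Sum>(u, v)\<in>E. g u v + g v u) + (\<Sum>u\<in>V. g u u)"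
proof -
  note E = tournamentD(2)[OF T] and fin = finite_tournament
  have split: "g u v = (if (u, v) \<in> E then g u v else 0) + (if (v, u) \<in> E then g u v else 0) +
      (if u = v then g u v else 0)" if "u \<in> V" "v \<in> V" for u v
    using tournamentD(3)[OF T, of u] tournamentD(4)[OF T that] by (cases "u = v") auto
  have arcs: "(\<Sum>u\<in>V. \<Sum>v\<in>V. if (u, v) \<in> E then h u v else 0) = (\<Sum>(u, v)\<in>E. h u v)" for h :: "'a \<Rightarrow> 'a \<Rightarrow> real"
  proof -
    have "(\<Sum>u\<in>V. \<Sum>v\<in>V. if (u, v) \<in> E then h u v else 0) =
        (\<Sum>p\<in>V \<times> V. if p \<in> E then h (fst p) (snd p) else 0)"
      by (simp add: sum.cartesian_product case_prod_unfold)
    also have "\<dots> = (\<Sum>p\<in>(V \<times> V) \<inter> E. h (fst p) (snd p))"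
      using fin by (simp add: sum.inter_restrict)
    also have "(V \<times> V) \<inter> E = E" using E by blast
    finally show ?thesis by (simp add: case_prod_unfold)
  qed
  have "(\<Sum>u\<in>V. \<Sum>v\<in>V. g u v) = (\<Sum>u\<in>V. \<Sum>v\<in>V. (if (u, v) \<in> E then g u v else 0) +
      (if (v, u) \<in> E then g u v else 0) + (if u = v then g u v else 0))"
    by (intro sum.cong refl split)
  also have "\<dots> = (\<Sum>u\<in>V. \<Sum>v\<in>V. if (u, v) \<in> E then g u v else 0) +
      (\<Sum>u\<in>V. \<Sum>v\<in>V. if (v, u) \<in> E then g u v else 0) +
      (\<Sum>u\<in>V. \<Sum>v\<in>V. if u = v then g u v else 0)"
    by (simp only: sum.distrib)
  also have "(\<Sum>u\<in>V. \<Sum>v\<in>V. if (v, u) \<in> E then g u v else 0) =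
      (\<Sum>v\<in>V. \<Sum>u\<in>V. if (v, u) \<in> E then g u v else 0)"
    by (rule sum.swap)
  also have "(\<Sum>u\<in>V. \<Sum>v\<in>V. if u = v then g u v else 0) = (\<Sum>u\<in>V. g u u)"
    using fin by simp
  finally show ?thesis
    unfolding arcs[of g] arcs[of "\<lambda>v u. g u v"] by (simp add: sum.distrib case_prod_unfold)
qed

lemma real_card_arcs: "real (card E) = real (card V) * (real (card V) - 1) / 2"
proof -
  have "real (2 * card E) = real (card V * (card V - 1))"
    using card_arcs[OF T] by (simp only:)
  then show ?thesis by (cases "card V") (simp_all add: algebra_simps)
qed

lemma sign_square_diag: "u \<in> V \<Longrightarrow> sign_square V E u u = - (real (card V) - 1)"
proof -
  assume u: "u \<in> V"
  have "sign_square V E u u = (\<Sum>w\<in>V. - of_bool (u \<noteq> w))"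
    unfolding sign_square_def
  proof (rule sum.cong[OF refl])
    fix w assume "w \<in> V"
    then show "arc_sign E u w * arc_sign E w u = - of_bool (u \<noteq> w)"
      using arc_sign_square[OF u] arc_sign_antisym[of E w u] by simp
  qed
  also have "\<dots> = - real (card (V - {u}))"
    using finite_tournament by (simp add: sum_negf of_bool_def sum.If_cases Diff_eq Collect_neg_eq[symmetric] Int_def)
      (rule arg_cong[where f = card], auto)
  finally show ?thesis using u finite_tournament card_gt_0_iff[of V] by (auto simp: of_nat_diff)
qed

text \<open>
  Expand the sum over \<open>w\<close> of \<open>(1 + f(u, w)) (1 + f(w, v))\<close>: the vertices between \<open>u\<close> and \<open>v\<close>
  contribute \<open>4\<close> each, \<open>u\<close> and \<open>v\<close> themselves contribute \<open>2\<close> each, and all others \<open>0\<close>.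
\<close>

lemma card_midverts_arc:
  assumes uv: "(u, v) \<in> E"
  shows "4 * real (card (midverts E u v)) =
    real (card V) - 4 + score V E u - score V E v + sign_square V E u v"
proof -
  note irr = tournamentD(3)[OF T] and tot = tournamentD(4)[OF T]
  have V: "u \<in> V" "v \<in> V" and ne: "u \<noteq> v"
    using uv tournamentD(2)[OF T] irr by auto
  have vu: "(v, u) \<notin> E" using tot[OF V ne] uv by simp
  have *: "(1 + arc_sign E u w) * (1 + arc_sign E w v) =
      4 * of_bool (w \<in> midverts E u v) + 2 * of_bool (w = u) + 2 * of_bool (w = v)" if w: "w \<in> V" for w
  proof (cases "w = u \<or> w = v")
    case True
    then show ?thesis
      using uv vu ne irr by (auto simp: arc_sign_def midverts_def)
  next
    case False
    then show ?thesis
      using tot[OF V(1) w] tot[OF w V(2)] by (auto simp: arc_sign_def midverts_def)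
  qed
  have sub: "midverts E u v \<subseteq> V" using tournamentD(2)[OF T] by (auto simp: midverts_def)
  have "(\<Sum>w\<in>V. (1 + arc_sign E u w) * (1 + arc_sign E w v)) =
      (\<Sum>w\<in>V. 4 * of_bool (w \<in> midverts E u v) + 2 * of_bool (w = u) + 2 * of_bool (w = v))"
    by (intro sum.cong refl *)
  also have "\<dots> = 4 * (\<Sum>w\<in>V. of_bool (w \<in> midverts E u v)) + 4"
    using V finite_tournament by (simp add: sum.distrib sum_distrib_left[symmetric] of_bool_def)
  also have "(\<Sum>w\<in>V. of_bool (w \<in> midverts E u v)) = real (card (midverts E u v))"
    using card_eq_sum_of_bool[OF finite_tournament(1), of "\<lambda>w. w \<in> midverts E u v"] sub
    by (simp add: Int_absorb1 Collect_conj_eq)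
  finally have "4 * real (card (midverts E u v)) + 4 =
      (\<Sum>w\<in>V. 1 + arc_sign E u w + arc_sign E w v + arc_sign E u w * arc_sign E w v)"
    by (simp add: algebra_simps)
  also have "\<dots> = real (card V) + score V E u + (\<Sum>w\<in>V. arc_sign E w v) + sign_square V E u v"
    by (simp add: sum.distrib score_def sign_square_def)
  finally show ?thesis by (simp add: sum_arc_sign_in)
qed

lemma sum_arcs_score_diff: "(\<Sum>(u, v)\<in>E. score V E u - score V E v) = (\<Sum>u\<in>V. (score V E u)\<^sup>2)"
proof -
  have "(\<Sum>u\<in>V. (score V E u)\<^sup>2) = (\<Sum>u\<in>V. \<Sum>v\<in>V. arc_sign E u v * score V E u)"
    by (simp add: score_def power2_eq_square sum_distrib_right)
  also have "\<dots> = (\<Sum>(u, v)\<in>E. arc_sign E u v * score V E u + arc_sign E v u * score V E v)"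
    unfolding sum_pairs_arcs by (simp add: arc_sign_def)
  also have "\<dots> = (\<Sum>(u, v)\<in>E. score V E u - score V E v)"
  proof (rule sum.cong[OF refl], clarify)
    fix u v assume "(u, v) \<in> E"
    then show "arc_sign E u v * score V E u + arc_sign E v u * score V E v = score V E u - score V E v"
      by (simp add: arc_sign_antisym[of E v u] arc_sign_arc)
  qed
  finally show ?thesis by simp
qed

lemma sum_arcs_sign_square:
  "2 * (\<Sum>(u, v)\<in>E. sign_square V E u v) =
    real (card V) * (real (card V) - 1) - (\<Sum>u\<in>V. (score V E u)\<^sup>2)"
proof -
  have "(\<Sum>u\<in>V. \<Sum>v\<in>V. sign_square V E u v) = (\<Sum>u\<in>V. \<Sum>w\<in>V. \<Sum>v\<in>V. arc_sign E u w * arc_sign E w v)"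
    unfolding sign_square_def by (intro sum.cong refl sum.swap)
  also have "\<dots> = (\<Sum>w\<in>V. \<Sum>u\<in>V. \<Sum>v\<in>V. arc_sign E u w * arc_sign E w v)"
    by (rule sum.swap)
  also have "\<dots> = (\<Sum>w\<in>V. (\<Sum>u\<in>V. arc_sign E u w) * score V E w)"
    by (simp add: score_def sum_product)
  also have "\<dots> = - (\<Sum>u\<in>V. (score V E u)\<^sup>2)"
    by (simp add: sum_arc_sign_in sum_negf power2_eq_square)
  finally have "- (\<Sum>u\<in>V. (score V E u)\<^sup>2) =
      (\<Sum>(u, v)\<in>E. sign_square V E u v + sign_square V E v u) + (\<Sum>u\<in>V. sign_square V E u u)"
    unfolding sum_pairs_arcs by simp
  also have "\<dots> = 2 * (\<Sum>(u, v)\<in>E. sign_square V E u v) - real (card V) * (real (card V) - 1)"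
    by (simp add: sign_square_sym sign_square_diag sum_distrib_left[symmetric] case_prod_unfold
        algebra_simps cong: sum.cong)
  finally show ?thesis by simp
qed

text \<open>
  Sum the identity \<open>card_midverts_arc\<close> over the arcs. The differences of scores and the entries of
  the square have opposite signs in the sum of the squared scores, but the former count twice.
\<close>

lemma triangles_eq:
  "8 * triangles E = real (card V) * (real (card V) - 1) * (real (card V) - 3) +
    (\<Sum>u\<in>V. (score V E u)\<^sup>2)"
proof -
  have "4 * triangles E = (\<Sum>p\<in>E. 4 * real (card (midverts E (fst p) (snd p))))"
    by (simp add: triangles_def sum_distrib_left case_prod_unfold)
  also have "\<dots> = (\<Sum>p\<in>E. (real (card V) - 4) + (score V E (fst p) - score V E (snd p)) +
      sign_square V E (fst p) (snd p))"
    by (intro sum.cong refl) (simp add: card_midverts_arc)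
  also have "\<dots> = real (card E) * (real (card V) - 4) + (\<Sum>(u, v)\<in>E. score V E u - score V E v) +
      (\<Sum>(u, v)\<in>E. sign_square V E u v)"
    by (simp add: sum.distrib case_prod_unfold)
  finally have "8 * triangles E = 2 * real (card E) * (real (card V) - 4) +
      2 * (\<Sum>(u, v)\<in>E. score V E u - score V E v) + 2 * (\<Sum>(u, v)\<in>E. sign_square V E u v)"
    by simp
  then show ?thesis
    unfolding real_card_arcs sum_arcs_score_diff sum_arcs_sign_square by (simp add: algebra_simps)
qed

text \<open>
  On an arc, \<open>card_midverts_arc\<close> expresses the entry of the square of the sign kernel by the number of
  vertices between its ends and by two scores. The scores are controlled by \<open>triangles_eq\<close>; by
  symmetry the arcs account for all off-diagonal entries. The bound is linear in \<open>triangles\<close> and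
  \<open>triangle_pairs\<close>, as is needed for taking expectations.
\<close>

lemma deviation_le:
  defines "m \<equiv> real (card V)"
  shows "deviation V E \<le> 64 * triangle_pairs E + (192 + 32 * m) * triangles E +
    2 * m * (m - 1) * (m - 4)\<^sup>2 - 8 * m\<^sup>2 * (m - 1) * (m - 3) + m * (m - 1)\<^sup>2"
proof -
  let ?a = "\<lambda>p. real (card (midverts E (fst p) (snd p)))"
  let ?d = "score V E" and ?c = "sign_square V E"
  define D where "D = (\<Sum>u\<in>V. (?d u)\<^sup>2)"
  have D: "D = 8 * triangles E - m * (m - 1) * (m - 3)" using triangles_eq by (simp add: D_def m_def)
  have "D \<ge> 0" by (simp add: D_def sum_nonneg)
  have c: "?c (fst p) (snd p) = (4 * ?a p - (m - 4)) - (?d (fst p) - ?d (snd p))" if "p \<in> E" for p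
    using card_midverts_arc[of "fst p" "snd p"] that by (simp add: m_def)
  have lin: "(\<Sum>p\<in>E. 2 * x p + 4 * y p) = 2 * sum x E + 4 * sum y E" for x y :: "'a \<times> 'a \<Rightarrow> real"
    by (simp add: sum.distrib sum_distrib_left)
  have sq: "(x - (y - z))\<^sup>2 \<le> 2 * x\<^sup>2 + 4 * (y\<^sup>2 + z\<^sup>2)" for x y z :: real
  proof -
    have "0 \<le> (x + (y - z))\<^sup>2 + 2 * (y + z)\<^sup>2" by simp
    then show ?thesis by (simp add: power2_eq_square algebra_simps)
  qed
  have "m * D = (\<Sum>u\<in>V. \<Sum>v\<in>V. (?d u)\<^sup>2)"
    by (simp add: D_def m_def sum_distrib_left)
  then have d: "(\<Sum>p\<in>E. (?d (fst p))\<^sup>2 + (?d (snd p))\<^sup>2) = (m - 1) * D"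
    unfolding sum_pairs_arcs by (simp add: D_def case_prod_unfold algebra_simps)
  have "(\<Sum>p\<in>E. (4 * ?a p - (m - 4))\<^sup>2) =
      (\<Sum>p\<in>E. 16 * (?a p * (?a p - 1)) + (48 - 8 * m) * ?a p + (m - 4)\<^sup>2)"
    by (intro sum.cong refl) (simp add: power2_eq_square algebra_simps)
  also have "\<dots> = 16 * triangle_pairs E + (48 - 8 * m) * triangles E + real (card E) * (m - 4)\<^sup>2"
    by (simp add: sum.distrib triangle_pairs_def triangles_def case_prod_unfold sum_distrib_left[symmetric])
  finally have a: "(\<Sum>p\<in>E. (4 * ?a p - (m - 4))\<^sup>2) =
      16 * triangle_pairs E + (48 - 8 * m) * triangles E + m * (m - 1) / 2 * (m - 4)\<^sup>2"
    by (simp add: real_card_arcs m_def)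
  have "(\<Sum>p\<in>E. (?c (fst p) (snd p))\<^sup>2) \<le>
      (\<Sum>p\<in>E. 2 * (4 * ?a p - (m - 4))\<^sup>2 + 4 * ((?d (fst p))\<^sup>2 + (?d (snd p))\<^sup>2))"
    by (intro sum_mono) (simp only: c sq)
  also have "\<dots> = 2 * (\<Sum>p\<in>E. (4 * ?a p - (m - 4))\<^sup>2) + 4 * ((m - 1) * D)"
    unfolding d[symmetric] by (rule lin)
  finally have le: "(\<Sum>p\<in>E. (?c (fst p) (snd p))\<^sup>2) \<le>
      2 * (16 * triangle_pairs E + (48 - 8 * m) * triangles E + m * (m - 1) / 2 * (m - 4)\<^sup>2) +
      4 * ((m - 1) * D)"
    unfolding a .
  have "deviation V E = 2 * (\<Sum>p\<in>E. (?c (fst p) (snd p))\<^sup>2) + m * (m - 1)\<^sup>2"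
    unfolding deviation_def sum_pairs_arcs
    by (simp add: sign_square_sym sign_square_diag m_def case_prod_unfold sum_distrib_left
        power2_commute[of 1] cong: sum.cong)
  also have "\<dots> \<le> 2 * (2 * (16 * triangle_pairs E + (48 - 8 * m) * triangles E +
      m * (m - 1) / 2 * (m - 4)\<^sup>2) + 4 * ((m - 1) * D)) + m * (m - 1)\<^sup>2"
    using le by simp
  also have "\<dots> \<le> 2 * (2 * (16 * triangle_pairs E + (48 - 8 * m) * triangles E +
      m * (m - 1) / 2 * (m - 4)\<^sup>2) + 4 * (m * D)) + m * (m - 1)\<^sup>2"
    using \<open>D \<ge> 0\<close> by (simp add: mult_right_mono)
  also have "\<dots> = 64 * triangle_pairs E + (192 + 32 * m) * triangles E +
    2 * m * (m - 1) * (m - 4)\<^sup>2 - 8 * m\<^sup>2 * (m - 1) * (m - 3) + m * (m - 1)\<^sup>2"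
    unfolding D by (simp add: power2_eq_square field_simps)
  finally show ?thesis .
qed

text \<open>
  The deviation controls the cut norm of the sign kernel. Two applications of the
  Cauchy-Schwarz inequality remove the weights \<open>g\<close> and \<open>h\<close>.
\<close>

lemma sign_bilinear_power4:
  assumes g: "\<And>u. u \<in> V \<Longrightarrow> \<bar>g u\<bar> \<le> 1" and h: "\<And>u. u \<in> V \<Longrightarrow> \<bar>h u\<bar> \<le> 1"
  shows "(\<Sum>u\<in>V. \<Sum>v\<in>V. arc_sign E u v * g u * h v) ^ 4 \<le> real (card V) ^ 4 * deviation V E"
proof -
  let ?m = "real (card V)" and ?s = "arc_sign E"
  let ?X = "\<Sum>u\<in>V. \<Sum>v\<in>V. ?s u v * g u * h v"
  define Y where "Y = (\<Sum>u\<in>V. (\<Sum>v\<in>V. ?s u v * h v)\<^sup>2)"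
  have sq1: "x\<^sup>2 \<le> 1" if "\<bar>x\<bar> \<le> 1" for x :: real using that by (simp add: abs_square_le_1)
  have bound: "(\<Sum>u\<in>V. (k u)\<^sup>2) \<le> ?m" if "\<And>u. u \<in> V \<Longrightarrow> \<bar>k u\<bar> \<le> 1" for k :: "'a \<Rightarrow> real"
  proof -
    have "(\<Sum>u\<in>V. (k u)\<^sup>2) \<le> (\<Sum>u\<in>V. 1)" by (intro sum_mono sq1 that)
    then show ?thesis by simp
  qed
  have X: "?X = (\<Sum>u\<in>V. g u * (\<Sum>v\<in>V. ?s u v * h v))"
    unfolding sum_distrib_left by (intro sum.cong refl) (simp add: mult.commute mult.left_commute)
  have "?X\<^sup>2 \<le> (\<Sum>u\<in>V. (g u)\<^sup>2) * Y"
    unfolding X Y_def by (rule Cauchy_Schwarz_ineq_sum)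
  also have "\<dots> \<le> ?m * Y"
    by (intro mult_right_mono bound g) (simp_all add: Y_def sum_nonneg)
  finally have X: "?X\<^sup>2 \<le> ?m * Y" .
  have "Y = (\<Sum>u\<in>V. \<Sum>v\<in>V. \<Sum>w\<in>V. (?s u v * h v) * (?s u w * h w))"
    unfolding Y_def power2_eq_square by (simp only: sum_product)
  also have "\<dots> = (\<Sum>v\<in>V. \<Sum>w\<in>V. \<Sum>u\<in>V. (?s u v * h v) * (?s u w * h w))"
    by (subst sum.swap) (intro sum.cong refl sum.swap)
  also have "\<dots> = (\<Sum>v\<in>V. \<Sum>w\<in>V. - sign_square V E v w * (h v * h w))"
    unfolding sign_square_def sum_negf[symmetric] sum_distrib_right
  proof (intro sum.cong refl)
    fix v w u
    show "(?s u v * h v) * (?s u w * h w) = - (?s v u * ?s u w) * (h v * h w)"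
      by (simp add: arc_sign_antisym[of E v u])
  qed
  also have "\<dots> = (\<Sum>p\<in>V \<times> V. - sign_square V E (fst p) (snd p) * (h (fst p) * h (snd p)))"
    by (simp add: sum.cartesian_product case_prod_unfold)
  finally have Y: "Y = (\<Sum>p\<in>V \<times> V. - sign_square V E (fst p) (snd p) * (h (fst p) * h (snd p)))" .
  have "Y\<^sup>2 \<le> (\<Sum>p\<in>V \<times> V. (- sign_square V E (fst p) (snd p))\<^sup>2) *
      (\<Sum>p\<in>V \<times> V. (h (fst p) * h (snd p))\<^sup>2)"
    unfolding Y by (rule Cauchy_Schwarz_ineq_sum)
  also have "(\<Sum>p\<in>V \<times> V. (- sign_square V E (fst p) (snd p))\<^sup>2) = deviation V E"
    by (simp add: deviation_def sum.cartesian_product case_prod_unfold)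
  also have "(\<Sum>p\<in>V \<times> V. (h (fst p) * h (snd p))\<^sup>2) = (\<Sum>u\<in>V. (h u)\<^sup>2) * (\<Sum>u\<in>V. (h u)\<^sup>2)"
    by (simp add: sum_product sum.cartesian_product case_prod_unfold power_mult_distrib)
  also have "deviation V E * \<dots> \<le> deviation V E * (?m * ?m)"
    by (intro mult_left_mono mult_mono bound h deviation_nonneg sum_nonneg) auto
  finally have Y: "Y\<^sup>2 \<le> deviation V E * (?m * ?m)" .
  have "?X ^ 4 = (?X\<^sup>2)\<^sup>2" by (simp add: power_mult[symmetric])
  also have "\<dots> \<le> (?m * Y)\<^sup>2" using X by (intro power_mono) simp_all
  also have "\<dots> = ?m\<^sup>2 * Y\<^sup>2" by (simp add: power_mult_distrib)
  also have "\<dots> \<le> ?m\<^sup>2 * (deviation V E * (?m * ?m))" using Y by (intro mult_left_mono) simp_all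
  also have "\<dots> = ?m ^ 4 * deviation V E" by (simp add: power2_eq_square power4_eq_xxxx)
  finally show ?thesis .
qed

end

section \<open>Embeddings into a tournament of small deviation\<close>

text \<open>
  Only the pairs in \<open>D\<close> are required to become arcs. As \<open>D\<close> grows from the empty set to the arcs of
  a tournament on \<open>W\<close>, the condition grows from injectivity to being an embedding of that tournament.
\<close>

definition embeddings :: "'b set \<Rightarrow> ('b \<times> 'b) set \<Rightarrow> 'a set \<Rightarrow> ('a \<times> 'a) set \<Rightarrow> ('b \<Rightarrow> 'a) set" where
  "embeddings W D V E = {i \<in> W \<rightarrow>\<^sub>E V. inj_on i W \<and> (\<forall>(a, b)\<in>D. (i a, i b) \<in> E)}"

lemma sum_PiE_insert:
  assumes "x \<notin> S"
  shows "(\<Sum>f\<in>Pi\<^sub>E (insert x S) T. F f) = (\<Sum>y\<in>T x. \<Sum>g\<in>Pi\<^sub>E S T. F (g(x := y)))"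
  unfolding PiE_insert_eq sum.cartesian_product
  by (subst sum.reindex[OF inj_combinator[OF assms]]) (simp add: case_prod_unfold)

text \<open>
  Requiring one more arc \<open>(a, b)\<close> halves the number of maps up to an error. If all values but
  those at \<open>a\<close> and \<open>b\<close> are fixed, then the remaining conditions are a condition on the image
  of \<open>a\<close> and one on the image of \<open>b\<close>, so that the error is a bilinear form in the sign kernel.
\<close>

lemma embeddings_insert:
  fixes V :: "'a set" and W :: "'b set"
  assumes T: "tournament V E" and W: "finite W" and D: "D \<subseteq> W \<times> W"
    and ab: "a \<in> W" "b \<in> W" "a \<noteq> b" "(a, b) \<notin> D" "(b, a) \<notin> D"
    and B: "\<And>g h. (\<And>u. u \<in> V \<Longrightarrow> \<bar>g u\<bar> \<le> 1) \<Longrightarrow> (\<And>u. u \<in> V \<Longrightarrow> \<bar>h u\<bar> \<le> 1) \<Longrightarrow>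
      \<bar>(\<Sum>u\<in>V. \<Sum>v\<in>V. arc_sign E u v * g u * h v)\<bar> \<le> B"
  shows "\<bar>2 * real (card (embeddings W (insert (a, b) D) V E)) - real (card (embeddings W D V E))\<bar> \<le>
    real (card V) ^ (card W - 2) * B"
proof -
  define R where "R = W - {a, b}"
  have WR: "W = insert a (insert b R)" "b \<notin> R" "a \<notin> insert b R" "finite R" "card R = card W - 2"
    using ab W by (auto simp: R_def card_Diff_subset)
  note finV = finite_tournament(1)[OF T]
  have fin: "finite (W \<rightarrow>\<^sub>E V)" using W finV by (intro finite_PiE) auto
  have good: "real (card (embeddings W D V E)) =
      (\<Sum>i\<in>W \<rightarrow>\<^sub>E V. of_bool (inj_on i W \<and> (\<forall>(x, y)\<in>D. (i x, i y) \<in> E)))" for D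
    unfolding embeddings_def by (rule card_eq_sum_of_bool[OF fin])
  define P where "P c i \<longleftrightarrow> inj_on i (W - {c}) \<and>
    (\<forall>(x, y)\<in>D. x \<noteq> c \<longrightarrow> y \<noteq> c \<longrightarrow> (i x, i y) \<in> E)" for c and i :: "'b \<Rightarrow> 'a"
  have P_upd: "P c (i(c := y)) \<longleftrightarrow> P c i" for c i y
  proof -
    have "inj_on (i(c := y)) (W - {c}) \<longleftrightarrow> inj_on i (W - {c})"
      by (rule inj_on_cong) auto
    then show ?thesis unfolding P_def by auto
  qed
  have "2 * of_bool (inj_on i W \<and> (\<forall>(x, y)\<in>insert (a, b) D. (i x, i y) \<in> E)) -
      of_bool (inj_on i W \<and> (\<forall>(x, y)\<in>D. (i x, i y) \<in> E)) =
      arc_sign E (i a) (i b) * of_bool (P b i) * of_bool (P a i)" if i: "i \<in> W \<rightarrow>\<^sub>E V" for i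
  proof (cases "i a = i b")
    case True
    then have "\<not> inj_on i W" using ab by (auto simp: inj_on_def)
    then show ?thesis using True by (simp add: arc_sign_def)
  next
    case False
    have "i a \<in> V" "i b \<in> V" using i ab by (auto simp: PiE_iff)
    note s = arc_sign_eq[OF T this False]
    have inj: "inj_on i W \<longleftrightarrow> inj_on i (W - {b}) \<and> inj_on i (W - {a})"
    proof (intro iffI conjI)
      assume *: "inj_on i (W - {b}) \<and> inj_on i (W - {a})"
      show "inj_on i W"
      proof (rule inj_onI)
        fix x y assume xy: "x \<in> W" "y \<in> W" "i x = i y"
        consider "x = y" | "x = a" "y = b" | "x = b" "y = a" | "x \<noteq> a" "y \<noteq> a" | "x \<noteq> b" "y \<noteq> b"
          using ab(3) by blast
        then show "x = y"
        proof cases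
          case 4
          then show ?thesis using * xy inj_onD[of i "W - {a}" x y] by simp
        next
          case 5
          then show ?thesis using * xy inj_onD[of i "W - {b}" x y] by simp
        qed (use False xy(3) in auto)
      qed
    qed (auto intro: inj_on_subset)
    have D': "(\<forall>(x, y)\<in>D. (i x, i y) \<in> E) \<longleftrightarrow>
        (\<forall>(x, y)\<in>D. x \<noteq> b \<longrightarrow> y \<noteq> b \<longrightarrow> (i x, i y) \<in> E) \<and>
        (\<forall>(x, y)\<in>D. x \<noteq> a \<longrightarrow> y \<noteq> a \<longrightarrow> (i x, i y) \<in> E)" (is "?A \<longleftrightarrow> ?B")
    proof
      assume B: ?B
      show ?A
      proof clarify
        fix x y assume xy: "(x, y) \<in> D"
        have "x \<noteq> b \<and> y \<noteq> b \<or> x \<noteq> a \<and> y \<noteq> a \<or> x = y"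
          using xy ab by auto
        moreover have "x \<noteq> b \<and> y \<noteq> b \<or> x \<noteq> a \<and> y \<noteq> a" if "x = y" using that ab by auto
        ultimately show "(i x, i y) \<in> E" using B xy by blast
      qed
    qed blast
    have "inj_on i W \<and> (\<forall>(x, y)\<in>D. (i x, i y) \<in> E) \<longleftrightarrow> P b i \<and> P a i"
      unfolding P_def inj D' by blast
    moreover have "(\<forall>(x, y)\<in>insert (a, b) D. (i x, i y) \<in> E) \<longleftrightarrow>
        (i a, i b) \<in> E \<and> (\<forall>(x, y)\<in>D. (i x, i y) \<in> E)" by simp
    ultimately show ?thesis unfolding s by (auto simp: of_bool_def)
  qed
  then have "2 * real (card (embeddings W (insert (a, b) D) V E)) - real (card (embeddings W D V E)) =
      (\<Sum>i\<in>W \<rightarrow>\<^sub>E V. arc_sign E (i a) (i b) * of_bool (P b i) * of_bool (P a i))"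
    unfolding good sum_distrib_left sum_subtractf[symmetric] by (intro sum.cong refl)
  also have "\<dots> = (\<Sum>u\<in>V. \<Sum>v\<in>V. \<Sum>r\<in>R \<rightarrow>\<^sub>E V.
      arc_sign E u v * of_bool (P b (r(b := v, a := u))) * of_bool (P a (r(b := v, a := u))))"
    unfolding WR(1) sum_PiE_insert[OF WR(3)] sum_PiE_insert[OF WR(2)] using ab by simp
  also have "\<dots> = (\<Sum>u\<in>V. \<Sum>v\<in>V. \<Sum>r\<in>R \<rightarrow>\<^sub>E V.
      arc_sign E u v * of_bool (P b (r(a := u))) * of_bool (P a (r(b := v))))"
    by (simp add: P_upd fun_upd_twist[OF ab(3)[symmetric]])
       (simp add: P_upd fun_upd_twist[OF ab(3)])
  also have "\<dots> = (\<Sum>r\<in>R \<rightarrow>\<^sub>E V. \<Sum>u\<in>V. \<Sum>v\<in>V.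
      arc_sign E u v * of_bool (P b (r(a := u))) * of_bool (P a (r(b := v))))"
    unfolding sum.swap[of _ _ "R \<rightarrow>\<^sub>E V"] by (rule refl)
  finally have eq: "2 * real (card (embeddings W (insert (a, b) D) V E)) - real (card (embeddings W D V E)) =
      (\<Sum>r\<in>R \<rightarrow>\<^sub>E V. \<Sum>u\<in>V. \<Sum>v\<in>V.
      arc_sign E u v * of_bool (P b (r(a := u))) * of_bool (P a (r(b := v))))" .
  also have "\<bar>\<dots>\<bar> \<le> (\<Sum>r\<in>R \<rightarrow>\<^sub>E V. B)"
    by (rule order_trans[OF sum_abs sum_mono]) (rule B; simp)
  also have "\<dots> = real (card V) ^ (card W - 2) * B"
    using WR(4,5) by (simp add: card_funcsetE)
  finally show ?thesis .
qed

lemma embeddings_telescope: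
  fixes V :: "'a set" and W :: "'b set"
  assumes T: "tournament V E" and A: "tournament W A" and D: "D \<subseteq> A"
    and B: "\<And>g h. (\<And>u. u \<in> V \<Longrightarrow> \<bar>g u\<bar> \<le> 1) \<Longrightarrow> (\<And>u. u \<in> V \<Longrightarrow> \<bar>h u\<bar> \<le> 1) \<Longrightarrow>
      \<bar>(\<Sum>u\<in>V. \<Sum>v\<in>V. arc_sign E u v * g u * h v)\<bar> \<le> B"
  shows "\<bar>2 ^ card D * real (card (embeddings W D V E)) - real (card (embeddings W {} V E))\<bar> \<le>
    real (card D) * 2 ^ card D * (real (card V) ^ (card W - 2) * B)"
proof -
  have "finite D" using D finite_tournament(2)[OF A] by (rule finite_subset)
  then show ?thesis using D
  proof (induction D rule: finite_induct)
    case (insert p D)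
    obtain a b where p: "p = (a, b)" by (cases p)
    define err where "err = real (card V) ^ (card W - 2) * B"
    have "0 \<le> B" using B[of "\<lambda>_. 0" "\<lambda>_. 0"] by simp
    then have err: "0 \<le> err" by (simp add: err_def)
    have pA: "(a, b) \<in> A" and DA: "D \<subseteq> A" using insert.prems p by auto
    have W: "a \<in> W" "b \<in> W" and ne: "a \<noteq> b"
      using pA tournamentD(2)[OF A] tournamentD(3)[OF A] by auto
    have "(b, a) \<notin> A" using tournamentD(4)[OF A W ne] pA by simp
    then have ba: "(b, a) \<notin> D" using DA by blast
    let ?N = "\<lambda>D. real (card (embeddings W D V E))"
    have 1: "\<bar>2 * ?N (insert p D) - ?N D\<bar> \<le> err"
      unfolding p err_def
      by (rule embeddings_insert[OF T tournamentD(1)[OF A] order_trans[OF DA tournamentD(2)[OF A]] W ne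
            insert.hyps(2)[unfolded p] ba B])
    have 2: "\<bar>2 ^ card D * ?N D - ?N {}\<bar> \<le> real (card D) * 2 ^ card D * err"
      using insert.IH[OF DA] by (simp add: err_def)
    have "\<bar>2 ^ card (insert p D) * ?N (insert p D) - ?N {}\<bar> =
        \<bar>2 ^ card D * (2 * ?N (insert p D) - ?N D) + (2 ^ card D * ?N D - ?N {})\<bar>"
      using insert.hyps by (simp add: algebra_simps)
    also have "\<dots> \<le> \<bar>2 ^ card D * (2 * ?N (insert p D) - ?N D)\<bar> + \<bar>2 ^ card D * ?N D - ?N {}\<bar>"
      by (rule abs_triangle_ineq)
    also have "\<dots> \<le> 2 ^ card D * err + real (card D) * 2 ^ card D * err"
      using 1 2 by (intro add_mono) (simp_all add: abs_mult)
    also have "\<dots> = real (Suc (card D)) * 2 ^ card D * err"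
      by (simp add: algebra_simps)
    also have "\<dots> \<le> real (Suc (card D)) * 2 ^ Suc (card D) * err"
      using err by (intro mult_right_mono mult_left_mono) auto
    finally show ?case
      unfolding err_def by (simp only: card_insert_disjoint[OF insert.hyps(1,2)])
  qed simp
qed

lemma card_embeddings_empty:
  assumes "finite W" "finite V" "card W \<le> card V"
  shows "real (card (embeddings W {} V E)) = fact (card W) * real (card V choose card W)"
proof -
  have "card (embeddings W {} V E) = (\<Prod>i = 0..<card W. card V - i)"
    using card_inj_on_subset_funcset[OF assms(1,2) subset_refl] by (simp add: embeddings_def)
  also have "real \<dots> = (\<Prod>i = 0..<card W. real (card V) - real i)"
    unfolding of_nat_prod using assms(3) by (intro prod.cong refl) (simp add: of_nat_diff)
  also have "\<dots> = fact (card W) * real (card V choose card W)"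
    by (simp add: binomial_gbinomial gbinomial_mult_fact)
  finally show ?thesis .
qed

text \<open>
  The fourth root of the deviation is traded for a bound that is linear in it, since only the
  expectation of the deviation will be known. This is \<open>y \<le> \<delta> + y ^ 4 / \<delta> ^ 3\<close> for \<open>y \<ge> 0\<close>.
\<close>

lemma sign_bilinear_le:
  fixes V :: "'a set"
  assumes T: "tournament V E" and m: "0 < card V" and \<delta>: "0 < \<delta>"
    and g: "\<And>u. u \<in> V \<Longrightarrow> \<bar>g u\<bar> \<le> 1" and h: "\<And>u. u \<in> V \<Longrightarrow> \<bar>h u\<bar> \<le> 1"
  shows "\<bar>(\<Sum>u\<in>V. \<Sum>v\<in>V. arc_sign E u v * g u * h v)\<bar> \<le>
    real (card V) ^ 2 * (\<delta> + deviation V E / (real (card V) ^ 4 * \<delta> ^ 3))"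
proof -
  define B where "B = \<bar>(\<Sum>u\<in>V. \<Sum>v\<in>V. arc_sign E u v * g u * h v)\<bar>"
  define m where "m = real (card V)"
  define y where "y = B / m ^ 2"
  have m: "m > 0" using m by (simp add: m_def)
  have "B ^ 4 \<le> m ^ 4 * deviation V E"
    using sign_bilinear_power4[OF T g h] by (simp add: B_def m_def power_even_abs)
  then have 1: "B ^ 4 / (m ^ 4 * m ^ 4) \<le> m ^ 4 * deviation V E / (m ^ 4 * m ^ 4)"
    by (rule divide_right_mono) simp
  have 2: "(m ^ 2) ^ 4 = m ^ 4 * m ^ 4" by (simp flip: power_mult power_add)
  have 3: "m ^ 4 * deviation V E / (m ^ 4 * m ^ 4) = deviation V E / m ^ 4"
    using m by (intro mult_divide_mult_cancel_left) simp
  have y4: "y ^ 4 \<le> deviation V E / m ^ 4"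
    using 1 unfolding y_def power_divide 2 3 .
  have y0: "0 \<le> y" by (simp add: y_def B_def)
  have "y \<le> \<delta> + y ^ 4 / \<delta> ^ 3"
  proof (cases "y \<le> \<delta>")
    case True
    have "0 \<le> y ^ 4 / \<delta> ^ 3" using \<delta> by simp
    then show ?thesis using True by linarith
  next
    case False
    then have "\<delta> ^ 3 \<le> y ^ 3" using \<delta> by (intro power_mono) auto
    then have "y * \<delta> ^ 3 \<le> y * y ^ 3" using y0 by (rule mult_left_mono)
    then have "y \<le> y ^ 4 / \<delta> ^ 3" using \<delta> by (simp add: le_divide_eq power4_eq_xxxx power3_eq_cube mult.assoc)
    then show ?thesis using \<delta> by linarith
  qed
  also have "y ^ 4 / \<delta> ^ 3 \<le> deviation V E / m ^ 4 / \<delta> ^ 3"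
    using y4 \<delta> by (intro divide_right_mono) auto
  finally have "y \<le> \<delta> + deviation V E / (m ^ 4 * \<delta> ^ 3)" by simp
  then have "B \<le> (\<delta> + deviation V E / (m ^ 4 * \<delta> ^ 3)) * m ^ 2"
    unfolding y_def using m by (simp only: pos_divide_le_eq zero_less_power)
  then show ?thesis by (simp only: B_def m_def mult.commute)
qed

section \<open>Isomorphisms and automorphisms\<close>

text \<open>
  Composition with a fixed isomorphism identifies the automorphisms of \<open>G\<close> with the isomorphisms
  to \<open>H\<close>. Outside the vertex set the former are the identity and the latter \<open>undefined\<close>.
\<close>

lemma card_isomorphisms:
  assumes G: "is_preflag \<sigma> G" and H: "is_preflag \<sigma> H" and eq: "abs_flag G = abs_flag H"
  shows "card {i \<in> verts G \<rightarrow>\<^sub>E verts H. iso_map i G H} = card (automorphisms G)"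
proof -
  obtain g where g: "iso_map g G H"
    using eq abs_flag_eq_iff[OF G H] unfolding flag_iso_def by blast
  let ?h = "inv_into (verts G) g"
  have h: "iso_map ?h H G" by (rule iso_map_inv[OF g G])
  have b: "bij_betw g (verts G) (verts H)" using g by (simp add: iso_map_def)
  have hg: "?h (g x) = x" if "x \<in> verts G" for x using b that by (simp add: bij_betw_def)
  have gh: "g (?h y) = y" if "y \<in> verts H" for y using b that by (auto simp: bij_betw_def f_inv_into_f)
  have hG: "?h y \<in> verts G" if "y \<in> verts H" for y using b that by (auto simp: bij_betw_def inv_into_into)
  have gH: "g x \<in> verts H" if "x \<in> verts G" for x using b that by (auto simp: bij_betw_def)
  have lab: "set (labels G) \<subseteq> verts G" by (rule labels_subset[OF G])
  have comp: "iso_map (k \<circ> f) A C" if "iso_map f A B" "iso_map k B C" for f k A B C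
    using that unfolding iso_map_def by (auto intro: bij_betw_trans dest: bij_betwE)
  have cong: "iso_map f A B \<longleftrightarrow> iso_map f' A B"
    if "\<And>x. x \<in> verts A \<Longrightarrow> f x = f' x" "set (labels A) \<subseteq> verts A" for f f' A B
  proof -
    have map: "map f (labels A) = map f' (labels A)" using that by (intro map_cong) auto
    have bij: "bij_betw f (verts A) (verts B) \<longleftrightarrow> bij_betw f' (verts A) (verts B)"
      using that(1) by (rule bij_betw_cong)
    show ?thesis unfolding iso_map_def map bij using that(1) by simp
  qed
  have "bij_betw (\<lambda>f. restrict (g \<circ> f) (verts G)) (automorphisms G)
      {i \<in> verts G \<rightarrow>\<^sub>E verts H. iso_map i G H}"
  proof (rule bij_betwI[where g = "\<lambda>i x. if x \<in> verts G then ?h (i x) else x"])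
    show "(\<lambda>f. restrict (g \<circ> f) (verts G)) \<in> automorphisms G \<rightarrow>
        {i \<in> verts G \<rightarrow>\<^sub>E verts H. iso_map i G H}"
    proof
      fix f assume "f \<in> automorphisms G"
      then have f: "f permutes verts G" "iso_map f G G" by (auto simp: automorphisms_def)
      have "iso_map (restrict (g \<circ> f) (verts G)) G H"
        using comp[OF f(2) g] cong[OF _ lab, of "restrict (g \<circ> f) (verts G)" "g \<circ> f"] by simp
      moreover have "restrict (g \<circ> f) (verts G) \<in> verts G \<rightarrow>\<^sub>E verts H"
        using gH permutes_in_image[OF f(1)] by auto
      ultimately show "restrict (g \<circ> f) (verts G) \<in> {i \<in> verts G \<rightarrow>\<^sub>E verts H. iso_map i G H}"
        by simp
    qed
    show "(\<lambda>i x. if x \<in> verts G then ?h (i x) else x) \<in>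
        {i \<in> verts G \<rightarrow>\<^sub>E verts H. iso_map i G H} \<rightarrow> automorphisms G"
    proof
      fix i assume "i \<in> {i \<in> verts G \<rightarrow>\<^sub>E verts H. iso_map i G H}"
      then have i: "iso_map i G H" by simp
      let ?k = "\<lambda>x. if x \<in> verts G then ?h (i x) else x"
      have k: "iso_map ?k G G"
        using comp[OF i h] cong[OF _ lab, of ?k "?h \<circ> i"] by simp
      then have "bij_betw ?k (verts G) (verts G)" by (simp add: iso_map_def)
      then have "?k permutes verts G" by (rule bij_imp_permutes) simp
      then show "?k \<in> automorphisms G" using k by (simp add: automorphisms_def)
    qed
    show "(\<lambda>x. if x \<in> verts G then ?h (restrict (g \<circ> f) (verts G) x) else x) = f"
      if "f \<in> automorphisms G" for f
    proof
      fix x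
      have f: "f permutes verts G" using that by (simp add: automorphisms_def)
      show "(if x \<in> verts G then ?h (restrict (g \<circ> f) (verts G) x) else x) = f x"
        using hg permutes_in_image[OF f, of x] permutes_not_in[OF f, of x] by simp
    qed
    show "restrict (g \<circ> (\<lambda>x. if x \<in> verts G then ?h (i x) else x)) (verts G) = i"
      if "i \<in> {i \<in> verts G \<rightarrow>\<^sub>E verts H. iso_map i G H}" for i
    proof
      fix x
      show "restrict (g \<circ> (\<lambda>x. if x \<in> verts G then ?h (i x) else x)) (verts G) x = i x"
        using that gh by (auto simp: PiE_iff extensional_def)
    qed
  qed
  then show ?thesis by (rule bij_betw_same_card[symmetric])
qed

lemma automorphisms_pos:
  assumes "is_preflag \<sigma> G"
  shows "0 < card (automorphisms G)"
proof -
  have "finite (automorphisms G)"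
    using finite_permutations[OF finite_verts[OF assms]]
    by (rule finite_subset[rotated]) (auto simp: automorphisms_def)
  moreover have "id \<in> automorphisms G"
    by (simp add: automorphisms_def iso_map_def permutes_id)
  ultimately show ?thesis by (auto simp: card_gt_0_iff)
qed

text \<open>
  An embedding is determined by its image \<open>S\<close> and by an isomorphism to the subtournament on \<open>S\<close>.
\<close>

lemma card_embeddings:
  assumes P: "is_preflag Type_0 P" and G: "is_preflag Type_0 G"
  shows "card (embeddings (verts P) (arcs P) (verts G) (arcs G)) =
    card (automorphisms P) * card {S \<in> rooted_sets G (card (verts P)). subflag G S = abs_flag P}"
proof -
  let ?W = "verts P" and ?V = "verts G"
  let ?I = "embeddings ?W (arcs P) ?V (arcs G)"
  let ?S = "{S \<in> rooted_sets G (card ?W). subflag G S = abs_flag P}"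
  have TP: "tournament ?W (arcs P)" and TG: "tournament ?V (arcs G)"
    using P G by (simp_all add: is_preflag_def)
  have lab: "labels P = []" "labels G = []" using P G by (simp_all add: is_preflag_def)
  have fin: "finite ?I"
    unfolding embeddings_def
    using finite_PiE[of ?W "\<lambda>_. ?V"] finite_verts[OF P] finite_verts[OF G] by simp
  have arc: "(i u, i v) \<in> arcs G \<longleftrightarrow> (u, v) \<in> arcs P" if i: "i \<in> ?I" and uv: "u \<in> ?W" "v \<in> ?W" for i u v
  proof
    assume e: "(i u, i v) \<in> arcs G"
    have "u \<noteq> v" using preflag_arcsD(3)[OF G e] by auto
    moreover have "(v, u) \<notin> arcs P"
      using preflag_arcsD(4)[OF G e] i by (auto simp: embeddings_def)
    ultimately show "(u, v) \<in> arcs P" using tournamentD(4)[OF TP uv] by simp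
  qed (use i in \<open>auto simp: embeddings_def\<close>)
  have iso: "iso_map i P (induced G (i ` ?W))" if i: "i \<in> ?I" for i
    using i arc[OF i] lab by (auto simp: iso_map_def embeddings_def bij_betw_def)
  have im: "i ` ?W \<in> ?S" if i: "i \<in> ?I" for i
  proof -
    have "inj_on i ?W" "i ` ?W \<subseteq> ?V" using i by (auto simp: embeddings_def)
    then have S: "i ` ?W \<in> rooted_sets G (card ?W)"
      using lab by (simp add: rooted_sets_def card_image)
    then show ?thesis
      using abs_flag_eqI[OF P is_preflag_rooted[OF G S] iso[OF i]] by simp
  qed
  have fib: "{i \<in> ?I. i ` ?W = S} = {i \<in> ?W \<rightarrow>\<^sub>E S. iso_map i P (induced G S)}" if S: "S \<in> ?S" for S
  proof (intro equalityI subsetI)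
    fix i assume "i \<in> {i \<in> ?I. i ` ?W = S}"
    then have i: "i \<in> ?I" and S: "S = i ` ?W" by auto
    have "i \<in> ?W \<rightarrow>\<^sub>E S" using i S by (auto simp: embeddings_def)
    then show "i \<in> {i \<in> ?W \<rightarrow>\<^sub>E S. iso_map i P (induced G S)}" using iso[OF i] S by simp
  next
    fix i assume i: "i \<in> {i \<in> ?W \<rightarrow>\<^sub>E S. iso_map i P (induced G S)}"
    have SV: "S \<subseteq> ?V" using S rooted_setsD(2) by blast
    have b: "inj_on i ?W" "i ` ?W = S" using i by (auto simp: iso_map_def bij_betw_def)
    have "(i a, i b) \<in> arcs G" if "(a, b) \<in> arcs P" for a b
      using i that preflag_arcsD(1,2)[OF P that] by (auto simp: iso_map_def)
    moreover have "i \<in> ?W \<rightarrow>\<^sub>E ?V" using i SV by (auto simp: PiE_iff)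
    ultimately show "i \<in> {i \<in> ?I. i ` ?W = S}" using b by (auto simp: embeddings_def)
  qed
  have "card ?I = (\<Sum>i\<in>?I. 1)" by simp
  also have "\<dots> = (\<Sum>S\<in>?S. \<Sum>i\<in>{i \<in> ?I. i ` ?W = S}. 1)"
    by (rule sum.group[symmetric, OF fin]) (use im finite_rooted_sets[OF G] in auto)
  also have "\<dots> = (\<Sum>S\<in>?S. card (automorphisms P))"
  proof (rule sum.cong[OF refl])
    fix S assume S: "S \<in> ?S"
    then have "is_preflag Type_0 (induced G S)" "abs_flag P = subflag G S"
      using is_preflag_rooted[OF G] by auto
    from card_isomorphisms[OF P this] show "(\<Sum>i\<in>{i \<in> ?I. i ` ?W = S}. 1) = card (automorphisms P)"
      unfolding fib[OF S] by simp
  qed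
  finally show ?thesis by (simp add: mult.commute)
qed

section \<open>Quasi-randomness from two moments\<close>

lemma card_arcs_choose: "tournament W A \<Longrightarrow> card A = card W choose 2"
  unfolding choose_two using card_arcs[of W A] by simp

text \<open>Tournaments of small deviation contain every tournament as often as random ones do.\<close>

lemma density_near_phi_qr:
  assumes F: "F \<in> flags Type_0" and G: "is_preflag Type_0 G"
    and n: "flag_size F \<le> card (verts G)" and m0: "0 < card (verts G)" and \<delta>: "0 < \<delta>"
  shows "\<bar>density F (abs_flag G) - phi_qr F\<bar> \<le>
    real (flag_size F choose 2) * real (flag_size F) ^ flag_size F *
    (\<delta> + deviation (verts G) (arcs G) / (real (card (verts G)) ^ 4 * \<delta> ^ 3))"
proof -
  let ?P = "rep_flag F"
  define n where "n = flag_size F"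
  define m where "m = card (verts G)"
  define k where "k = n choose 2"
  define e where "e = \<delta> + deviation (verts G) (arcs G) / (real m ^ 4 * \<delta> ^ 3)"
  define a where "a = real (card (automorphisms ?P))"
  define C where "C = real (m choose n)"
  define c where "c = real (card {S \<in> rooted_sets G n. subflag G S = F})"
  have P: "is_preflag Type_0 ?P" by (rule preflag_rep[OF F])
  have TP: "tournament (verts ?P) (arcs ?P)" and TG: "tournament (verts G) (arcs G)"
    using P G by (simp_all add: is_preflag_def)
  have cP: "card (verts ?P) = n" by (simp add: n_def flag_size_def)
  have k: "card (arcs ?P) = k" using card_arcs_choose[OF TP] by (simp add: cP k_def)
  have nm: "n \<le> m" and m: "0 < m" using n m0 by (simp_all add: n_def m_def)
  have a: "1 \<le> a" using automorphisms_pos[OF P] by (simp add: a_def)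
  have C: "C > 0" using nm by (simp add: C_def zero_less_binomial_iff)
  have e: "0 \<le> e"
    unfolding e_def using \<delta> deviation_nonneg[of "verts G" "arcs G"]
    by (intro add_nonneg_nonneg divide_nonneg_nonneg mult_nonneg_nonneg) simp_all
  have N: "real (card (embeddings (verts ?P) (arcs ?P) (verts G) (arcs G))) = a * c"
    using card_embeddings[OF P G] by (simp add: cP a_def c_def abs_rep_flag)
  have N0: "real (card (embeddings (verts ?P) {} (verts G) (arcs G))) = fact n * C"
    using card_embeddings_empty[OF finite_verts[OF P] finite_verts[OF G], of "arcs G"] nm
    by (simp add: cP C_def m_def)
  have "\<bar>2 ^ k * (a * c) - fact n * C\<bar> \<le> real k * 2 ^ k * (real m ^ (n - 2) * (real m ^ 2 * e))"
    using embeddings_telescope[OF TG TP subset_refl sign_bilinear_le[OF TG m0 \<delta>]]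
    unfolding N N0 k cP by (simp only: m_def e_def)
  then have "\<bar>2 ^ k * (a * c) - fact n * C\<bar> / (a * 2 ^ k * C) \<le>
      real k * 2 ^ k * (real m ^ (n - 2) * (real m ^ 2 * e)) / (a * 2 ^ k * C)"
    using a C by (intro divide_right_mono) auto
  also have "\<dots> = real k * (real m ^ (n - 2) * (real m ^ 2 * e)) / (a * C)"
    by simp
  also have "\<dots> \<le> real k * (real m ^ (n - 2) * (real m ^ 2 * e)) / (1 * C)"
    using a C e by (intro divide_left_mono mult_right_mono) auto
  also have "\<dots> \<le> real k * real n ^ n * e"
  proof (cases "k = 0")
    case False
    then have n2: "2 \<le> n" unfolding k_def by (metis binomial_eq_0 not_le)
    have "real m ^ (n - 2) * real m ^ 2 = real m ^ n"
      using power_add[of "real m" "n - 2" 2] by (simp only: le_add_diff_inverse2[OF n2])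
    moreover have "(real m / real n) ^ n \<le> C"
      unfolding C_def by (rule binomial_ge_n_over_k_pow_k[OF nm])
    ultimately have "real m ^ (n - 2) * real m ^ 2 \<le> real n ^ n * C"
      using n2 by (simp add: power_divide divide_le_eq mult.commute)
    then have "real m ^ (n - 2) * real m ^ 2 * e \<le> real n ^ n * C * e"
      using e by (rule mult_right_mono)
    then have "real k * (real m ^ (n - 2) * real m ^ 2 * e) \<le> real k * (real n ^ n * C * e)"
      by (rule mult_left_mono) simp
    then show ?thesis using C by (simp add: divide_le_eq mult_ac)
  qed simp
  finally have "\<bar>2 ^ k * (a * c) - fact n * C\<bar> / (a * 2 ^ k * C) \<le> real k * real n ^ n * e" .
  moreover have "density F (abs_flag G) = c / C"
    unfolding density_abs[OF G] c_def C_def card_eq_sum_of_bool[OF finite_rooted_sets[OF G], symmetric]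
    using card_rooted_sets[OF G, of n] by (simp add: n_def m_def)
  moreover have "phi_qr F = fact n / (a * 2 ^ k)"
    using F by (simp add: phi_qr_def n_def a_def k_def)
  moreover have "c / C - fact n / (a * 2 ^ k) = (2 ^ k * (a * c) - fact n * C) / (a * 2 ^ k * C)"
    using a C by (simp add: field_simps)
  moreover have "\<bar>a * 2 ^ k * C\<bar> = a * 2 ^ k * C" using a C by simp
  ultimately show ?thesis by (simp add: abs_divide e_def n_def m_def k_def)
qed

text \<open>
  For these values of the two sums, the terms of order \<open>m ^ 4\<close> in \<open>deviation_le\<close> cancel.
\<close>

lemma mean_deviation_le:
  assumes \<phi>: "\<phi> \<in> Hom_plus Type_0" and m: "4 \<le> m"
    and t1: "(\<Sum>G\<in>flags_of_size Type_0 m. \<phi> G * triangles (arcs (rep_flag G))) =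
      real m * (real m - 1) * (real m - 2) / 8"
    and t2: "(\<Sum>G\<in>flags_of_size Type_0 m. \<phi> G * triangle_pairs (arcs (rep_flag G))) =
      real m * (real m - 1) * (real m - 2) * (real m - 3) / 32"
  shows "(\<Sum>G\<in>flags_of_size Type_0 m. \<phi> G * deviation (verts (rep_flag G)) (arcs (rep_flag G))) \<le>
    15 * real m ^ 3"
proof -
  let ?m = "flags_of_size Type_0 m" and ?r = "real m"
  define K where "K = 2 * ?r * (?r - 1) * (?r - 4)\<^sup>2 - 8 * ?r\<^sup>2 * (?r - 1) * (?r - 3) + ?r * (?r - 1)\<^sup>2"
  have "(\<Sum>G\<in>?m. \<phi> G * deviation (verts (rep_flag G)) (arcs (rep_flag G))) \<le>
      (\<Sum>G\<in>?m. \<phi> G * (64 * triangle_pairs (arcs (rep_flag G)) +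
        (192 + 32 * ?r) * triangles (arcs (rep_flag G)) + K))"
  proof (rule sum_mono)
    fix G assume G: "G \<in> ?m"
    then have F: "G \<in> flags Type_0" and c: "card (verts (rep_flag G)) = m"
      by (auto simp: flags_of_size_def flag_size_def)
    have "tournament (verts (rep_flag G)) (arcs (rep_flag G))"
      using preflag_rep[OF F] by (simp add: is_preflag_def)
    from deviation_le[OF this] show "\<phi> G * deviation (verts (rep_flag G)) (arcs (rep_flag G)) \<le>
        \<phi> G * (64 * triangle_pairs (arcs (rep_flag G)) +
          (192 + 32 * ?r) * triangles (arcs (rep_flag G)) + K)"
      unfolding c K_def using Hom_plus_nonneg[OF \<phi> F] by (intro mult_left_mono) simp_all
  qed
  also have "\<dots> = 64 * (\<Sum>G\<in>?m. \<phi> G * triangle_pairs (arcs (rep_flag G))) +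
      (192 + 32 * ?r) * (\<Sum>G\<in>?m. \<phi> G * triangles (arcs (rep_flag G))) + K * (\<Sum>G\<in>?m. \<phi> G)"
    by (simp add: distrib_left sum.distrib sum_distrib_left mult_ac)
  also have "\<dots> = ?r * (?r - 1) * (15 * ?r - 5)"
    unfolding t1 t2 Hom_plus_sum[OF \<phi>, of m, simplified] K_def
    by (simp add: power2_eq_square field_simps)
  also have "\<dots> \<le> ?r * ?r * (15 * ?r)"
    using m by (intro mult_mono) auto
  finally show ?thesis by (simp add: power3_eq_cube mult.assoc)
qed

text \<open>
  The value \<open>\<phi> F\<close> is a mean of densities of \<open>F\<close>, each of which differs from \<open>phi_qr F\<close> by an
  error that is linear in the deviation.
\<close>

lemma phi_qr_if_moments:
  assumes \<phi>: "\<phi> \<in> Hom_plus Type_0"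
    and t1: "\<And>m. 4 \<le> m \<Longrightarrow> (\<Sum>G\<in>flags_of_size Type_0 m. \<phi> G * triangles (arcs (rep_flag G))) =
      real m * (real m - 1) * (real m - 2) / 8"
    and t2: "\<And>m. 4 \<le> m \<Longrightarrow> (\<Sum>G\<in>flags_of_size Type_0 m. \<phi> G * triangle_pairs (arcs (rep_flag G))) =
      real m * (real m - 1) * (real m - 2) * (real m - 3) / 32"
  shows "\<phi> = phi_qr"
proof (rule extensionalityI)
  show "\<phi> \<in> extensional (flags Type_0)" using \<phi> by (elim Hom_plusE)
  show "phi_qr \<in> extensional (flags Type_0)" by (simp add: phi_qr_def)
  fix F assume F: "F \<in> flags Type_0"
  define K where "K = real (flag_size F choose 2) * real (flag_size F) ^ flag_size F"
  have K: "0 \<le> K" by (simp add: K_def)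
  have bound: "\<bar>\<phi> F - phi_qr F\<bar> * real j \<le> 16 * K" if j: "4 \<le> j" "flag_size F \<le> j" for j
  proof -
    \<comment> \<open>\<open>m = j ^ 4\<close> and \<open>\<delta> = 1 / j\<close> balance the two error terms \<open>\<delta>\<close> and \<open>1 / (m \<delta> ^ 3)\<close>\<close>
    define m where "m = j ^ 4"
    define \<delta> where "\<delta> = 1 / real j"
    let ?m = "flags_of_size Type_0 m"
    let ?d = "\<lambda>G. deviation (verts (rep_flag G)) (arcs (rep_flag G))"
    have jm: "j \<le> m" using j by (simp add: m_def self_le_power)
    have m: "4 \<le> m" "flag_size F \<le> m" "0 < m" using jm j by simp_all
    have \<delta>: "0 < \<delta>" using j by (simp add: \<delta>_def)
    have "\<phi> F - phi_qr F = (\<Sum>G\<in>?m. \<phi> G * (density F G - phi_qr F))"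
      using Hom_plus_chain[OF \<phi> F m(2)] Hom_plus_sum[OF \<phi>, of m]
      by (simp add: right_diff_distrib sum_subtractf mult.commute flip: sum_distrib_left sum_distrib_right)
    also have "\<bar>\<dots>\<bar> \<le> (\<Sum>G\<in>?m. \<phi> G * (K * (\<delta> + ?d G / (real m ^ 4 * \<delta> ^ 3))))"
    proof (rule order_trans[OF sum_abs sum_mono])
      fix G assume "G \<in> ?m"
      then have G: "G \<in> flags Type_0" and c: "card (verts (rep_flag G)) = m"
        by (auto simp: flags_of_size_def flag_size_def)
      have "\<bar>density F G - phi_qr F\<bar> \<le> K * (\<delta> + ?d G / (real m ^ 4 * \<delta> ^ 3))"
        using density_near_phi_qr[OF F preflag_rep[OF G] _ _ \<delta>] m by (simp add: c abs_rep_flag K_def)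
      then show "\<bar>\<phi> G * (density F G - phi_qr F)\<bar> \<le> \<phi> G * (K * (\<delta> + ?d G / (real m ^ 4 * \<delta> ^ 3)))"
        using Hom_plus_nonneg[OF \<phi> G] by (simp add: abs_mult mult_left_mono)
    qed
    also have "\<dots> = K * (\<delta> * (\<Sum>G\<in>?m. \<phi> G) + (\<Sum>G\<in>?m. \<phi> G * ?d G) / (real m ^ 4 * \<delta> ^ 3))"
      by (simp add: distrib_left sum.distrib sum_distrib_left sum_divide_distrib mult_ac)
    also have "\<dots> \<le> K * (\<delta> * 1 + 15 * real m ^ 3 / (real m ^ 4 * \<delta> ^ 3))"
      using mean_deviation_le[OF \<phi> m(1) t1[OF m(1)] t2[OF m(1)]] Hom_plus_sum[OF \<phi>, of m] K \<delta>
      by (intro mult_left_mono add_mono divide_right_mono) auto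
    also have "15 * real m ^ 3 / (real m ^ 4 * \<delta> ^ 3) = 15 / (real m * \<delta> ^ 3)"
      using m by (simp add: power4_eq_xxxx power3_eq_cube)
    also have "\<dots> = 15 / real j"
      using j by (simp add: m_def \<delta>_def power4_eq_xxxx power3_eq_cube)
    also have "K * (\<delta> * 1 + 15 / real j) = 16 * K / real j"
      by (simp add: \<delta>_def field_simps)
    finally show ?thesis using j by (simp add: le_divide_eq)
  qed
  show "\<phi> F = phi_qr F"
  proof (rule ccontr)
    assume "\<phi> F \<noteq> phi_qr F"
    then have pos: "0 < \<bar>\<phi> F - phi_qr F\<bar>" by simp
    obtain j0 :: nat where j0: "16 * K / \<bar>\<phi> F - phi_qr F\<bar> < real j0"
      using reals_Archimedean2 by blast
    define j where "j = j0 + 4 + flag_size F"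
    have "16 * K < \<bar>\<phi> F - phi_qr F\<bar> * real j0"
      using j0 pos by (simp add: divide_less_eq mult.commute)
    also have "\<dots> \<le> \<bar>\<phi> F - phi_qr F\<bar> * real j"
      by (intro mult_left_mono) (simp_all add: j_def)
    also have "\<dots> \<le> 16 * K" by (rule bound) (simp_all add: j_def)
    finally show False by simp
  qed
qed

section \<open>Counting labelled tournaments\<close>

definition tournaments :: "'a set \<Rightarrow> ('a \<times> 'a) set set" where
  "tournaments V = {E. tournament V E}"

lemma finite_tournaments: "finite V \<Longrightarrow> finite (tournaments V)"
  by (rule finite_subset[of _ "Pow (V \<times> V)"]) (auto simp: tournaments_def tournament_def)

lemma tournamentI:
  assumes "finite V" "E \<subseteq> V \<times> V" "\<And>v. (v, v) \<notin> E"
    "\<And>u v. u \<in> V \<Longrightarrow> v \<in> V \<Longrightarrow> u \<noteq> v \<Longrightarrow> (u, v) \<in> E \<longleftrightarrow> (v, u) \<notin> E"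
  shows "tournament V E"
  unfolding tournament_def using assms by blast

lemma tournament_flip:
  assumes E: "tournament V E" and ab: "(a, b) \<in> E"
  shows "tournament V (insert (b, a) (E - {(a, b)}))"
proof (rule tournamentI)
  note D = tournamentD[OF E]
  have V: "a \<in> V" "b \<in> V" and ne: "a \<noteq> b" using ab D(2) D(3)[of a] by auto
  have ba: "(b, a) \<notin> E" using D(4)[OF V ne] ab by simp
  show "finite V" by (rule D(1))
  show "insert (b, a) (E - {(a, b)}) \<subseteq> V \<times> V" using D(2) V by blast
  show "(v, v) \<notin> insert (b, a) (E - {(a, b)})" for v using D(3)[of v] ne by auto
  fix u v assume uv: "u \<in> V" "v \<in> V" "u \<noteq> v"
  show "(u, v) \<in> insert (b, a) (E - {(a, b)}) \<longleftrightarrow> (v, u) \<notin> insert (b, a) (E - {(a, b)})"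
    using D(4)[OF uv] ba ab ne by auto
qed

text \<open>
  Half of the tournaments that contain \<open>D\<close> also contain a given further arc, since that arc may
  be reversed.
\<close>

lemma card_tournaments_containing:
  assumes V: "finite V" and D: "D \<subseteq> V \<times> V" and asym: "\<And>a b. (a, b) \<in> D \<Longrightarrow> (b, a) \<notin> D"
  shows "card {E \<in> tournaments V. D \<subseteq> E} * 2 ^ card D = card (tournaments V)"
proof -
  have "finite D" using D finite_cartesian_product[OF V V] by (rule finite_subset)
  then show ?thesis using D asym
  proof (induction D rule: finite_induct)
    case (insert p D)
    obtain a b where p: "p = (a, b)" by (cases p)
    have V2: "a \<in> V" "b \<in> V" using insert.prems(1) p by auto
    have ne: "a \<noteq> b" using insert.prems(2)[of a b] p by auto
    have ba: "(b, a) \<notin> D" using insert.prems(2)[of a b] p by auto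
    have ab: "(a, b) \<notin> D" using insert.hyps(2) p by simp
    define T where "T x y = {E \<in> tournaments V. insert (x, y) D \<subseteq> E}" for x y
    have fin: "finite (T x y)" for x y using finite_tournaments[OF V] by (simp add: T_def)
    have flip: "insert (y, x) (E - {(x, y)}) \<in> T y x" if "E \<in> T x y" "(x, y) \<notin> D" for E x y
      using that tournament_flip[of V E x y] by (auto simp: T_def tournaments_def)
    have undo: "insert (x, y) (insert (y, x) (E - {(x, y)}) - {(y, x)}) = E"
      if "E \<in> T x y" "x \<noteq> y" for E x y
    proof -
      have "tournament V E" "(x, y) \<in> E" using that by (auto simp: T_def tournaments_def)
      moreover have "x \<in> V" "y \<in> V" using calculation tournamentD(2) by blast+
      ultimately have "(y, x) \<notin> E" using tournamentD(4)[of V E x y] that(2) by simp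
      with \<open>(x, y) \<in> E\<close> show ?thesis by auto
    qed
    have "bij_betw (\<lambda>E. insert (b, a) (E - {(a, b)})) (T a b) (T b a)"
      by (rule bij_betwI[where g = "\<lambda>E. insert (a, b) (E - {(b, a)})"])
        (use flip ab ba undo ne in auto)
    then have same: "card (T a b) = card (T b a)" by (rule bij_betw_same_card)
    have arc: "(a, b) \<in> E \<longleftrightarrow> (b, a) \<notin> E" if "E \<in> tournaments V" for E
      using that tournamentD(4)[OF _ V2 ne, of E] by (simp add: tournaments_def)
    have "E \<in> {E \<in> tournaments V. D \<subseteq> E} \<longleftrightarrow> E \<in> T a b \<union> T b a" for E
      using arc[of E] by (cases "E \<in> tournaments V") (auto simp: T_def)
    then have union: "{E \<in> tournaments V. D \<subseteq> E} = T a b \<union> T b a" by blast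
    have "E \<notin> T a b \<inter> T b a" for E
      using arc[of E] by (cases "E \<in> tournaments V") (auto simp: T_def)
    then have disj: "T a b \<inter> T b a = {}" by blast
    have "card {E \<in> tournaments V. D \<subseteq> E} = 2 * card (T a b)"
      unfolding union card_Un_disjoint[OF fin fin disj] same[symmetric] by simp
    moreover have "card {E \<in> tournaments V. D \<subseteq> E} * 2 ^ card D = card (tournaments V)"
    proof (rule insert.IH)
      show "D \<subseteq> V \<times> V" using insert.prems(1) by simp
      show "(y, x) \<notin> D" if "(x, y) \<in> D" for x y using insert.prems(2)[of x y] that by simp
    qed
    ultimately show ?case using insert.hyps by (simp add: T_def p)
  qed simp
qed

text \<open>
  Apply the previous lemma to all arcs of the transitive tournament, which is the only tournament
  that contains them.
\<close>

lemma card_tournaments: "card (tournaments {..<m :: nat}) = 2 ^ (m choose 2)"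
proof -
  let ?V = "{..<m}"
  define L where "L = {(a, b). a < b \<and> b < m}"
  have L: "tournament ?V L" by (rule tournamentI) (auto simp: L_def)
  have "{E \<in> tournaments ?V. L \<subseteq> E} = {L}"
  proof (intro equalityI subsetI)
    fix E assume E: "E \<in> {E \<in> tournaments ?V. L \<subseteq> E}"
    then have T: "tournament ?V E" and sub: "L \<subseteq> E" by (auto simp: tournaments_def)
    have "finite E" using finite_tournament(2)[OF T] .
    moreover have "card L = card E" using card_arcs_choose[OF L] card_arcs_choose[OF T] by simp
    ultimately show "E \<in> {L}" using card_subset_eq[OF _ sub] by simp
  qed (use L in \<open>auto simp: tournaments_def\<close>)
  moreover have "card {E \<in> tournaments ?V. L \<subseteq> E} * 2 ^ card L = card (tournaments ?V)"
    by (rule card_tournaments_containing) (auto simp: L_def)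
  ultimately show ?thesis using card_arcs_choose[OF L] by simp
qed

abbreviation on_vertices :: "nat \<Rightarrow> (nat \<times> nat) set \<Rightarrow> preflag" where
  "on_vertices m E \<equiv> \<lparr>verts = {..<m}, arcs = E, labels = []\<rparr>"

text \<open>
  Every bijection from a tournament to \<open>{..<m}\<close> transports it to a tournament on \<open>{..<m}\<close>, and
  each isomorphic tournament arises from as many bijections as there are automorphisms.
\<close>

lemma card_labelled_copies:
  assumes G: "G \<in> flags_of_size Type_0 m"
  shows "card {E \<in> tournaments {..<m}. abs_flag (on_vertices m E) = G} *
    card (automorphisms (rep_flag G)) = fact m"
proof -
  let ?R = "rep_flag G" and ?T = "{E \<in> tournaments {..<m}. abs_flag (on_vertices m E) = G}"
  let ?I = "embeddings (verts ?R) {} {..<m} ({} :: (nat \<times> nat) set)"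
  have R: "is_preflag Type_0 ?R" and c: "card (verts ?R) = m"
    using G by (auto simp: flags_of_size_def flags_def flag_size_def)
  have TR: "tournament (verts ?R) (arcs ?R)" and labR: "labels ?R = []"
    using R by (simp_all add: is_preflag_def)
  note DR = tournamentD[OF TR]
  have pre: "is_preflag Type_0 (on_vertices m E)" if "E \<in> tournaments {..<m}" for E
    using that by (simp add: is_preflag_def tournaments_def)
  have cI: "card ?I = fact m"
  proof -
    have "real (card ?I) = real (fact m)"
      using card_embeddings_empty[OF finite_verts[OF R], of "{..<m}" "{}"] by (simp add: c)
    then show ?thesis by (simp only: of_nat_eq_iff)
  qed
  have "finite ({..<m} :: nat set)" by simp
  then have fin: "finite ?I" using cI by (metis card.infinite fact_nonzero)
  define push where "push i = map_prod i i ` arcs ?R" for i :: "nat \<Rightarrow> nat"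
  have bij: "bij_betw i (verts ?R) {..<m}" if "i \<in> ?I" for i
  proof -
    have i: "inj_on i (verts ?R)" "i ` verts ?R \<subseteq> {..<m}" using that by (auto simp: embeddings_def)
    then have "i ` verts ?R = {..<m}" by (intro card_subset_eq) (simp_all add: card_image c)
    then show ?thesis using i by (simp add: bij_betw_def)
  qed
  have arc: "(i u, i v) \<in> push i \<longleftrightarrow> (u, v) \<in> arcs ?R"
    if i: "i \<in> ?I" and uv: "u \<in> verts ?R" "v \<in> verts ?R" for i u v
  proof
    assume "(i u, i v) \<in> push i"
    then obtain a b where ab: "(a, b) \<in> arcs ?R" "i u = i a" "i v = i b" by (auto simp: push_def)
    have "inj_on i (verts ?R)" using bij[OF i] by (simp add: bij_betw_def)
    then have "u = a" "v = b"
      using ab uv preflag_arcsD(1,2)[OF R ab(1)] by (auto dest: inj_onD)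
    then show "(u, v) \<in> arcs ?R" using ab by simp
  qed (force simp: push_def)
  have push_T: "push i \<in> tournaments {..<m}" if i: "i \<in> ?I" for i
  proof -
    have im: "i ` verts ?R = {..<m}" and inj: "inj_on i (verts ?R)"
      using bij[OF i] by (auto simp: bij_betw_def)
    have "tournament {..<m} (push i)"
    proof (rule tournamentI)
      show sub: "push i \<subseteq> {..<m} \<times> {..<m}"
      proof
        fix p assume "p \<in> push i"
        then obtain u v where uv: "(u, v) \<in> arcs ?R" "p = (i u, i v)" by (auto simp: push_def)
        then show "p \<in> {..<m} \<times> {..<m}"
          using preflag_arcsD(1,2)[OF R uv(1)] im by blast
      qed
      show "(x, x) \<notin> push i" for x
      proof
        assume x: "(x, x) \<in> push i"
        then have "x \<in> i ` verts ?R" using sub im by blast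
        then obtain u where u: "x = i u" "u \<in> verts ?R" by blast
        show False using x arc[OF i u(2,2)] DR(3) by (simp add: u(1))
      qed
      fix x y :: nat assume "x \<in> {..<m}" "y \<in> {..<m}" "x \<noteq> y"
      then obtain u v where uv: "x = i u" "y = i v" "u \<in> verts ?R" "v \<in> verts ?R" "u \<noteq> v"
        unfolding im[symmetric] by blast
      then show "(x, y) \<in> push i \<longleftrightarrow> (y, x) \<notin> push i"
        using arc[OF i uv(3,4)] arc[OF i uv(4,3)] DR(4)[OF uv(3,4,5)] by simp
    qed simp
    then show ?thesis by (simp add: tournaments_def)
  qed
  have iso: "iso_map i ?R (on_vertices m (push i))" if i: "i \<in> ?I" for i
    using bij[OF i] arc[OF i] labR by (simp add: iso_map_def)
  have push_in: "push i \<in> ?T" if i: "i \<in> ?I" for i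
    using push_T[OF i] abs_flag_eqI[OF R pre[OF push_T[OF i]] iso[OF i]] by (simp add: abs_rep_flag)
  have fib: "{i \<in> ?I. push i = E} = {i \<in> verts ?R \<rightarrow>\<^sub>E {..<m}. iso_map i ?R (on_vertices m E)}"
    if E: "E \<in> ?T" for E
  proof (intro equalityI subsetI)
    fix i assume "i \<in> {i \<in> ?I. push i = E}"
    then show "i \<in> {i \<in> verts ?R \<rightarrow>\<^sub>E {..<m}. iso_map i ?R (on_vertices m E)}"
      using iso by (auto simp: embeddings_def)
  next
    fix i assume i: "i \<in> {i \<in> verts ?R \<rightarrow>\<^sub>E {..<m}. iso_map i ?R (on_vertices m E)}"
    then have iI: "i \<in> ?I" by (auto simp: embeddings_def iso_map_def bij_betw_def)
    have im: "i ` verts ?R = {..<m}" using bij[OF iI] by (simp add: bij_betw_def)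
    have sub: "E \<subseteq> {..<m} \<times> {..<m}" "push i \<subseteq> {..<m} \<times> {..<m}"
      using E push_T[OF iI] tournamentD(2) by (auto simp: tournaments_def)
    have "(x, y) \<in> push i \<longleftrightarrow> (x, y) \<in> E" for x y
    proof (cases "x \<in> {..<m} \<and> y \<in> {..<m}")
      case True
      then obtain u v where uv: "x = i u" "y = i v" "u \<in> verts ?R" "v \<in> verts ?R"
        unfolding im[symmetric] by blast
      then show ?thesis using arc[OF iI uv(3,4)] i by (simp add: iso_map_def)
    next
      case False
      then show ?thesis using sub by blast
    qed
    then have "push i = E" by auto
    with iI show "i \<in> {i \<in> ?I. push i = E}" by simp
  qed
  have finT: "finite ?T" using finite_tournaments[of "{..<m}"] by simp
  have "card ?I = (\<Sum>i\<in>?I. 1)" by simp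
  also have "\<dots> = (\<Sum>E\<in>?T. \<Sum>i\<in>{i \<in> ?I. push i = E}. 1)"
    by (rule sum.group[symmetric, OF fin finT]) (use push_in in auto)
  also have "\<dots> = (\<Sum>E\<in>?T. card (automorphisms ?R))"
  proof (rule sum.cong[OF refl])
    fix E assume E: "E \<in> ?T"
    then have "is_preflag Type_0 (on_vertices m E)" "abs_flag ?R = abs_flag (on_vertices m E)"
      using pre by (auto simp: abs_rep_flag)
    from card_isomorphisms[OF R this] show "(\<Sum>i\<in>{i \<in> ?I. push i = E}. 1) = card (automorphisms ?R)"
      unfolding fib[OF E] by simp
  qed
  finally show ?thesis using cI by simp
qed

text \<open>The quasi-random homomorphism averages over all tournaments on a fixed vertex set.\<close>

lemma sum_phi_qr:
  "(\<Sum>G\<in>flags_of_size Type_0 m. phi_qr G * h G) =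
    (\<Sum>E\<in>tournaments {..<m}. h (abs_flag (on_vertices m E))) / 2 ^ (m choose 2)"
proof -
  let ?m = "flags_of_size Type_0 m" and ?T = "tournaments {..<m}"
  have "abs_flag (on_vertices m E) \<in> ?m" if "E \<in> ?T" for E
  proof -
    have pre: "is_preflag Type_0 (on_vertices m E)"
      using that by (simp add: is_preflag_def tournaments_def)
    show ?thesis
      using abs_flag_in_flags[OF pre] flag_size_abs[OF pre] by (simp add: flags_of_size_def)
  qed
  then have "(\<Sum>E\<in>?T. h (abs_flag (on_vertices m E))) =
      (\<Sum>G\<in>?m. \<Sum>E\<in>{E \<in> ?T. abs_flag (on_vertices m E) = G}. h (abs_flag (on_vertices m E)))"
    by (intro sum.group[symmetric] finite_tournaments finite_flags_of_size) auto
  also have "\<dots> = (\<Sum>G\<in>?m. real (card {E \<in> ?T. abs_flag (on_vertices m E) = G}) * h G)"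
    by (intro sum.cong refl) simp
  also have "\<dots> = (\<Sum>G\<in>?m. 2 ^ (m choose 2) * (phi_qr G * h G))"
  proof (rule sum.cong[OF refl])
    fix G assume G: "G \<in> ?m"
    define a where "a = card (automorphisms (rep_flag G))"
    have F: "G \<in> flags Type_0" "flag_size G = m" using G by (auto simp: flags_of_size_def)
    have a: "0 < a" using automorphisms_pos[OF preflag_rep[OF F(1)]] by (simp add: a_def)
    have "real (card {E \<in> ?T. abs_flag (on_vertices m E) = G} * a) = real (fact m)"
      using card_labelled_copies[OF G] by (simp only: a_def)
    then have "real (card {E \<in> ?T. abs_flag (on_vertices m E) = G}) = fact m / real a"
      using a by (simp add: field_simps)
    moreover have "2 ^ (m choose 2) * phi_qr G = fact m / real a"
      using F by (simp add: phi_qr_def a_def)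
    ultimately show "real (card {E \<in> ?T. abs_flag (on_vertices m E) = G}) * h G =
        2 ^ (m choose 2) * (phi_qr G * h G)" by (simp only: mult.assoc[symmetric])
  qed
  finally show ?thesis by (simp flip: sum_distrib_left)
qed

section \<open>The two moments of the quasi-random homomorphism\<close>

lemma sum_arcs_of_bool:
  assumes T: "tournament V E"
  shows "(\<Sum>(u, v)\<in>E. h u v) = (\<Sum>u\<in>V. \<Sum>v\<in>V. of_bool ((u, v) \<in> E) * (h u v :: real))"
proof -
  have "(\<Sum>(u, v)\<in>E. h u v) = (\<Sum>p\<in>V \<times> V. of_bool (p \<in> E) * h (fst p) (snd p))"
    using tournamentD(1,2)[OF T] by (intro sum.mono_neutral_cong_left) auto
  then show ?thesis by (simp add: sum.cartesian_product case_prod_unfold)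
qed

lemma card_midverts_sum:
  assumes T: "tournament V E"
  shows "real (card (midverts E u v)) = (\<Sum>w\<in>V. of_bool (w \<in> midverts E u v))"
proof -
  have "midverts E u v = {w \<in> V. w \<in> midverts E u v}"
    using tournamentD(2)[OF T] by (auto simp: midverts_def)
  then show ?thesis
    using card_eq_sum_of_bool[OF tournamentD(1)[OF T], of "\<lambda>w. w \<in> midverts E u v"] by simp
qed

lemma triangles_sum:
  assumes T: "tournament V E"
  shows "triangles E = (\<Sum>u\<in>V. \<Sum>v\<in>V. \<Sum>w\<in>V. of_bool ({(u, v), (u, w), (w, v)} \<subseteq> E))"
  unfolding triangles_def sum_arcs_of_bool[OF T] card_midverts_sum[OF T] sum_distrib_left
  by (intro sum.cong refl) (simp add: midverts_def flip: of_bool_conj)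

lemma triangle_pairs_sum:
  assumes T: "tournament V E"
  shows "triangle_pairs E = (\<Sum>u\<in>V. \<Sum>v\<in>V. \<Sum>w\<in>V. \<Sum>z\<in>V.
    of_bool (w \<noteq> z) * of_bool ({(u, v), (u, w), (w, v), (u, z), (z, v)} \<subseteq> E))"
proof -
  have "real (card (midverts E u v)) * (real (card (midverts E u v)) - 1) =
      (\<Sum>w\<in>V. \<Sum>z\<in>V. of_bool (w \<noteq> z) * of_bool (w \<in> midverts E u v \<and> z \<in> midverts E u v))" for u v
  proof -
    let ?b = "\<lambda>w. of_bool (w \<in> midverts E u v) :: real"
    have "(\<Sum>w\<in>V. \<Sum>z\<in>V. of_bool (w \<noteq> z) * of_bool (w \<in> midverts E u v \<and> z \<in> midverts E u v)) =
        (\<Sum>w\<in>V. \<Sum>z\<in>V. ?b w * ?b z - (if w = z then ?b w else 0))"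
      by (intro sum.cong refl) auto
    also have "\<dots> = (\<Sum>w\<in>V. \<Sum>z\<in>V. ?b w * ?b z) - (\<Sum>w\<in>V. \<Sum>z\<in>V. if w = z then ?b w else 0)"
      by (simp only: sum_subtractf)
    also have "(\<Sum>w\<in>V. \<Sum>z\<in>V. ?b w * ?b z) = (\<Sum>w\<in>V. ?b w) * (\<Sum>z\<in>V. ?b z)"
      by (simp only: sum_product)
    also have "(\<Sum>w\<in>V. \<Sum>z\<in>V. if w = z then ?b w else 0) = (\<Sum>w\<in>V. ?b w)"
      using tournamentD(1)[OF T] by (intro sum.cong refl) simp
    finally show ?thesis by (simp add: card_midverts_sum[OF T] algebra_simps)
  qed
  then have "triangle_pairs E = (\<Sum>u\<in>V. \<Sum>v\<in>V. of_bool ((u, v) \<in> E) *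
      (\<Sum>w\<in>V. \<Sum>z\<in>V. of_bool (w \<noteq> z) * of_bool (w \<in> midverts E u v \<and> z \<in> midverts E u v)))"
    unfolding triangle_pairs_def sum_arcs_of_bool[OF T] by simp
  then show ?thesis
    unfolding sum_distrib_left
    by (simp only:) (intro sum.cong refl, auto simp: midverts_def)
qed

lemma triangles_rep_flag:
  assumes G: "is_preflag Type_0 G" and m: "4 \<le> card (verts G)"
  shows "triangles (arcs (rep_flag (abs_flag G))) = triangles (arcs G)"
    "triangle_pairs (arcs (rep_flag (abs_flag G))) = triangle_pairs (arcs G)"
proof -
  let ?R = "rep_flag (abs_flag G)"
  have R: "is_preflag Type_0 ?R" by (rule preflag_rep[OF abs_flag_in_flags[OF G]])
  have c: "card (verts ?R) = card (verts G)"
    using flag_size_abs[OF G] by (simp add: flag_size_def)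
  show "triangles (arcs ?R) = triangles (arcs G)"
    using labelling_prob_Tr3A[OF R] labelling_prob_Tr3A[OF G] m by (simp add: c abs_rep_flag)
  show "triangle_pairs (arcs ?R) = triangle_pairs (arcs G)"
    using labelling_prob_Tr3A_square[OF R] labelling_prob_Tr3A_square[OF G] m by (simp add: c abs_rep_flag)
qed

lemma sum_tournaments_containing:
  assumes D: "D \<subseteq> {..<4} \<times> {..<4 :: nat}" and asym: "\<And>a b. (a, b) \<in> D \<Longrightarrow> (b, a) \<notin> D"
  shows "(\<Sum>E\<in>tournaments {..<4}. of_bool (D \<subseteq> E)) = (64 / 2 ^ card D :: real)"
proof -
  have "real (card {E \<in> tournaments {..<4}. D \<subseteq> E} * 2 ^ card D) = real (card (tournaments {..<4 :: nat}))"
    using card_tournaments_containing[OF _ D asym] by simp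
  also have "\<dots> = 64" by (simp add: card_tournaments choose_two)
  finally have "real (card {E \<in> tournaments {..<4}. D \<subseteq> E}) = 64 / 2 ^ card D"
    by (simp add: field_simps)
  then show ?thesis by (simp only: card_eq_sum_of_bool[OF finite_tournaments[OF finite_lessThan]])
qed

lemma sum_tournaments_containing_loop:
  assumes "(u, u) \<in> D"
  shows "(\<Sum>E\<in>tournaments V. of_bool (D \<subseteq> E) :: real) = 0"
proof (rule sum.neutral, rule ballI)
  fix E assume "E \<in> tournaments V"
  then have "(u, u) \<notin> E" using tournamentD(3) by (simp add: tournaments_def)
  then have "\<not> D \<subseteq> E" using assms by blast
  then show "(of_bool (D \<subseteq> E) :: real) = 0" by simp
qed

text \<open>
  There are \<open>24\<close> triples and \<open>24\<close> quadruples of distinct vertices among four. The arcs required by a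
  triple orient \<open>3\<close> of the \<open>6\<close> pairs and those required by a quadruple orient \<open>5\<close>, which leaves \<open>8\<close>
  and \<open>2\<close> tournaments.
\<close>

lemma sum_tournaments_triangles: "(\<Sum>E\<in>tournaments {..<4 :: nat}. triangles E) = 192"
proof -
  let ?V = "{..<4 :: nat}" and ?D = "\<lambda>u v w. {(u, v), (u, w), (w, v)}"
  have "(\<Sum>E\<in>tournaments ?V. triangles E) =
      (\<Sum>E\<in>tournaments ?V. \<Sum>u\<in>?V. \<Sum>v\<in>?V. \<Sum>w\<in>?V. of_bool (?D u v w \<subseteq> E))"
    by (intro sum.cong refl triangles_sum) (simp add: tournaments_def)
  also have "\<dots> = (\<Sum>u\<in>?V. \<Sum>E\<in>tournaments ?V. \<Sum>v\<in>?V. \<Sum>w\<in>?V. of_bool (?D u v w \<subseteq> E))"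
    by (rule sum.swap)
  also have "\<dots> = (\<Sum>u\<in>?V. \<Sum>v\<in>?V. \<Sum>E\<in>tournaments ?V. \<Sum>w\<in>?V. of_bool (?D u v w \<subseteq> E))"
    by (intro sum.cong refl sum.swap)
  also have "\<dots> = (\<Sum>u\<in>?V. \<Sum>v\<in>?V. \<Sum>w\<in>?V. \<Sum>E\<in>tournaments ?V. of_bool (?D u v w \<subseteq> E))"
    by (intro sum.cong refl sum.swap)
  also have "\<dots> = (\<Sum>u\<in>?V. \<Sum>v\<in>?V. \<Sum>w\<in>?V. if u \<noteq> v \<and> u \<noteq> w \<and> v \<noteq> w then 8 else 0)"
  proof (intro sum.cong refl)
    fix u v w assume V: "u \<in> ?V" "v \<in> ?V" "w \<in> ?V"
    show "(\<Sum>E\<in>tournaments ?V. of_bool (?D u v w \<subseteq> E)) =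
        (if u \<noteq> v \<and> u \<noteq> w \<and> v \<noteq> w then 8 else 0 :: real)"
    proof (cases "u \<noteq> v \<and> u \<noteq> w \<and> v \<noteq> w")
      case True
      then have "card (?D u v w) = 3" by simp
      moreover have "(\<Sum>E\<in>tournaments ?V. of_bool (?D u v w \<subseteq> E)) = (64 / 2 ^ card (?D u v w) :: real)"
        using V True by (intro sum_tournaments_containing) auto
      ultimately show ?thesis using True by simp
    next
      case False
      then obtain x where "(x, x) \<in> ?D u v w" by auto
      then show ?thesis unfolding if_not_P[OF False] by (rule sum_tournaments_containing_loop)
    qed
  qed
  also have "\<dots> = 192" by (simp add: eval_nat_numeral lessThan_Suc)
  finally show ?thesis .
qed

lemma sum_tournaments_triangle_pairs: "(\<Sum>E\<in>tournaments {..<4 :: nat}. triangle_pairs E) = 48"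
proof -
  let ?V = "{..<4 :: nat}" and ?D = "\<lambda>u v w z. {(u, v), (u, w), (w, v), (u, z), (z, v)}"
  let ?b = "\<lambda>u v w z E. of_bool (w \<noteq> z) * of_bool (?D u v w z \<subseteq> E) :: real"
  have "(\<Sum>E\<in>tournaments ?V. triangle_pairs E) =
      (\<Sum>E\<in>tournaments ?V. \<Sum>u\<in>?V. \<Sum>v\<in>?V. \<Sum>w\<in>?V. \<Sum>z\<in>?V. ?b u v w z E)"
    by (intro sum.cong refl triangle_pairs_sum) (simp add: tournaments_def)
  also have "\<dots> = (\<Sum>u\<in>?V. \<Sum>E\<in>tournaments ?V. \<Sum>v\<in>?V. \<Sum>w\<in>?V. \<Sum>z\<in>?V. ?b u v w z E)"
    by (rule sum.swap)
  also have "\<dots> = (\<Sum>u\<in>?V. \<Sum>v\<in>?V. \<Sum>E\<in>tournaments ?V. \<Sum>w\<in>?V. \<Sum>z\<in>?V. ?b u v w z E)"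
    by (intro sum.cong refl sum.swap)
  also have "\<dots> = (\<Sum>u\<in>?V. \<Sum>v\<in>?V. \<Sum>w\<in>?V. \<Sum>E\<in>tournaments ?V. \<Sum>z\<in>?V. ?b u v w z E)"
    by (intro sum.cong refl sum.swap)
  also have "\<dots> = (\<Sum>u\<in>?V. \<Sum>v\<in>?V. \<Sum>w\<in>?V. \<Sum>z\<in>?V. \<Sum>E\<in>tournaments ?V. ?b u v w z E)"
    by (intro sum.cong refl sum.swap)
  also have "\<dots> = (\<Sum>u\<in>?V. \<Sum>v\<in>?V. \<Sum>w\<in>?V. \<Sum>z\<in>?V. if distinct [u, v, w, z] then 2 else 0)"
  proof (intro sum.cong refl)
    fix u v w z assume V: "u \<in> ?V" "v \<in> ?V" "w \<in> ?V" "z \<in> ?V"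
    have "(\<Sum>E\<in>tournaments ?V. ?b u v w z E) =
        of_bool (w \<noteq> z) * (\<Sum>E\<in>tournaments ?V. of_bool (?D u v w z \<subseteq> E))"
      by (rule sum_distrib_left[symmetric])
    also have "\<dots> = (if distinct [u, v, w, z] then 2 else 0)"
    proof (cases "distinct [u, v, w, z]")
      case True
      then have "card (?D u v w z) = 5" by auto
      moreover have "(\<Sum>E\<in>tournaments ?V. of_bool (?D u v w z \<subseteq> E)) = (64 / 2 ^ card (?D u v w z) :: real)"
        using V True by (intro sum_tournaments_containing) auto
      ultimately show ?thesis using True by simp
    next
      case False
      then consider "w = z" | x where "(x, x) \<in> ?D u v w z" by auto
      then show ?thesis
      proof cases
        case 1
        then show ?thesis by simp
      next
        case 2
        then show ?thesis
          unfolding if_not_P[OF False] sum_tournaments_containing_loop[OF 2] by simp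
      qed
    qed
    finally show "(\<Sum>E\<in>tournaments ?V. ?b u v w z E) = (if distinct [u, v, w, z] then 2 else 0)" .
  qed
  also have "\<dots> = 48" by (simp add: eval_nat_numeral lessThan_Suc)
  finally show ?thesis .
qed

lemma phi_qr_moments:
  "(\<Sum>G\<in>flags_of_size Type_0 4. phi_qr G * triangles (arcs (rep_flag G))) = 3"
  "(\<Sum>G\<in>flags_of_size Type_0 4. phi_qr G * triangle_pairs (arcs (rep_flag G))) = 3 / 4"
proof -
  have pre: "is_preflag Type_0 (on_vertices 4 E)" if "E \<in> tournaments {..<4}" for E
    using that by (simp add: is_preflag_def tournaments_def)
  have "(\<Sum>E\<in>tournaments {..<4 :: nat}. triangles (arcs (rep_flag (abs_flag (on_vertices 4 E))))) =
      (\<Sum>E\<in>tournaments {..<4 :: nat}. triangles E)"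
    by (intro sum.cong refl) (simp add: triangles_rep_flag(1)[OF pre])
  then show "(\<Sum>G\<in>flags_of_size Type_0 4. phi_qr G * triangles (arcs (rep_flag G))) = 3"
    by (simp add: sum_phi_qr sum_tournaments_triangles choose_two)
  have "(\<Sum>E\<in>tournaments {..<4 :: nat}. triangle_pairs (arcs (rep_flag (abs_flag (on_vertices 4 E))))) =
      (\<Sum>E\<in>tournaments {..<4 :: nat}. triangle_pairs E)"
    by (intro sum.cong refl) (simp add: triangles_rep_flag(2)[OF pre])
  then show "(\<Sum>G\<in>flags_of_size Type_0 4. phi_qr G * triangle_pairs (arcs (rep_flag G))) = 3 / 4"
    by (simp add: sum_phi_qr sum_tournaments_triangle_pairs choose_two)
qed

text \<open>
  The moment conditions hold for every \<open>m \<ge> 4\<close> if they hold for one. The forward direction needs them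
  for large \<open>m\<close>, whereas the converse checks them where counting is easiest.
\<close>

theorem theorem3p1:
  fixes \<phi> :: "flag \<Rightarrow> real"
    and M :: "'w measure"
    and \<xi> :: "'w \<Rightarrow> flag \<Rightarrow> real"
  assumes "\<phi> \<in> Hom_plus Type_0"
    and "random_extension \<phi> M \<xi>"
  shows "(AE \<omega> in M. \<xi> \<omega> Tr3A = 1 / 4) \<longleftrightarrow> \<phi> = phi_qr"
proof
  assume ae: "AE \<omega> in M. \<xi> \<omega> Tr3A = 1 / 4"
  show "\<phi> = phi_qr"
    using random_extension_AE_iff[OF assms] ae by (intro phi_qr_if_moments[OF assms(1)]) blast+
next
  assume "\<phi> = phi_qr"
  \<comment> \<open>four vertices are the least number that can carry the square of \<open>Tr3A\<close>\<close>
  then show "AE \<omega> in M. \<xi> \<omega> Tr3A = 1 / 4"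
    using random_extension_AE_iff[OF assms, of 4] phi_qr_moments by simp
qed

end
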